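(* Let $(M,J)$ be a compact complex manifold and let $g(t)$, $t\in[0,\tau)$, be a solution of the HCF on $M$. If the Chern curvature $\Omega^{g(0)}$ is dual-Nakano non-negative, then $\Omega^{g(t)}$ is dual-Nakano non-negative for all $t\in(0,\tau)$.
   Context: Einstein summation is used. Hermitian metric: a $J$-invariant Riemannian metric $g$, with components $g_{i\bar j}$ on $T^{1,0}M$ and inverse $g^{i\bar j}$. In holomorphic coordinates the torsion of the Chern connection is $T_{ij}^k=g^{k\bar l}(\partial_i g_{j\bar l}-\partial_j g_{i\bar l})$, with $T_{ij\bar l}=T_{ij}^kg_{k\bar l}$, $T_{\bar i\bar j l}=\overline{T_{ij\bar l}}$, and the Chern curvature is $\Omega_{i\bar jk\bar l}=-\partial_i\partial_{\bar j}g_{k\bar l}+g^{p\bar s}\partial_{\bar j}g_{p\bar l}\,\partial_ig_{k\bar s}$. HCF: $\partial_t g_{i\bar j}=-S^{(2)}_{i\bar j}-Q_{i\bar j}$ for a smooth family of Hermitian metrics $g(t)$, where $S^{(2)}_{i\bar j}=g^{m\bar n}\Omega_{m\bar ni\bar j}$ and $Q_{i\bar j}=\frac12 g^{m\bar n}g^{p\bar s}T_{mp\bar j}T_{\bar n\bar s i}$. Put $\Omega_{i\bar j}{}^{\bar lk}=\Omega_{i\bar jm\bar n}g^{m\bar l}g^{k\bar n}$. The Chern curvature is dual-Nakano non-negative if at every point, as an element of $\mathrm{Sym}^{1,1}(\mathrm{End}(T^{1,0}M))$ (the real span of the elements $w\otimes\bar w$, $w\in\mathrm{End}(T^{1,0}M)$),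 it is positive semidefinite, i.e. $\Omega_{i\bar j}{}^{\bar lk}u^i_k\overline{u^j_l}\ge0$ for every $u=u^i_k\,e_i\otimes\epsilon^k\in\mathrm{End}(T^{1,0}M)$, where $\{e_i\}$ is a frame of $T^{1,0}M$ and $\{\epsilon^i\}$ its dual frame. *)

theory Defs
  imports "HOL-Analysis.Analysis"
begin

section \<open>Smooth and holomorphic maps\<close>

text \<open>
  Derivatives are taken within \<open>S\<close>, so on \<open>{0..<T} \<times> U\<close> with \<open>U\<close> open the derivatives
  in the first variable are one-sided at \<open>0\<close>.  The notion is only used for sets \<open>S\<close> (such as this one
  and open sets) on which derivatives are unique.
\<close>

primrec Ck_on ::
  "nat \<Rightarrow> 'a::real_normed_vector set \<Rightarrow> ('a \<Rightarrow> 'b::real_normed_vector) \<Rightarrow> bool" where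
  "Ck_on 0 S f \<longleftrightarrow> continuous_on S f"
| "Ck_on (Suc k) S f \<longleftrightarrow>
     (\<exists>f'. (\<forall>x\<in>S. (f has_derivative f' x) (at x within S)) \<and> (\<forall>v. Ck_on k S (\<lambda>x. f' x v)))"

definition smooth_on ::
  "'a::real_normed_vector set \<Rightarrow> ('a \<Rightarrow> 'b::real_normed_vector) \<Rightarrow> bool" where
  "smooth_on S f \<longleftrightarrow> (\<forall>k. Ck_on k S f)"

definition holomorphic_map_on :: "(complex^'n) set \<Rightarrow> (complex^'n \<Rightarrow> complex^'m) \<Rightarrow> bool" where
  "holomorphic_map_on S f \<longleftrightarrow>
     (\<forall>x\<in>S. \<exists>D. (f has_derivative D) (at x) \<and> (\<forall>a v. D (a *s v) = a *s D v))"


section \<open>Complex manifolds\<close>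

type_synonym ('a, 'n) chart = "'a set \<times> ('a \<Rightarrow> (complex, 'n) vec)"

definition is_chart :: "'a topology \<Rightarrow> ('a, 'n::finite) chart \<Rightarrow> bool" where
  "is_chart M c \<longleftrightarrow> (case c of (U, \<phi>) \<Rightarrow>
     openin M U \<and> open (\<phi> ` U) \<and> homeomorphic_map (subtopology M U) (top_of_set (\<phi> ` U)) \<phi>)"

text \<open>The point of the manifold with coordinates \<open>x\<close> in the chart \<open>c\<close>.\<close>

definition chart_inv :: "('a, 'n::finite) chart \<Rightarrow> complex^'n \<Rightarrow> 'a" where
  "chart_inv c = inv_into (fst c) (snd c)"

definition transition ::
  "('a, 'n::finite) chart \<Rightarrow> ('a, 'n) chart \<Rightarrow> complex^'n \<Rightarrow> complex^'n" where
  "transition c d = snd d \<circ> chart_inv c"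

definition complex_manifold :: "'a topology \<Rightarrow> ('a, 'n::finite) chart set \<Rightarrow> bool" where
  "complex_manifold M A \<longleftrightarrow>
     Hausdorff_space M \<and> second_countable M \<and>
     (\<forall>c\<in>A. is_chart M c) \<and> (\<Union>c\<in>A. fst c) = topspace M \<and>
     (\<forall>c\<in>A. \<forall>d\<in>A. holomorphic_map_on (snd c ` (fst c \<inter> fst d)) (transition c d))"

text \<open>
  A tangent vector at \<open>p\<close> is the family of its coordinate expressions in all charts of the atlas
  around \<open>p\<close>, related by the differentials of the coordinate changes.  As a real vector space,
  the model of the tangent space is \<open>complex^'n\<close>, i.e. \<open>z = x + i y\<close>.
\<close>

type_synonym ('a, 'n) tvec = "('a, 'n) chart \<Rightarrow> (complex, 'n) vec"

definition charts_at :: "('a, 'n::finite) chart set \<Rightarrow> 'a \<Rightarrow> ('a, 'n) chart set" where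
  "charts_at A p = {c\<in>A. p \<in> fst c}"

definition tangent_space :: "('a, 'n::finite) chart set \<Rightarrow> 'a \<Rightarrow> ('a, 'n) tvec set" where
  "tangent_space A p = {X.
     (\<forall>c\<in>charts_at A p. \<forall>d\<in>charts_at A p.
        X d = frechet_derivative (transition c d) (at (snd c p)) (X c)) \<and>
     (\<forall>c. c \<notin> charts_at A p \<longrightarrow> X c = 0)}"

text \<open>The tangent vector at \<open>p\<close> whose expression in the chart \<open>c\<close> is \<open>v\<close>.\<close>

definition tangent_of ::
  "('a, 'n::finite) chart set \<Rightarrow> ('a, 'n) chart \<Rightarrow> 'a \<Rightarrow> complex^'n \<Rightarrow> ('a, 'n) tvec" where
  "tangent_of A c p v = (\<lambda>d. if d \<in> charts_at A p
     then frechet_derivative (transition c d) (at (snd c p)) v else 0)"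

definition complex_structure :: "('a, 'n::finite) tvec \<Rightarrow> ('a, 'n) tvec" where
  "complex_structure X = (\<lambda>c. \<i> *s X c)"


section \<open>Hermitian metrics\<close>

type_synonym ('a, 'n) metric_field = "'a \<Rightarrow> ('a, 'n) tvec \<Rightarrow> ('a, 'n) tvec \<Rightarrow> real"

definition inner_product_on :: "('a, 'n::finite) tvec set \<Rightarrow> (('a, 'n) tvec \<Rightarrow> ('a, 'n) tvec \<Rightarrow> real) \<Rightarrow> bool" where
  "inner_product_on V b \<longleftrightarrow>
     (\<forall>X\<in>V. \<forall>Y\<in>V. b X Y = b Y X) \<and>
     (\<forall>X\<in>V. \<forall>Y\<in>V. \<forall>Z\<in>V. \<forall>r s. b (\<lambda>c. r *\<^sub>R X c + s *\<^sub>R Y c) Z = r * b X Z + s * b Y Z) \<and>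
     (\<forall>X\<in>V. X \<noteq> (\<lambda>c. 0) \<longrightarrow> b X X > 0)"

definition hermitian_metric ::
  "'a topology \<Rightarrow> ('a, 'n::finite) chart set \<Rightarrow> ('a, 'n) metric_field \<Rightarrow> bool" where
  "hermitian_metric M A h \<longleftrightarrow>
     (\<forall>p\<in>topspace M. inner_product_on (tangent_space A p) (h p)) \<and>
     (\<forall>p\<in>topspace M. \<forall>X\<in>tangent_space A p. \<forall>Y\<in>tangent_space A p.
        h p (complex_structure X) (complex_structure Y) = h p X Y) \<and>
     (\<forall>c\<in>A. \<forall>v w. smooth_on (snd c ` fst c)
        (\<lambda>x. h (chart_inv c x) (tangent_of A c (chart_inv c x) v)
                               (tangent_of A c (chart_inv c x) w)))"

text \<open>
  The entry \<open>(i,j)\<close> of \<open>metric_comp A h c x\<close> is the value of the complex bilinear extension of \<open>h\<close>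
  on the coordinate fields \<open>\<partial>\<^sub>i = (X i - i Y i) / 2\<close> and \<open>\<partial>\<^sub>j\<close>-bar \<open>= (X j + i Y j) / 2\<close>, where
  \<open>X k\<close>, \<open>Y k\<close> are the real coordinate vectors of \<open>z\<^sub>k = x\<^sub>k + i y\<^sub>k\<close>.
\<close>

definition metric_comp ::
  "('a, 'n::finite) chart set \<Rightarrow> ('a, 'n) metric_field \<Rightarrow> ('a, 'n) chart \<Rightarrow>
     complex^'n \<Rightarrow> complex^'n^'n" where
  "metric_comp A h c x = (\<chi> i j.
     let p = chart_inv c x;
         X = (\<lambda>k. tangent_of A c p (axis k 1));
         Y = (\<lambda>k. tangent_of A c p (axis k \<i>))
     in (of_real (h p (X i) (X j)) + of_real (h p (Y i) (Y j))
         + \<i> * (of_real (h p (X i) (Y j)) - of_real (h p (Y i) (X j)))) / 4)"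


section \<open>Chern connection in holomorphic coordinates\<close>

text \<open>
  Below, \<open>G\<close> is the coordinate expression of a Hermitian metric, \<open>G x $ i $ j\<close> being the component
  with first index unbarred and second index barred; the barred indices of all components are those
  that are barred in the standard notation.
\<close>

definition wirtinger :: "'n \<Rightarrow> (complex^'n \<Rightarrow> complex) \<Rightarrow> complex^'n \<Rightarrow> complex" where
  "wirtinger i f x =
     (frechet_derivative f (at x) (axis i 1) - \<i> * frechet_derivative f (at x) (axis i \<i>)) / 2"

definition wirtinger_bar :: "'n \<Rightarrow> (complex^'n \<Rightarrow> complex) \<Rightarrow> complex^'n \<Rightarrow> complex" where
  "wirtinger_bar i f x =
     (frechet_derivative f (at x) (axis i 1) + \<i> * frechet_derivative f (at x) (axis i \<i>)) / 2"

text \<open>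
  The transpose realises the convention that contracting the \<^emph>\<open>barred\<close> indices of the inverse and of
  the metric (or the unbarred ones) gives the Kronecker symbol.
\<close>

definition inv_comp :: "(complex^'n \<Rightarrow> complex^'n^'n) \<Rightarrow> complex^'n \<Rightarrow> 'n \<Rightarrow> 'n \<Rightarrow> complex" where
  "inv_comp G x i j = matrix_inv (transpose (G x)) $ i $ j"

text \<open>\<open>torsion G x i j k\<close> has lower indices \<open>i\<close>, \<open>j\<close> and upper index \<open>k\<close>.\<close>

definition torsion :: "(complex^'n \<Rightarrow> complex^'n^'n) \<Rightarrow> complex^'n \<Rightarrow> 'n \<Rightarrow> 'n \<Rightarrow> 'n \<Rightarrow> complex" where
  "torsion G x i j k = (\<Sum>l\<in>UNIV. inv_comp G x k l *
     (wirtinger i (\<lambda>y. G y $ j $ l) x - wirtinger j (\<lambda>y. G y $ i $ l) x))"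

definition torsion_low :: "(complex^'n \<Rightarrow> complex^'n^'n) \<Rightarrow> complex^'n \<Rightarrow> 'n \<Rightarrow> 'n \<Rightarrow> 'n \<Rightarrow> complex" where
  "torsion_low G x i j l = (\<Sum>k\<in>UNIV. torsion G x i j k * G x $ k $ l)"

definition torsion_low_bar :: "(complex^'n \<Rightarrow> complex^'n^'n) \<Rightarrow> complex^'n \<Rightarrow> 'n \<Rightarrow> 'n \<Rightarrow> 'n \<Rightarrow> complex" where
  "torsion_low_bar G x i j l = cnj (torsion_low G x i j l)"

definition chern_curvature ::
  "(complex^'n \<Rightarrow> complex^'n^'n) \<Rightarrow> complex^'n \<Rightarrow> 'n \<Rightarrow> 'n \<Rightarrow> 'n \<Rightarrow> 'n \<Rightarrow> complex" where
  "chern_curvature G x i j k l =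
     - wirtinger i (wirtinger_bar j (\<lambda>y. G y $ k $ l)) x
     + (\<Sum>p\<in>UNIV. \<Sum>s\<in>UNIV. inv_comp G x p s *
          wirtinger_bar j (\<lambda>y. G y $ p $ l) x * wirtinger i (\<lambda>y. G y $ k $ s) x)"

definition second_chern_ricci :: "(complex^'n \<Rightarrow> complex^'n^'n) \<Rightarrow> complex^'n \<Rightarrow> 'n \<Rightarrow> 'n \<Rightarrow> complex" where
  "second_chern_ricci G x i j =
     (\<Sum>m\<in>UNIV. \<Sum>n\<in>UNIV. inv_comp G x m n * chern_curvature G x m n i j)"

definition torsion_Q :: "(complex^'n \<Rightarrow> complex^'n^'n) \<Rightarrow> complex^'n \<Rightarrow> 'n \<Rightarrow> 'n \<Rightarrow> complex" where
  "torsion_Q G x i j = (1/2) *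
     (\<Sum>m\<in>UNIV. \<Sum>n\<in>UNIV. \<Sum>p\<in>UNIV. \<Sum>s\<in>UNIV.
        inv_comp G x m n * inv_comp G x p s * torsion_low G x m p j * torsion_low_bar G x n s i)"

text \<open>\<open>curvature_up G x i j l k\<close>: lower indices \<open>i\<close>, \<open>j\<close>-bar, upper indices \<open>l\<close>-bar, \<open>k\<close>.\<close>

definition curvature_up ::
  "(complex^'n \<Rightarrow> complex^'n^'n) \<Rightarrow> complex^'n \<Rightarrow> 'n \<Rightarrow> 'n \<Rightarrow> 'n \<Rightarrow> 'n \<Rightarrow> complex" where
  "curvature_up G x i j l k =
     (\<Sum>m\<in>UNIV. \<Sum>n\<in>UNIV. chern_curvature G x i j m n * inv_comp G x m l * inv_comp G x k n)"

text \<open>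
  In the next definition \<open>u $ i $ k\<close> are the components of an endomorphism in the coordinate frame
  of the chart; upper index first.
\<close>

definition dual_Nakano_nonneg ::
  "('a, 'n::finite) chart set \<Rightarrow> ('a, 'n) metric_field \<Rightarrow> bool" where
  "dual_Nakano_nonneg A h \<longleftrightarrow>
     (\<forall>c\<in>A. \<forall>x\<in>snd c ` fst c. \<forall>u :: complex^'n^'n.
        (\<Sum>i\<in>UNIV. \<Sum>j\<in>UNIV. \<Sum>k\<in>UNIV. \<Sum>l\<in>UNIV.
           curvature_up (metric_comp A h c) x i j l k * u $ i $ k * cnj (u $ j $ l)) \<in> \<real>\<^sub>\<ge>\<^sub>0)"


section \<open>The Hermitian curvature flow\<close>

text \<open>Solutions live on \<open>[0, T)\<close>, where \<open>T\<close> may be infinite.\<close>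

definition time_domain :: "ereal \<Rightarrow> real set" where
  "time_domain T = {t. 0 \<le> t \<and> ereal t < T}"

definition smooth_hermitian_family ::
  "'a topology \<Rightarrow> ('a, 'n::finite) chart set \<Rightarrow> ereal \<Rightarrow> (real \<Rightarrow> ('a, 'n) metric_field) \<Rightarrow> bool" where
  "smooth_hermitian_family M A T g \<longleftrightarrow>
     (\<forall>t\<in>time_domain T. hermitian_metric M A (g t)) \<and>
     (\<forall>c\<in>A. \<forall>v w. smooth_on (time_domain T \<times> snd c ` fst c)
        (\<lambda>(t, x). g t (chart_inv c x) (tangent_of A c (chart_inv c x) v)
                                      (tangent_of A c (chart_inv c x) w)))"

definition HCF_solution ::
  "'a topology \<Rightarrow> ('a, 'n::finite) chart set \<Rightarrow> ereal \<Rightarrow> (real \<Rightarrow> ('a, 'n) metric_field) \<Rightarrow> bool" where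
  "HCF_solution M A T g \<longleftrightarrow>
     smooth_hermitian_family M A T g \<and>
     (\<forall>t\<in>time_domain T. \<forall>c\<in>A. \<forall>x\<in>snd c ` fst c. \<forall>i j.
        ((\<lambda>s. metric_comp A (g s) c x $ i $ j) has_vector_derivative
           (- second_chern_ricci (metric_comp A (g t) c) x i j
            - torsion_Q (metric_comp A (g t) c) x i j)) (at t within time_domain T))"

end

theory Submission
  imports Defs "HOL-Complex_Analysis.Cauchy_Integral_Formula"
begin

text \<open>
  In terms of the inverse metric \<open>h\<close> the flow reads
  \<open>\<partial>\<^sub>t h\<^bsup>kl\<^esup> = h\<^bsup>mn\<^esup> \<partial>\<^sub>m\<partial>\<^sub>n h\<^bsup>kl\<^esup> - \<partial>\<^sub>m h\<^bsup>kn\<^esup> \<partial>\<^sub>n h\<^bsup>ml\<^esup>\<close> (second indices and \<open>\<partial>\<^sub>n\<close> barred), and the curvature with two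
  raised indices is the Schur complement of the form
  \<open>M(\<xi>, u) = D\<^sub>k D\<^sub>l h\<^bsup>kl\<^esup>\<close> (\<open>D\<^sub>l\<close> conjugated), where \<open>D\<^sub>k = \<xi>\<^sub>k + u\<^sup>i\<^sub>k \<partial>\<^sub>i\<close>.  So dual-Nakano non-negativity means that \<open>M\<close> is
  positive semidefinite, and \<open>M\<close> is linear in the 2-jet of \<open>h\<close>.

  The maximum principle is applied to \<open>M + \<epsilon> exp(\<kappa> t) I\<close> with \<open>I = g \<otimes> h\<close>.  At a first null vector \<open>w = (\<xi>, u)\<close>
  the second-order condition is used along each vector \<open>b\<^sub>q\<close> of a unitary frame, with \<open>w\<close> varied by \<open>E\<^sub>q\<close>.
  The \<open>u\<close>-part of \<open>E\<^sub>q\<close> is the commutator of \<open>u\<close> with the matrix of the first derivatives of \<open>h\<close>; with this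
  choice all third derivatives of \<open>h\<close> cancel.  The \<open>\<xi>\<close>-part is found by completing a square.  If the
  2-jet form is written as \<open>\<Sum>\<^sub>s V\<^sub>s \<otimes> cnj V\<^sub>s\<close>, what remains is half the sum of the squares
  \<open>|tr(u V\<^sub>s V\<^sub>t) - tr(u V\<^sub>t V\<^sub>s)|\<^sup>2\<close>, in which the torsion terms of the flow supply exactly the missing
  mixed terms, up to an error of size \<open>O(\<epsilon>)\<close> that is absorbed by \<open>\<kappa>\<close>.
\<close>

section \<open>Calculus of smooth functions\<close>

text \<open>Working with the 2-jet of the inverse metric in plain coordinates avoids covariant
  derivatives altogether. The price is that \<open>M\<close> is not a tensor, because second
  derivatives of a coordinate change enter it. They only shift \<xi>, so the set of values of the
  pair (\<open>M\<close>, \<open>I\<close>) at a point is still chart independent, and that is all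
  positivity needs. The perturbation involves u only. For u = 0 the form \<open>M\<close> is the
  inverse metric itself, hence already positive definite, so adding a multiple of \<open>I\<close>
  makes a semidefinite \<open>M\<close> definite. It also keeps \<xi> out of the error term, which
  can therefore be bounded on a compact set of normalised u. The obstacle is the gradient term of
  the evolution: it pairs a matrix c with its transpose and has no sign. The optimal \<xi>-part of
  \<open>E_q\<close> contributes the square of the norm of c; together the two see only the
  antisymmetric part of c, which then fits into the squares of the reaction term.\<close>

lemma Ck_on_cong:
  assumes "Ck_on k S f" and "\<And>x. x \<in> S \<Longrightarrow> f x = g x"
  shows "Ck_on k S g"
proof (cases k)
  case 0
  then show ?thesis using assms by (auto cong: continuous_on_cong)
next
  case (Suc m)
  obtain f' where f': "\<forall>x\<in>S. (f has_derivative f' x) (at x within S)"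
      "\<forall>v. Ck_on m S (\<lambda>x. f' x v)"
    using assms(1) Suc by auto
  have "(g has_derivative f' x) (at x within S)" if "x \<in> S" for x
    using f'(1) that assms(2) by (metis has_derivative_transform)
  then show ?thesis using f' Suc by auto
qed

lemma Ck_on_Suc_D: "Ck_on (Suc k) S f \<Longrightarrow> Ck_on k S f"
proof (induction k arbitrary: f)
  case 0
  then show ?case by (auto intro: has_derivative_continuous_on)
next
  case (Suc k)
  then show ?case by (metis Ck_on.simps(2))
qed

lemma Ck_on_subset: "Ck_on k S f \<Longrightarrow> S' \<subseteq> S \<Longrightarrow> Ck_on k S' f"
proof (induction k arbitrary: f)
  case 0
  then show ?case by (auto intro: continuous_on_subset)
next
  case (Suc k)
  then show ?case by simp (meson has_derivative_subset subsetD)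
qed

lemma Ck_on_const: "Ck_on k S (\<lambda>x. c)"
proof (induction k arbitrary: c)
  case (Suc k)
  then show ?case by (auto intro!: exI[of _ "\<lambda>x v. 0"])
qed auto

lemma Ck_on_add: "Ck_on k S f \<Longrightarrow> Ck_on k S g \<Longrightarrow> Ck_on k S (\<lambda>x. f x + g x)"
proof (induction k arbitrary: f g)
  case 0
  then show ?case by (auto intro: continuous_intros)
next
  case (Suc k)
  obtain f' g' where "\<forall>x\<in>S. (f has_derivative f' x) (at x within S)" "\<forall>v. Ck_on k S (\<lambda>x. f' x v)"
     "\<forall>x\<in>S. (g has_derivative g' x) (at x within S)" "\<forall>v. Ck_on k S (\<lambda>x. g' x v)"
    using Suc.prems by auto
  then show ?case
    by (auto intro!: exI[of _ "\<lambda>x v. f' x v + g' x v"] has_derivative_add Suc.IH)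
qed

lemma Ck_on_bounded_linear:
  assumes "bounded_linear L"
  shows "Ck_on k S f \<Longrightarrow> Ck_on k S (\<lambda>x. L (f x))"
proof (induction k arbitrary: f)
  case 0
  then show ?case using assms by (auto intro: bounded_linear.continuous_on)
next
  case (Suc k)
  obtain f' where f': "\<forall>x\<in>S. (f has_derivative f' x) (at x within S)" "\<forall>v. Ck_on k S (\<lambda>x. f' x v)"
    using Suc.prems by auto
  have "((\<lambda>x. L (f x)) has_derivative (\<lambda>v. L (f' x v))) (at x within S)" if "x \<in> S" for x
    using bounded_linear.has_derivative[OF assms] f'(1) that by blast
  then show ?case using f' Suc.IH by (auto intro!: exI[of _ "\<lambda>x v. L (f' x v)"])
qed

lemma Ck_on_mult:
  fixes f g :: "'a::real_normed_vector \<Rightarrow> 'b::real_normed_algebra"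
  shows "Ck_on k S f \<Longrightarrow> Ck_on k S g \<Longrightarrow> Ck_on k S (\<lambda>x. f x * g x)"
proof (induction k arbitrary: f g)
  case 0
  then show ?case by (auto intro: continuous_intros)
next
  case (Suc k)
  obtain f' g' where *: "\<forall>x\<in>S. (f has_derivative f' x) (at x within S)" "\<forall>v. Ck_on k S (\<lambda>x. f' x v)"
     "\<forall>x\<in>S. (g has_derivative g' x) (at x within S)" "\<forall>v. Ck_on k S (\<lambda>x. g' x v)"
    using Suc.prems by auto
  have "Ck_on k S f" "Ck_on k S g" using Suc.prems Ck_on_Suc_D by blast+
  then show ?case using *
    by (auto intro!: exI[of _ "\<lambda>x v. f x * g' x v + f' x v * g x"] has_derivative_mult
        Suc.IH Ck_on_add)
qed

text \<open>The derivative of \<open>inverse f\<close> is a product of \<open>inverse f\<close>,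
  \<open>f'\<close> and \<open>inverse f\<close>, so at order \<open>Suc k\<close> only the order
  \<open>k\<close> of \<open>inverse f\<close> is needed and the induction closes. The factor
  \<open>- 1\<close> keeps the derivative in the shape of a product.\<close>

lemma Ck_on_inverse:
  fixes f :: "'a::real_normed_vector \<Rightarrow> 'b::real_normed_field"
  assumes "\<And>x. x \<in> S \<Longrightarrow> f x \<noteq> 0"
  shows "Ck_on k S f \<Longrightarrow> Ck_on k S (\<lambda>x. inverse (f x))"
proof (induction k)
  case 0
  then show ?case using assms by (auto intro: continuous_intros)
next
  case (Suc k)
  obtain f' where *: "\<forall>x\<in>S. (f has_derivative f' x) (at x within S)" "\<forall>v. Ck_on k S (\<lambda>x. f' x v)"
    using Suc.prems by auto
  have "Ck_on k S (\<lambda>x. inverse (f x))" using Suc Ck_on_Suc_D by blast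
  moreover have "((\<lambda>x. inverse (f x)) has_derivative
      (\<lambda>v. - 1 * (inverse (f x) * f' x v * inverse (f x)))) (at x within S)" if "x \<in> S" for x
    using *(1) assms[OF that] that by (auto intro!: derivative_eq_intros)
  ultimately show ?case using *(2)
    by (simp only: Ck_on.simps)
       (intro exI[of _ "\<lambda>x v. - 1 * (inverse (f x) * f' x v * inverse (f x))"] conjI allI ballI
          Ck_on_mult Ck_on_const; blast)
qed

lemma smooth_on_cong: "smooth_on S f \<Longrightarrow> (\<And>x. x \<in> S \<Longrightarrow> f x = g x) \<Longrightarrow> smooth_on S g"
  unfolding smooth_on_def using Ck_on_cong by blast

lemma smooth_on_subset: "smooth_on S f \<Longrightarrow> S' \<subseteq> S \<Longrightarrow> smooth_on S' f"
  unfolding smooth_on_def using Ck_on_subset by blast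

lemma smooth_on_const: "smooth_on S (\<lambda>x. c)"
  unfolding smooth_on_def using Ck_on_const by blast

lemma smooth_on_add: "smooth_on S f \<Longrightarrow> smooth_on S g \<Longrightarrow> smooth_on S (\<lambda>x. f x + g x)"
  unfolding smooth_on_def using Ck_on_add by blast

lemma smooth_on_bounded_linear:
  "bounded_linear L \<Longrightarrow> smooth_on S f \<Longrightarrow> smooth_on S (\<lambda>x. L (f x))"
  unfolding smooth_on_def using Ck_on_bounded_linear by blast

lemma smooth_on_mult:
  fixes f g :: "'a::real_normed_vector \<Rightarrow> 'b::real_normed_algebra"
  shows "smooth_on S f \<Longrightarrow> smooth_on S g \<Longrightarrow> smooth_on S (\<lambda>x. f x * g x)"
  unfolding smooth_on_def using Ck_on_mult by blast

lemma smooth_on_inverse: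
  fixes f :: "'a::real_normed_vector \<Rightarrow> 'b::real_normed_field"
  shows "smooth_on S f \<Longrightarrow> (\<And>x. x \<in> S \<Longrightarrow> f x \<noteq> 0) \<Longrightarrow> smooth_on S (\<lambda>x. inverse (f x))"
  unfolding smooth_on_def using Ck_on_inverse by blast

lemma smooth_on_uminus: "smooth_on S f \<Longrightarrow> smooth_on S (\<lambda>x. - f x)"
  using smooth_on_bounded_linear[of uminus] by (simp add: bounded_linear_minus[OF bounded_linear_ident])

lemma smooth_on_diff: "smooth_on S f \<Longrightarrow> smooth_on S g \<Longrightarrow> smooth_on S (\<lambda>x. f x - g x)"
  using smooth_on_add[OF _ smooth_on_uminus, of S f g] by simp

lemma smooth_on_cnj: "smooth_on S f \<Longrightarrow> smooth_on S (\<lambda>x. cnj (f x))"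
  using smooth_on_bounded_linear[OF bounded_linear_cnj] by blast

lemma smooth_on_of_real: "smooth_on S f \<Longrightarrow> smooth_on S (\<lambda>x. complex_of_real (f x))"
  using smooth_on_bounded_linear[OF bounded_linear_of_real] by blast

lemma smooth_on_sum: "(\<And>i. i \<in> I \<Longrightarrow> smooth_on S (f i)) \<Longrightarrow> smooth_on S (\<lambda>x. \<Sum>i\<in>I. f i x)"
proof (induction I rule: infinite_finite_induct)
  case (insert i I)
  then show ?case using smooth_on_add[of S "f i"] by simp
qed (auto intro: smooth_on_const)

lemma smooth_on_prod:
  fixes f :: "'i \<Rightarrow> 'a::real_normed_vector \<Rightarrow> 'b::{real_normed_algebra, comm_ring_1}"
  shows "(\<And>i. i \<in> I \<Longrightarrow> smooth_on S (f i)) \<Longrightarrow> smooth_on S (\<lambda>x. \<Prod>i\<in>I. f i x)"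
proof (induction I rule: infinite_finite_induct)
  case (insert i I)
  then show ?case using smooth_on_mult[of S "f i"] by simp
qed (auto intro: smooth_on_const)

lemmas smooth_intros = smooth_on_const smooth_on_add smooth_on_mult smooth_on_diff smooth_on_uminus
  smooth_on_cnj smooth_on_of_real smooth_on_sum smooth_on_prod

lemma smooth_on_continuous: "smooth_on S f \<Longrightarrow> continuous_on S f"
  unfolding smooth_on_def by (metis Ck_on.simps(1))

section \<open>Symmetry of second derivatives\<close>

text \<open>Schwarz's argument: the mixed second difference is the increment in direction
  \<open>v\<close> of the difference in direction \<open>w\<close>, and the mean value theorem is
  applied to each in turn. Only the derivative of \<open>F x v\<close> for the fixed
  \<open>v\<close> is used.\<close>

lemma mixed_difference_mean_value:
  fixes f :: "'a::real_normed_vector \<Rightarrow> real"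
  assumes h: "h > 0" and U: "\<And>s r. 0 \<le> s \<Longrightarrow> s \<le> h \<Longrightarrow> 0 \<le> r \<Longrightarrow> r \<le> h \<Longrightarrow> p + s *\<^sub>R v + r *\<^sub>R w \<in> U"
    and f: "\<And>x. x \<in> U \<Longrightarrow> (f has_derivative F x) (at x)"
    and F: "\<And>x. x \<in> U \<Longrightarrow> ((\<lambda>x. F x v) has_derivative G x) (at x)"
  shows "\<exists>s r. 0 < s \<and> s < h \<and> 0 < r \<and> r < h \<and>
    f (p + h *\<^sub>R v + h *\<^sub>R w) - f (p + h *\<^sub>R v) - f (p + h *\<^sub>R w) + f p
      = h * h * G (p + s *\<^sub>R v + r *\<^sub>R w) w"
proof -
  have lin: "F x (c *\<^sub>R y) = c * F x y" if "x \<in> U" for x c y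
    using f[OF that] by (metis has_derivative_bounded_linear bounded_linear.linear linear_cmul real_scaleR_def)
  have linG: "G x (c *\<^sub>R y) = c * G x y" if "x \<in> U" for x c y
    using F[OF that] by (metis has_derivative_bounded_linear bounded_linear.linear linear_cmul real_scaleR_def)
  have d1: "((\<lambda>s. f (p + s *\<^sub>R v + r *\<^sub>R w)) has_field_derivative F (p + s *\<^sub>R v + r *\<^sub>R w) v) (at s)"
    if "0 \<le> s" "s \<le> h" "0 \<le> r" "r \<le> h" for s r
  proof -
    have *: "((\<lambda>s. p + s *\<^sub>R v + r *\<^sub>R w) has_derivative (\<lambda>s. s *\<^sub>R v)) (at s)"
      by (auto intro!: derivative_eq_intros)
    have "((\<lambda>s. f (p + s *\<^sub>R v + r *\<^sub>R w)) has_derivative (\<lambda>c. F (p + s *\<^sub>R v + r *\<^sub>R w) (c *\<^sub>R v))) (at s)"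
      by (rule has_derivative_compose[OF *]) (use f U that in blast)
    moreover have "(\<lambda>c. F (p + s *\<^sub>R v + r *\<^sub>R w) (c *\<^sub>R v)) = (*) (F (p + s *\<^sub>R v + r *\<^sub>R w) v)"
      using lin[OF U[OF that]] by (auto simp: mult.commute)
    ultimately show ?thesis by (simp add: has_field_derivative_def)
  qed
  have d2: "((\<lambda>r. F (p + s *\<^sub>R v + r *\<^sub>R w) v) has_field_derivative G (p + s *\<^sub>R v + r *\<^sub>R w) w) (at r)"
    if "0 \<le> s" "s \<le> h" "0 \<le> r" "r \<le> h" for s r
  proof -
    have *: "((\<lambda>r. p + s *\<^sub>R v + r *\<^sub>R w) has_derivative (\<lambda>s. s *\<^sub>R w)) (at r)"
      by (auto intro!: derivative_eq_intros)
    have "((\<lambda>r. F (p + s *\<^sub>R v + r *\<^sub>R w) v) has_derivative (\<lambda>c. G (p + s *\<^sub>R v + r *\<^sub>R w) (c *\<^sub>R w))) (at r)"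
      by (rule has_derivative_compose[OF * F]) (use U that in blast)
    moreover have "(\<lambda>c. G (p + s *\<^sub>R v + r *\<^sub>R w) (c *\<^sub>R w)) = (*) (G (p + s *\<^sub>R v + r *\<^sub>R w) w)"
      using linG[OF U[OF that]] by (auto simp: mult.commute)
    ultimately show ?thesis by (simp add: has_field_derivative_def)
  qed
  define \<phi> where "\<phi> = (\<lambda>s. f (p + s *\<^sub>R v + h *\<^sub>R w) - f (p + s *\<^sub>R v + 0 *\<^sub>R w))"
  have "\<exists>z>0. z < h \<and> \<phi> h - \<phi> 0 = (h - 0) * (F (p + z *\<^sub>R v + h *\<^sub>R w) v - F (p + z *\<^sub>R v + 0 *\<^sub>R w) v)"
    unfolding \<phi>_def by (rule MVT2[OF h]) (intro DERIV_diff d1, use h in auto)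
  then obtain s where s: "0 < s" "s < h"
    "\<phi> h - \<phi> 0 = h * (F (p + s *\<^sub>R v + h *\<^sub>R w) v - F (p + s *\<^sub>R v + 0 *\<^sub>R w) v)" by auto
  have "\<exists>z>0. z < h \<and> F (p + s *\<^sub>R v + h *\<^sub>R w) v - F (p + s *\<^sub>R v + 0 *\<^sub>R w) v
      = (h - 0) * G (p + s *\<^sub>R v + z *\<^sub>R w) w"
    by (rule MVT2[OF h]) (use s d2 in auto)
  then obtain r where "0 < r" "r < h" "F (p + s *\<^sub>R v + h *\<^sub>R w) v - F (p + s *\<^sub>R v + 0 *\<^sub>R w) v
      = h * G (p + s *\<^sub>R v + r *\<^sub>R w) w" by auto
  then show ?thesis using s unfolding \<phi>_def
    by (intro exI[of _ s] exI[of _ r]) (auto simp: algebra_simps)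
qed

text \<open>The mixed difference is symmetric in \<open>v\<close> and \<open>w\<close>, so its two
  mean value representations agree at points arbitrarily near \<open>p\<close>. Only the two fixed
  directions are differentiated twice, because \<open>Ck_on\<close> controls a derivative one vector
  at a time.\<close>

lemma symmetric_second_derivative_real:
  fixes f :: "'a::real_normed_vector \<Rightarrow> real"
  assumes U: "open U" "p \<in> U"
    and f: "\<And>x. x \<in> U \<Longrightarrow> (f has_derivative F x) (at x)"
    and Fv: "\<And>x. x \<in> U \<Longrightarrow> ((\<lambda>x. F x v) has_derivative Gv x) (at x)"
    and Fw: "\<And>x. x \<in> U \<Longrightarrow> ((\<lambda>x. F x w) has_derivative Gw x) (at x)"
    and cont: "continuous_on U (\<lambda>x. Gv x w)" "continuous_on U (\<lambda>x. Gw x v)"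
  shows "Gv p w = Gw p v"
proof (rule ccontr)
  assume neq: "Gv p w \<noteq> Gw p v"
  define e where "e = \<bar>Gv p w - Gw p v\<bar> / 2"
  have e: "e > 0" using neq by (simp add: e_def)
  have "isCont (\<lambda>x. Gv x w) p" "isCont (\<lambda>x. Gw x v) p"
    using cont U continuous_on_eq_continuous_at by blast+
  then obtain d1 d2 where d: "d1 > 0" "\<And>x. dist x p < d1 \<Longrightarrow> dist (Gv x w) (Gv p w) < e"
     "d2 > 0" "\<And>x. dist x p < d2 \<Longrightarrow> dist (Gw x v) (Gw p v) < e"
    using e unfolding continuous_at_eps_delta by metis
  obtain d3 where d3: "d3 > 0" "ball p d3 \<subseteq> U" using U open_contains_ball by blast
  define d where "d = min d1 (min d2 d3)"
  have dp: "d > 0" using d d3 by (simp add: d_def)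
  \<comment> \<open>Small enough for the whole parallelogram to lie within distance \<open>d\<close>
    of \<open>p\<close>; the summand 1 avoids a zero denominator.\<close>
  define h where "h = d / (2 * (1 + norm v + norm w))"
  have n: "1 + norm v + norm w > 0" by (smt (verit) norm_ge_zero)
  have h: "h > 0" using dp n by (simp add: h_def)
  have near: "dist (p + s *\<^sub>R v + r *\<^sub>R w) p < d" if "0 \<le> s" "s \<le> h" "0 \<le> r" "r \<le> h" for s r
  proof -
    have "dist (p + s *\<^sub>R v + r *\<^sub>R w) p \<le> s * norm v + r * norm w"
      using norm_triangle_ineq[of "s *\<^sub>R v" "r *\<^sub>R w"] that by (simp add: dist_norm algebra_simps)
    also have "\<dots> \<le> h * norm v + h * norm w"
      using that by (intro add_mono mult_right_mono) auto
    also have "\<dots> \<le> h * (1 + norm v + norm w)" using h by (simp add: algebra_simps)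
    also have "\<dots> = d / 2" using n by (simp add: h_def field_simps)
    finally show ?thesis using dp by simp
  qed
  have inU: "p + s *\<^sub>R v + r *\<^sub>R w \<in> U" if "0 \<le> s" "s \<le> h" "0 \<le> r" "r \<le> h" for s r
    using near[OF that] d3 by (auto simp: d_def dist_commute mem_ball)
  obtain s1 r1 where 1: "0 < s1" "s1 < h" "0 < r1" "r1 < h"
    "f (p + h *\<^sub>R v + h *\<^sub>R w) - f (p + h *\<^sub>R v) - f (p + h *\<^sub>R w) + f p = h * h * Gv (p + s1 *\<^sub>R v + r1 *\<^sub>R w) w"
    using mixed_difference_mean_value[OF h inU f Fv] by blast
  have inU': "p + s *\<^sub>R w + r *\<^sub>R v \<in> U" if "0 \<le> s" "s \<le> h" "0 \<le> r" "r \<le> h" for s r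
    using inU[of r s] that by (simp add: algebra_simps)
  obtain s2 r2 where 2: "0 < s2" "s2 < h" "0 < r2" "r2 < h"
    "f (p + h *\<^sub>R w + h *\<^sub>R v) - f (p + h *\<^sub>R w) - f (p + h *\<^sub>R v) + f p = h * h * Gw (p + s2 *\<^sub>R w + r2 *\<^sub>R v) v"
    using mixed_difference_mean_value[OF h inU' f Fw] by blast
  have "h * h * Gv (p + s1 *\<^sub>R v + r1 *\<^sub>R w) w = h * h * Gw (p + r2 *\<^sub>R v + s2 *\<^sub>R w) v"
    using 1(5) 2(5) by (simp add: algebra_simps)
  then have "Gv (p + s1 *\<^sub>R v + r1 *\<^sub>R w) w = Gw (p + r2 *\<^sub>R v + s2 *\<^sub>R w) v" using h by simp
  moreover have "dist (Gv (p + s1 *\<^sub>R v + r1 *\<^sub>R w) w) (Gv p w) < e"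
    using near[of s1 r1] 1 d by (auto simp: d_def)
  moreover have "dist (Gw (p + r2 *\<^sub>R v + s2 *\<^sub>R w) v) (Gw p v) < e"
    using near[of r2 s2] 2 d by (auto simp: d_def)
  ultimately show False unfolding e_def dist_real_def by (smt (verit) field_sum_of_halves)
qed

lemma symmetric_second_derivative:
  fixes f :: "'a::real_normed_vector \<Rightarrow> complex"
  assumes U: "open U" "p \<in> U"
    and f: "\<And>x. x \<in> U \<Longrightarrow> (f has_derivative F x) (at x)"
    and Fv: "\<And>x. x \<in> U \<Longrightarrow> ((\<lambda>x. F x v) has_derivative Gv x) (at x)"
    and Fw: "\<And>x. x \<in> U \<Longrightarrow> ((\<lambda>x. F x w) has_derivative Gw x) (at x)"
    and cont: "continuous_on U (\<lambda>x. Gv x w)" "continuous_on U (\<lambda>x. Gw x v)"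
  shows "Gv p w = Gw p v"
proof (rule complex_eqI)
  show "Re (Gv p w) = Re (Gw p v)"
    by (rule symmetric_second_derivative_real[OF U, of "\<lambda>x. Re (f x)" "\<lambda>x v. Re (F x v)" v "\<lambda>x w. Re (Gv x w)" w "\<lambda>x w. Re (Gw x w)"])
       (use f Fv Fw cont in \<open>auto intro!: derivative_eq_intros continuous_intros\<close>)
  show "Im (Gv p w) = Im (Gw p v)"
    by (rule symmetric_second_derivative_real[OF U, of "\<lambda>x. Im (f x)" "\<lambda>x v. Im (F x v)" v "\<lambda>x w. Im (Gv x w)" w "\<lambda>x w. Im (Gw x w)"])
       (use f Fv Fw cont in \<open>auto intro!: derivative_eq_intros continuous_intros\<close>)
qed

section \<open>Wirtinger operators on a coordinate domain\<close>

text \<open>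
  The operators vanish by definition outside \<open>T \<times> V\<close>; this makes the calculus rules identities
  between functions, which can be used for rewriting under further differential operators.
\<close>

lemma has_derivative_has_vector_derivative:
  assumes "(f has_derivative f') (at t within S)"
  shows "(f has_vector_derivative f' 1) (at t within S)"
proof -
  have "f' = (\<lambda>x. x *\<^sub>R f' 1)"
    using has_derivative_bounded_linear[OF assms]
    by (metis bounded_linear.linear linear_cmul mult.right_neutral real_scaleR_def)
  then show ?thesis using assms by (simp add: has_vector_derivative_def)
qed

locale chart_domain =
  fixes T :: "real set" and V :: "(complex^'n::finite) set"
  assumes open_V: "open V"
begin

definition ddx :: "complex^'n \<Rightarrow> (real \<times> (complex^'n) \<Rightarrow> complex) \<Rightarrow> real \<times> (complex^'n) \<Rightarrow> complex" where
  "ddx v f p = (if p \<in> T \<times> V then frechet_derivative (\<lambda>y. f (fst p, y)) (at (snd p)) v else 0)"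

text \<open>\<open>wd (- \<i>) i\<close> is \<open>\<partial>\<^sub>i\<close> and \<open>wd \<i> i\<close> is its conjugate.\<close>

definition wd :: "complex \<Rightarrow> 'n \<Rightarrow> (real \<times> (complex^'n) \<Rightarrow> complex) \<Rightarrow> real \<times> (complex^'n) \<Rightarrow> complex" where
  "wd s i f p = (ddx (axis i 1) f p + s * ddx (axis i \<i>) f p) / 2"

abbreviation "dz \<equiv> wd (- \<i>)"
abbreviation "dzb \<equiv> wd \<i>"
abbreviation "sm \<equiv> smooth_on (T \<times> V)"

lemma dz_eq_wirtinger: "p \<in> T \<times> V \<Longrightarrow> dz i f p = wirtinger i (\<lambda>y. f (fst p, y)) (snd p)"
  by (simp add: wd_def ddx_def wirtinger_def)

lemma dzb_eq_wirtinger_bar: "p \<in> T \<times> V \<Longrightarrow> dzb i f p = wirtinger_bar i (\<lambda>y. f (fst p, y)) (snd p)"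
  by (simp add: wd_def ddx_def wirtinger_bar_def)

text \<open>\<open>V\<close> is open although \<open>T\<close> need not be: freezing the time turns
  a derivative within \<open>T \<times> V\<close> into an unrestricted one in space, even at the
  initial time.\<close>

lemma slice_has_derivative:
  assumes "(f has_derivative f') (at (t, x) within T \<times> V)" "t \<in> T" "x \<in> V"
  shows "((\<lambda>y. f (t, y)) has_derivative (\<lambda>v. f' (0, v))) (at x)"
proof -
  have 1: "((\<lambda>y. (t, y)) has_derivative (\<lambda>v. (0, v))) (at x within V)"
    by (auto intro!: derivative_eq_intros)
  have "((\<lambda>y. f (t, y)) has_derivative (\<lambda>v. f' (0, v))) (at x within V)"
    by (rule has_derivative_in_compose[OF 1])
       (use assms in \<open>auto intro: has_derivative_subset[OF assms(1)]\<close>)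
  then show ?thesis using at_within_open[OF assms(3) open_V] by simp
qed

lemma smooth_slice_derivative:
  assumes "sm f" "t \<in> T" "x \<in> V"
  shows "((\<lambda>y. f (t, y)) has_derivative (\<lambda>v. ddx v f (t, x))) (at x)"
proof -
  have "Ck_on (Suc 0) (T \<times> V) f" using assms by (auto simp: smooth_on_def simp del: Ck_on.simps)
  then obtain f' where "(f has_derivative f' (t, x)) (at (t, x) within T \<times> V)"
    using assms by auto
  from slice_has_derivative[OF this assms(2,3)] show ?thesis
    using assms(2,3) frechet_derivative_at by (fastforce simp: ddx_def)
qed

lemma ddx_eqI:
  assumes "((\<lambda>y. f (t, y)) has_derivative f') (at x)" "t \<in> T" "x \<in> V"
  shows "ddx v f (t, x) = f' v"
  using frechet_derivative_at[OF assms(1)] assms(2,3) by (simp add: ddx_def)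

lemma smooth_ddx: assumes "sm f" shows "sm (ddx v f)"
  unfolding smooth_on_def
proof
  fix k
  have "Ck_on (Suc k) (T \<times> V) f" using assms by (auto simp: smooth_on_def simp del: Ck_on.simps)
  then obtain f' where f': "\<And>p. p \<in> T \<times> V \<Longrightarrow> (f has_derivative f' p) (at p within T \<times> V)"
    "Ck_on k (T \<times> V) (\<lambda>p. f' p (0, v))" unfolding Ck_on.simps by blast
  show "Ck_on k (T \<times> V) (ddx v f)"
  proof (rule Ck_on_cong[OF f'(2)])
    fix p assume "p \<in> T \<times> V"
    then show "f' p (0, v) = ddx v f p"
      using ddx_eqI[OF slice_has_derivative[OF f'(1)]] by (cases p) auto
  qed
qed

lemma ddx_cong: assumes "\<And>p. p \<in> T \<times> V \<Longrightarrow> f p = g p" "sm f" shows "ddx v f = ddx v g"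
proof
  fix p show "ddx v f p = ddx v g p"
  proof (cases "p \<in> T \<times> V")
    case True
    then obtain t x where p: "p = (t, x)" "t \<in> T" "x \<in> V" by auto
    have "((\<lambda>y. g (t, y)) has_derivative (\<lambda>v. ddx v f (t, x))) (at x)"
      by (rule has_derivative_transform_within_open[OF smooth_slice_derivative[OF assms(2) p(2,3)] open_V])
         (use p assms(1) in auto)
    then show ?thesis using ddx_eqI[OF _ p(2,3)] p by simp
  qed (simp_all add: ddx_def)
qed

lemma ddx_outside: "p \<notin> T \<times> V \<Longrightarrow> ddx v f p = 0"
  by (simp only: ddx_def if_False)

lemma ddx_funI:
  assumes "\<And>t x. t \<in> T \<Longrightarrow> x \<in> V \<Longrightarrow> ((\<lambda>y. f (t, y)) has_derivative (\<lambda>v. g v (t, x))) (at x)"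
    and "\<And>p. p \<notin> T \<times> V \<Longrightarrow> g v p = 0"
  shows "ddx v f = g v"
proof
  fix p show "ddx v f p = g v p"
  proof (cases "p \<in> T \<times> V")
    case True
    then obtain t x where "p = (t, x)" "t \<in> T" "x \<in> V" by auto
    then show ?thesis using ddx_eqI[OF assms(1)] by simp
  qed (use assms(2) ddx_outside in auto)
qed

lemma ddx_add: "sm f \<Longrightarrow> sm g \<Longrightarrow> ddx v (\<lambda>p. f p + g p) = (\<lambda>p. ddx v f p + ddx v g p)"
  by (rule ddx_funI) (auto intro!: has_derivative_add smooth_slice_derivative simp: ddx_outside)

lemma ddx_mult: "sm f \<Longrightarrow> sm g \<Longrightarrow> ddx v (\<lambda>p. f p * g p) = (\<lambda>p. ddx v f p * g p + f p * ddx v g p)"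
  by (rule ddx_funI[where g="\<lambda>v p. ddx v f p * g p + f p * ddx v g p"])
     (auto intro!: derivative_eq_intros smooth_slice_derivative simp: ddx_outside)

lemma ddx_const: "ddx v (\<lambda>p. c) = (\<lambda>p. 0)"
  by (rule ddx_funI) auto

lemma ddx_cnj: "sm f \<Longrightarrow> ddx v (\<lambda>p. cnj (f p)) = (\<lambda>p. cnj (ddx v f p))"
  by (rule ddx_funI[where g="\<lambda>v p. cnj (ddx v f p)"])
     (auto intro!: bounded_linear.has_derivative[OF bounded_linear_cnj] smooth_slice_derivative simp: ddx_outside)

lemma ddx_linear: assumes "sm f" "t \<in> T" "x \<in> V" shows "linear (\<lambda>v. ddx v f (t, x))"
  using smooth_slice_derivative[OF assms] has_derivative_bounded_linear bounded_linear.linear by blast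

lemma ddx_commute: assumes "sm f" shows "ddx v (ddx w f) = ddx w (ddx v f)"
proof
  fix p show "ddx v (ddx w f) p = ddx w (ddx v f) p"
  proof (cases "p \<in> T \<times> V")
    case True
    then obtain t x where p: "p = (t, x)" "t \<in> T" "x \<in> V" by auto
    have c: "continuous_on V (\<lambda>y. ddx a (ddx b f) (t, y))" for a b
      by (rule continuous_on_compose2[OF smooth_on_continuous[OF smooth_ddx[OF smooth_ddx[OF assms]]]])
         (use p in \<open>auto intro!: continuous_intros\<close>)
    show ?thesis unfolding p(1)
      by (rule symmetric_second_derivative[OF open_V p(3), of "\<lambda>y. f (t, y)" "\<lambda>y v. ddx v f (t, y)" w
            "\<lambda>y v. ddx v (ddx w f) (t, y)" v "\<lambda>y w. ddx w (ddx v f) (t, y)"])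
         (use p assms c smooth_slice_derivative smooth_ddx in auto)
  qed (simp add: ddx_outside)
qed

lemma smooth_wd: "sm f \<Longrightarrow> sm (wd s i f)"
  unfolding wd_def[abs_def] divide_inverse
  by (intro smooth_intros smooth_ddx)

lemma wd_cong: assumes "\<And>p. p \<in> T \<times> V \<Longrightarrow> f p = g p" "sm f" shows "wd s i f = wd s i g"
  using ddx_cong[OF assms] by (simp add: wd_def[abs_def])

lemma wd_outside: assumes "p \<notin> T \<times> V" shows "wd s i f p = 0"
  by (simp add: wd_def ddx_outside[OF assms])

lemma wd_add: "sm f \<Longrightarrow> sm g \<Longrightarrow> wd s i (\<lambda>p. f p + g p) = (\<lambda>p. wd s i f p + wd s i g p)"
  by (simp add: wd_def[abs_def] ddx_add algebra_simps add_divide_distrib)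

lemma wd_mult: "sm f \<Longrightarrow> sm g \<Longrightarrow> wd s i (\<lambda>p. f p * g p) = (\<lambda>p. wd s i f p * g p + f p * wd s i g p)"
  by (simp add: wd_def[abs_def] ddx_mult algebra_simps add_divide_distrib)

lemma wd_const: "wd s i (\<lambda>p. c) = (\<lambda>p. 0)"
  by (simp add: wd_def[abs_def] ddx_const)

lemma wd_cmult: "sm f \<Longrightarrow> wd s i (\<lambda>p. c * f p) = (\<lambda>p. c * wd s i f p)"
  by (simp add: wd_mult smooth_intros wd_const)

lemma wd_uminus: "sm f \<Longrightarrow> wd s i (\<lambda>p. - f p) = (\<lambda>p. - wd s i f p)"
  using wd_cmult[of f s i "-1"] by simp

lemma wd_diff: "sm f \<Longrightarrow> sm g \<Longrightarrow> wd s i (\<lambda>p. f p - g p) = (\<lambda>p. wd s i f p - wd s i g p)"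
  using wd_add[of f "\<lambda>p. - g p"] by (simp add: wd_uminus smooth_intros)

lemma wd_sum: "(\<And>a. a \<in> I \<Longrightarrow> sm (f a)) \<Longrightarrow> wd s i (\<lambda>p. \<Sum>a\<in>I. f a p) = (\<lambda>p. \<Sum>a\<in>I. wd s i (f a) p)"
proof (induction I rule: infinite_finite_induct)
  case (insert a I)
  then show ?case by (simp add: wd_add smooth_intros)
qed (auto simp: wd_const)

lemma wd_cnj: "sm f \<Longrightarrow> wd s i (\<lambda>p. cnj (f p)) = (\<lambda>p. cnj (wd (cnj s) i f p))"
  by (simp add: wd_def[abs_def] ddx_cnj)

lemma wd_commute: "sm f \<Longrightarrow> wd s i (wd r j f) = wd r j (wd s i f)"
proof -
  assume f: "sm f"
  have d: "ddx v (\<lambda>p. (ddx a f p + q * ddx b f p) / 2) = (\<lambda>p. (ddx v (ddx a f) p + q * ddx v (ddx b f) p) / 2)"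
    for v a b q
    using ddx_mult[of "\<lambda>p. 1/2" "\<lambda>p. ddx a f p + q * ddx b f p" v] f
    by (simp add: smooth_intros smooth_ddx ddx_add ddx_mult ddx_const)
  show ?thesis
    unfolding wd_def[abs_def] d
    by (simp add: ddx_commute[OF f, of "axis j 1" "axis i 1"] ddx_commute[OF f, of "axis j 1" "axis i \<i>"]
        ddx_commute[OF f, of "axis j \<i>" "axis i 1"] ddx_commute[OF f, of "axis j \<i>" "axis i \<i>"]
        algebra_simps add_divide_distrib)
qed

text \<open>Time and space derivatives commute. The symmetry lemma needs an open set, and at an
  endpoint of \<open>T\<close> a time derivative would be one-sided, hence the open \<open>J\<close>
  inside \<open>T\<close>.\<close>

lemma time_derivative_ddx:
  assumes J: "open J" "J \<subseteq> T" and f: "sm f" and P: "sm P"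
    and der: "\<And>t x. t \<in> J \<Longrightarrow> x \<in> V \<Longrightarrow> ((\<lambda>s. f (s, x)) has_vector_derivative P (t, x)) (at t)"
    and t: "t \<in> J" and x: "x \<in> V"
  shows "((\<lambda>s. ddx v f (s, x)) has_vector_derivative ddx v P (t, x)) (at t)"
proof -
  let ?U = "J \<times> V"
  have U: "open ?U" "?U \<subseteq> T \<times> V" using J open_V by (auto intro: open_Times)
  have "Ck_on (Suc (Suc 0)) (T \<times> V) f" using f by (auto simp: smooth_on_def simp del: Ck_on.simps)
  then obtain f' where f': "\<And>p. p \<in> T \<times> V \<Longrightarrow> (f has_derivative f' p) (at p within T \<times> V)"
     "\<And>v. Ck_on (Suc 0) (T \<times> V) (\<lambda>p. f' p v)" unfolding Ck_on.simps(2)[of "Suc 0"] by blast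
  have at_J: "(g has_derivative g') (at p)"
    if "(g has_derivative g') (at p within T \<times> V)" "p \<in> ?U"
    for g :: "real \<times> (complex^'n) \<Rightarrow> complex" and g' p
    using has_derivative_subset[OF that(1) U(2)] at_within_open[OF that(2) U(1)] by simp
  have "\<exists>G. (\<forall>p\<in>?U. ((\<lambda>p. f' p v) has_derivative G p) (at p)) \<and> (\<forall>w. continuous_on ?U (\<lambda>p. G p w))" for v
  proof -
    obtain G where "\<And>p. p \<in> T \<times> V \<Longrightarrow> ((\<lambda>p. f' p v) has_derivative G p) (at p within T \<times> V)"
       "\<And>w. continuous_on (T \<times> V) (\<lambda>p. G p w)"
      using f'(2)[of v] unfolding Ck_on.simps by blast
    then show ?thesis
      by (intro exI[of _ G] conjI ballI allI at_J) (use U in \<open>blast intro: continuous_on_subset\<close>)+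
  qed
  then obtain G where G: "\<And>v p. p \<in> ?U \<Longrightarrow> ((\<lambda>p. f' p v) has_derivative G v p) (at p)"
    "\<And>v w. continuous_on ?U (\<lambda>p. G v p w)" by metis
  have fd: "(f has_derivative f' p) (at p)" if "p \<in> ?U" for p
    using at_J[OF f'(1) that] U that by blast
  have eq1: "f' p (0, v) = ddx v f p" if "p \<in> ?U" for p v
    using that ddx_eqI[OF slice_has_derivative[OF f'(1)]] U by (cases p) auto
  have tslice: "((\<lambda>s. (s, x)) has_derivative (\<lambda>c. (c, 0))) (at t)" for t and x :: "complex^'n"
    by (auto intro!: derivative_eq_intros)
  have eq2: "f' p (1, 0) = P p" if "p \<in> ?U" for p
  proof -
    from that obtain t x where p: "p = (t, x)" "t \<in> J" "x \<in> V" by auto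
    have "((\<lambda>s. f (s, x)) has_derivative (\<lambda>c. f' p (c, 0))) (at t)"
      by (rule has_derivative_compose[OF tslice]) (use fd that p in auto)
    then have "((\<lambda>s. f (s, x)) has_vector_derivative f' p (1, 0)) (at t)"
      using has_derivative_has_vector_derivative by blast
    then show ?thesis using der[OF p(2,3)] vector_derivative_unique_at p(1) by blast
  qed
  have sym: "G (0, v) (t, x) (1, 0) = G (1, 0) (t, x) (0, v)"
    by (rule symmetric_second_derivative[OF U(1), where f = f and F = f'])
       (use t x fd G in auto)
  have "((\<lambda>p. ddx v f p) has_derivative G (0, v) (t, x)) (at (t, x))"
    by (rule has_derivative_transform_within_open[OF G(1)[of _ "(0, v)"] U(1)]) (use t x eq1 in auto)
  from has_derivative_compose[OF tslice this]
  have 1: "((\<lambda>s. ddx v f (s, x)) has_vector_derivative G (0, v) (t, x) (1, 0)) (at t)"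
    using has_derivative_has_vector_derivative by blast
  have "(P has_derivative G (1, 0) (t, x)) (at (t, x))"
    by (rule has_derivative_transform_within_open[OF G(1)[of _ "(1, 0)"] U(1)]) (use t x eq2 in auto)
  then have PG: "(P has_derivative G (1, 0) (t, x)) (at (t, x) within T \<times> V)"
    by (rule has_derivative_at_withinI)
  have tT: "t \<in> T" using t J by blast
  have "ddx v P (t, x) = G (1, 0) (t, x) (0, v)"
    by (rule ddx_eqI[OF slice_has_derivative[OF PG tT x] tT x])
  then show ?thesis using 1 sym by simp
qed

lemma time_derivative_wd:
  assumes "open J" "J \<subseteq> T" "sm f" "sm P"
    and "\<And>t x. t \<in> J \<Longrightarrow> x \<in> V \<Longrightarrow> ((\<lambda>s. f (s, x)) has_vector_derivative P (t, x)) (at t)"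
    and "t \<in> J" "x \<in> V"
  shows "((\<lambda>s. wd r i f (s, x)) has_vector_derivative wd r i P (t, x)) (at t)"
proof -
  note d = time_derivative_ddx[OF assms]
  have "((\<lambda>s. (1/2) * (ddx (axis i 1) f (s, x) + r * ddx (axis i \<i>) f (s, x))) has_vector_derivative
     (1/2) * (ddx (axis i 1) P (t, x) + r * ddx (axis i \<i>) P (t, x))) (at t)"
    by (intro derivative_intros has_vector_derivative_mult_right d)
  then show ?thesis by (simp add: wd_def)
qed

subsection \<open>First-order operators with constant coefficients\<close>

definition Xop :: "complex \<Rightarrow> ('n \<Rightarrow> complex) \<Rightarrow> (real \<times> (complex^'n) \<Rightarrow> complex) \<Rightarrow> real \<times> (complex^'n) \<Rightarrow> complex" where
  "Xop s a f p = (\<Sum>i\<in>UNIV. a i * wd s i f p)"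

definition Dop :: "complex \<Rightarrow> complex \<Rightarrow> ('n \<Rightarrow> complex) \<Rightarrow> (real \<times> (complex^'n) \<Rightarrow> complex) \<Rightarrow> real \<times> (complex^'n) \<Rightarrow> complex" where
  "Dop s c a f p = c * f p + Xop s a f p"

lemma smooth_Xop: "sm f \<Longrightarrow> sm (Xop s a f)"
  unfolding Xop_def[abs_def] by (intro smooth_intros smooth_wd)

lemma smooth_Dop: "sm f \<Longrightarrow> sm (Dop s c a f)"
  unfolding Dop_def[abs_def] by (intro smooth_intros smooth_Xop)

lemma wd_Xop: "sm f \<Longrightarrow> wd r j (Xop s a f) = Xop s a (wd r j f)"
  unfolding Xop_def[abs_def]
  by (simp add: wd_sum wd_cmult smooth_intros smooth_wd wd_commute[of f r j])

lemma wd_Dop: "sm f \<Longrightarrow> wd r j (Dop s c a f) = Dop s c a (wd r j f)"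
  unfolding Dop_def[abs_def] by (simp add: wd_add wd_cmult smooth_intros smooth_Xop wd_Xop)

lemma Xop_add: "sm f \<Longrightarrow> sm g \<Longrightarrow> Xop s a (\<lambda>p. f p + g p) = (\<lambda>p. Xop s a f p + Xop s a g p)"
  by (simp add: Xop_def[abs_def] wd_add algebra_simps sum.distrib)

lemma Xop_diff: "sm f \<Longrightarrow> sm g \<Longrightarrow> Xop s a (\<lambda>p. f p - g p) = (\<lambda>p. Xop s a f p - Xop s a g p)"
  by (simp add: Xop_def[abs_def] wd_diff algebra_simps sum_subtractf)

lemma Xop_cmult: "sm f \<Longrightarrow> Xop s a (\<lambda>p. c * f p) = (\<lambda>p. c * Xop s a f p)"
  by (simp add: Xop_def[abs_def] wd_cmult algebra_simps sum_distrib_left)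

lemma Xop_sum: "(\<And>b. b \<in> I \<Longrightarrow> sm (f b)) \<Longrightarrow> Xop s a (\<lambda>p. \<Sum>b\<in>I. f b p) = (\<lambda>p. \<Sum>b\<in>I. Xop s a (f b) p)"
  unfolding Xop_def[abs_def] by (simp add: wd_sum sum_distrib_left) (subst sum.swap, rule refl)

lemma Xop_mult: "sm f \<Longrightarrow> sm g \<Longrightarrow> Xop s a (\<lambda>p. f p * g p) = (\<lambda>p. Xop s a f p * g p + f p * Xop s a g p)"
  by (simp add: Xop_def[abs_def] wd_mult algebra_simps sum.distrib sum_distrib_left sum_distrib_right)

lemma Dop_add: "sm f \<Longrightarrow> sm g \<Longrightarrow> Dop s c a (\<lambda>p. f p + g p) = (\<lambda>p. Dop s c a f p + Dop s c a g p)"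
  by (simp add: Dop_def[abs_def] Xop_add algebra_simps)

lemma Dop_diff: "sm f \<Longrightarrow> sm g \<Longrightarrow> Dop s c a (\<lambda>p. f p - g p) = (\<lambda>p. Dop s c a f p - Dop s c a g p)"
  by (simp add: Dop_def[abs_def] Xop_diff algebra_simps)

lemma Dop_sum: "(\<And>b. b \<in> I \<Longrightarrow> sm (f b)) \<Longrightarrow> Dop s c a (\<lambda>p. \<Sum>b\<in>I. f b p) = (\<lambda>p. \<Sum>b\<in>I. Dop s c a (f b) p)"
  by (simp add: Dop_def[abs_def] Xop_sum sum.distrib sum_distrib_left)

text \<open>The zeroth-order part of the operator must be charged to exactly one factor; this
  version charges the first, \<open>Dop_mult2\<close> the second.\<close>

lemma Dop_mult1: "sm f \<Longrightarrow> sm g \<Longrightarrow> Dop s c a (\<lambda>p. f p * g p) = (\<lambda>p. Dop s c a f p * g p + f p * Xop s a g p)"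
  by (simp add: Dop_def[abs_def] Xop_mult algebra_simps)

lemma Dop_mult2: "sm f \<Longrightarrow> sm g \<Longrightarrow> Dop s c a (\<lambda>p. f p * g p) = (\<lambda>p. Xop s a f p * g p + f p * Dop s c a g p)"
  by (simp add: Dop_def[abs_def] Xop_mult algebra_simps)

lemma Xop_commute: assumes f: "sm f" shows "Xop s a (Xop r b f) = Xop r b (Xop s a f)"
proof -
  have e: "Xop r b g = (\<lambda>p. \<Sum>i\<in>UNIV. b i * wd r i g p)" for g
    by (simp add: Xop_def fun_eq_iff)
  have "Xop s a (Xop r b f) = (\<lambda>p. \<Sum>i\<in>UNIV. b i * Xop s a (wd r i f) p)"
    unfolding e[of f] by (simp add: Xop_sum Xop_cmult smooth_intros smooth_wd f)
  also have "\<dots> = Xop r b (Xop s a f)"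
    unfolding e[of "Xop s a f"] by (simp add: wd_Xop f)
  finally show ?thesis .
qed

lemma Dop_cmult: "sm f \<Longrightarrow> Dop s c a (\<lambda>p. d * f p) = (\<lambda>p. d * Dop s c a f p)"
  by (simp add: Dop_def[abs_def] Xop_cmult algebra_simps)

lemma Xop_Dop: assumes f: "sm f" shows "Xop s a (Dop r c b f) = Dop r c b (Xop s a f)"
proof -
  have "Xop s a (Dop r c b f) = Xop s a (\<lambda>p. c * f p + Xop r b f p)"
    by (simp add: Dop_def[abs_def])
  also have "\<dots> = (\<lambda>p. c * Xop s a f p + Xop r b (Xop s a f) p)"
    by (simp add: f Xop_add Xop_cmult smooth_intros smooth_Xop Xop_commute[OF f, of s a r b])
  finally show ?thesis by (simp add: Dop_def[abs_def])
qed

lemma Dop_commute: assumes f: "sm f" shows "Dop s c a (Dop r d b f) = Dop r d b (Dop s c a f)"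
proof -
  have "Dop s c a (Dop r d b f) = (\<lambda>p. c * Dop r d b f p + Dop r d b (Xop s a f) p)"
    by (simp add: Dop_def[of s c a] Xop_Dop[OF f] fun_eq_iff)
  also have "\<dots> = Dop r d b (\<lambda>p. c * f p + Xop s a f p)"
    by (simp add: f Dop_add Dop_cmult smooth_intros smooth_Xop)
  finally show ?thesis by (simp add: Dop_def[of s c a, abs_def])
qed

text \<open>The splitting of the differential into its (1,0) and (0,1) parts, evaluated on the real
  vector with complex coordinates \<open>v\<close>.\<close>

lemma ddx_eq_Xop:
  assumes "sm f"
  shows "ddx v f = (\<lambda>p. Xop (- \<i>) (\<lambda>m. v $ m) f p + Xop \<i> (\<lambda>m. cnj (v $ m)) f p)"
proof
  fix p show "ddx v f p = Xop (- \<i>) (\<lambda>m. v $ m) f p + Xop \<i> (\<lambda>m. cnj (v $ m)) f p"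
  proof (cases "p \<in> T \<times> V")
    case True
    then obtain t x where p: "p = (t, x)" "t \<in> T" "x \<in> V" by auto
    have v: "v = (\<Sum>m\<in>UNIV. Re (v $ m) *\<^sub>R axis m 1 + Im (v $ m) *\<^sub>R axis m \<i>)"
    proof (rule vec_eq_iff[THEN iffD2], rule allI)
      fix i
      have "(\<Sum>m\<in>UNIV. Re (v $ m) *\<^sub>R axis m 1 + Im (v $ m) *\<^sub>R axis m \<i> :: complex^'n) $ i
        = (\<Sum>m\<in>UNIV. if m = i then v $ m else 0)"
        by (simp only: sum_component vector_add_component vector_scaleR_component, intro sum.cong refl)
           (auto simp: axis_def complex_eq_iff)
      then show "v $ i = (\<Sum>m\<in>UNIV. Re (v $ m) *\<^sub>R axis m 1 + Im (v $ m) *\<^sub>R axis m \<i> :: complex^'n) $ i"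
        by simp
    qed
    note lin = ddx_linear[OF assms p(2,3)]
    have "ddx v f p = (\<Sum>m\<in>UNIV. Re (v $ m) *\<^sub>R ddx (axis m 1) f p + Im (v $ m) *\<^sub>R ddx (axis m \<i>) f p)"
      unfolding p(1) by (subst v) (simp only: linear_sum[OF lin] linear_add[OF lin] linear_scale[OF lin])
    also have "\<dots> = (\<Sum>m\<in>UNIV. v $ m * dz m f p + cnj (v $ m) * dzb m f p)"
    proof (rule sum.cong[OF refl])
      fix m
      show "Re (v $ m) *\<^sub>R ddx (axis m 1) f p + Im (v $ m) *\<^sub>R ddx (axis m \<i>) f p =
        v $ m * dz m f p + cnj (v $ m) * dzb m f p"
        by (simp add: wd_def complex_eq_iff field_simps)
    qed
    finally show ?thesis by (simp add: Xop_def sum.distrib)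
  qed (simp add: ddx_outside Xop_def wd_outside)
qed

end

section \<open>The second-order condition at a zero of a semidefinite family of forms\<close>

lemma second_derivative_nonneg_at_min:
  fixes f :: "real \<Rightarrow> real"
  assumes d: "d > 0" and f: "\<And>s. \<bar>s\<bar> < d \<Longrightarrow> (f has_field_derivative f' s) (at s)"
    and L: "(f' has_field_derivative L) (at 0)" and min: "\<And>s. \<bar>s\<bar> < d \<Longrightarrow> f 0 \<le> f s"
  shows "0 \<le> L"
proof (rule ccontr)
  assume "\<not> 0 \<le> L"
  then obtain e where e: "e > 0" "\<And>h. h > 0 \<Longrightarrow> h < e \<Longrightarrow> f' (0 + h) < f' 0"
    using DERIV_neg_dec_right[OF L] by auto
  have 0: "f' 0 = 0"
    by (rule DERIV_local_min[OF f d]) (use d min in auto)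
  define h where "h = min d e / 2"
  have h: "h > 0" "h < d" "h < e" using d e by (auto simp: h_def)
  have "\<exists>z>0. z < h \<and> f h - f 0 = (h - 0) * f' z"
    by (rule MVT2) (use h f in auto)
  then obtain z where z: "0 < z" "z < h" "f h - f 0 = h * f' z" by auto
  have "f' z < 0" using e(2)[of z] z h 0 by auto
  then have "f h < f 0" using z h by (smt (verit) mult_pos_neg)
  then show False using min[of h] h by auto
qed

context chart_domain
begin

text \<open>Moving the base point along \<open>v\<close> and the vector along \<open>E\<close>
  simultaneously gives a nonnegative real function that vanishes at 0, so its second derivative
  there is nonnegative. The free variation \<open>E\<close> is what later makes the third
  derivatives cancel.\<close>

lemma second_order_condition_real_direction:
  fixes M :: "'a::finite \<Rightarrow> 'a \<Rightarrow> real \<times> (complex^'n) \<Rightarrow> complex"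
  assumes sm: "\<And>a c. sm (M a c)" and t: "t \<in> T" and x: "x \<in> V"
    and nonneg: "\<And>y w. y \<in> V \<Longrightarrow> 0 \<le> Re (\<Sum>a\<in>UNIV. \<Sum>c\<in>UNIV. M a c (t, y) * w a * cnj (w c))"
    and zero: "Re (\<Sum>a\<in>UNIV. \<Sum>c\<in>UNIV. M a c (t, x) * w a * cnj (w c)) = 0"
  shows "0 \<le> Re (\<Sum>a\<in>UNIV. \<Sum>c\<in>UNIV. ddx v (ddx v (M a c)) (t, x) * w a * cnj (w c)
     + 2 * ddx v (M a c) (t, x) * (E a * cnj (w c) + w a * cnj (E c)) + 2 * M a c (t, x) * E a * cnj (E c))"
proof -
  obtain r where r: "r > 0" "ball x r \<subseteq> V" using open_V x open_contains_ball by blast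
  define d where "d = r / (norm v + 1)"
  have d: "d > 0" using r by (auto simp: d_def intro!: divide_pos_pos add_nonneg_pos)
  have inV: "x + s *\<^sub>R v \<in> V" if "\<bar>s\<bar> < d" for s
  proof -
    have n: "norm v + 1 > 0" by (smt (verit) norm_ge_zero)
    have "\<bar>s\<bar> * norm v \<le> \<bar>s\<bar> * (norm v + 1)" by (simp add: mult_left_mono)
    also have "\<dots> < r" using that n by (simp add: d_def pos_less_divide_eq)
    finally show ?thesis using r by (auto simp: dist_norm subset_iff)
  qed
  have line: "((\<lambda>s. f (t, x + s *\<^sub>R v)) has_vector_derivative ddx v f (t, x + s *\<^sub>R v)) (at s)"
    if "sm f" "\<bar>s\<bar> < d" for f s
  proof -
    have *: "((\<lambda>s. x + s *\<^sub>R v) has_derivative (\<lambda>s. s *\<^sub>R v)) (at s)"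
      by (auto intro!: derivative_eq_intros)
    have "((\<lambda>s. f (t, x + s *\<^sub>R v)) has_derivative (\<lambda>c. ddx (c *\<^sub>R v) f (t, x + s *\<^sub>R v))) (at s)"
      by (rule has_derivative_compose[OF * smooth_slice_derivative]) (use that inV t in auto)
    from has_derivative_has_vector_derivative[OF this] show ?thesis
      unfolding has_vector_derivative_def
      by (simp add: linear_scale[OF ddx_linear[OF that(1) t inV[OF that(2)]]])
  qed
  let ?q = "\<lambda>a c s::real. (w a + of_real s * E a) * cnj (w c + of_real s * E c)"
  let ?q' = "\<lambda>a c s::real. E a * cnj (w c + of_real s * E c) + (w a + of_real s * E a) * cnj (E c)"
  have q: "(?q a c has_vector_derivative ?q' a c s) (at s)" for a c s
    by (auto intro!: derivative_eq_intros simp: algebra_simps)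
  have q': "(?q' a c has_vector_derivative 2 * E a * cnj (E c)) (at s)" for a c s
    by (auto intro!: derivative_eq_intros simp: algebra_simps)
  let ?f = "\<lambda>s. \<Sum>a\<in>UNIV. \<Sum>c\<in>UNIV. M a c (t, x + s *\<^sub>R v) * ?q a c s"
  let ?f' = "\<lambda>s. \<Sum>a\<in>UNIV. \<Sum>c\<in>UNIV. M a c (t, x + s *\<^sub>R v) * ?q' a c s + ddx v (M a c) (t, x + s *\<^sub>R v) * ?q a c s"
  let ?L = "\<Sum>a\<in>UNIV. \<Sum>c\<in>UNIV. (M a c (t, x + 0 *\<^sub>R v) * (2 * E a * cnj (E c)) + ddx v (M a c) (t, x + 0 *\<^sub>R v) * ?q' a c 0)
     + (ddx v (M a c) (t, x + 0 *\<^sub>R v) * ?q' a c 0 + ddx v (ddx v (M a c)) (t, x + 0 *\<^sub>R v) * ?q a c 0)"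
  have f: "(?f has_vector_derivative ?f' s) (at s)" if "\<bar>s\<bar> < d" for s
    by (intro has_vector_derivative_sum has_vector_derivative_mult q line that sm)
  have f': "(?f' has_vector_derivative ?L) (at 0)"
    by (intro has_vector_derivative_sum has_vector_derivative_mult has_vector_derivative_add q q' line sm smooth_ddx)
       (use d in auto)
  have Re: "((\<lambda>s. Re (h s)) has_field_derivative Re h') (at s)"
    if "(h has_vector_derivative h') (at s)" for h h' s
    using bounded_linear.has_vector_derivative[OF bounded_linear_Re that]
    by (simp add: has_real_derivative_iff_has_vector_derivative)
  have "0 \<le> Re ?L"
  proof (rule second_derivative_nonneg_at_min[OF d Re[OF f] Re[OF f']])
    fix s :: real assume s: "\<bar>s\<bar> < d"
    show "Re (?f 0) \<le> Re (?f s)"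
      using nonneg[OF inV[OF s], of "\<lambda>a. w a + of_real s * E a"] zero by (simp add: mult.assoc)
  qed auto
  also have "?L = (\<Sum>a\<in>UNIV. \<Sum>c\<in>UNIV. ddx v (ddx v (M a c)) (t, x) * w a * cnj (w c)
     + 2 * ddx v (M a c) (t, x) * (E a * cnj (w c) + w a * cnj (E c)) + 2 * M a c (t, x) * E a * cnj (E c))"
    by (intro sum.cong refl) (simp add: algebra_simps)
  finally show ?thesis .
qed

text \<open>Adding the conditions along \<open>v\<close> and \<open>\<i> v\<close>, with \<open>w\<close> varied by \<open>E\<close> and \<open>\<i> E\<close>, leaves only mixed derivatives.\<close>

lemma second_order_condition:
  fixes M :: "'a::finite \<Rightarrow> 'a \<Rightarrow> real \<times> (complex^'n) \<Rightarrow> complex"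
  assumes sm: "\<And>a c. sm (M a c)" and t: "t \<in> T" and x: "x \<in> V"
    and nonneg: "\<And>y w. y \<in> V \<Longrightarrow> 0 \<le> Re (\<Sum>a\<in>UNIV. \<Sum>c\<in>UNIV. M a c (t, y) * w a * cnj (w c))"
    and zero: "Re (\<Sum>a\<in>UNIV. \<Sum>c\<in>UNIV. M a c (t, x) * w a * cnj (w c)) = 0"
  shows "0 \<le> Re (\<Sum>a\<in>UNIV. \<Sum>c\<in>UNIV. Xop (- \<i>) v (Xop \<i> (\<lambda>m. cnj (v m)) (M a c)) (t, x) * w a * cnj (w c)
     + Xop \<i> (\<lambda>m. cnj (v m)) (M a c) (t, x) * E a * cnj (w c)
     + Xop (- \<i>) v (M a c) (t, x) * w a * cnj (E c)
     + M a c (t, x) * E a * cnj (E c))" (is "0 \<le> Re ?R")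
proof -
  define v1 where "v1 = (\<chi> m. v m)"
  define v2 where "v2 = (\<chi> m. \<i> * v m)"
  let ?A = "\<lambda>v E. \<Sum>a\<in>UNIV. \<Sum>c\<in>UNIV. ddx v (ddx v (M a c)) (t, x) * w a * cnj (w c)
     + 2 * ddx v (M a c) (t, x) * (E a * cnj (w c) + w a * cnj (E c)) + 2 * M a c (t, x) * E a * cnj (E c)"
  let ?P = "Xop (- \<i>) v" and ?Q = "Xop \<i> (\<lambda>m. cnj (v m))"
  have e: "ddx v1 f = (\<lambda>p. ?P f p + ?Q f p)" "ddx v2 f = (\<lambda>p. \<i> * ?P f p - \<i> * ?Q f p)" if "sm f" for f
    using that by (auto simp: ddx_eq_Xop v1_def v2_def Xop_def[abs_def] sum_distrib_left algebra_simps sum_negf)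
  have e2: "ddx v1 (ddx v1 f) p + ddx v2 (ddx v2 f) p = 4 * ?P (?Q f) p" if "sm f" for f p
    using that by (simp add: e smooth_intros smooth_Xop Xop_add Xop_diff Xop_cmult Xop_commute[of f \<i> "\<lambda>m. cnj (v m)" "- \<i>" v] algebra_simps)
  have eq: "?A v1 E + ?A v2 (\<lambda>a. \<i> * E a) = 4 * ?R"
    unfolding sum.distrib[symmetric] sum_distrib_left
  proof (intro sum.cong refl)
    fix a c
    have p1: "ddx v1 (M a c) (t, x) = ?P (M a c) (t, x) + ?Q (M a c) (t, x)"
      and p2: "ddx v2 (M a c) (t, x) = \<i> * ?P (M a c) (t, x) - \<i> * ?Q (M a c) (t, x)"
      by (simp_all add: e[OF sm])
    have p0: "ddx v1 (ddx v1 (M a c)) (t, x) = 4 * ?P (?Q (M a c)) (t, x) - ddx v2 (ddx v2 (M a c)) (t, x)"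
      by (simp only: eq_diff_eq e2[OF sm])
    then show "ddx v1 (ddx v1 (M a c)) (t, x) * w a * cnj (w c) +
             2 * ddx v1 (M a c) (t, x) * (E a * cnj (w c) + w a * cnj (E c)) +
             2 * M a c (t, x) * E a * cnj (E c) +
             (ddx v2 (ddx v2 (M a c)) (t, x) * w a * cnj (w c) +
              2 * ddx v2 (M a c) (t, x) * (\<i> * E a * cnj (w c) + w a * cnj (\<i> * E c)) +
              2 * M a c (t, x) * (\<i> * E a) * cnj (\<i> * E c)) =
        4 * (?P (?Q (M a c)) (t, x) * w a * cnj (w c) + ?Q (M a c) (t, x) * E a * cnj (w c) +
             ?P (M a c) (t, x) * w a * cnj (E c) + M a c (t, x) * E a * cnj (E c))"
      unfolding p0 p1 p2 by (simp add: algebra_simps)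
  qed
  have A: "0 \<le> Re (?A v E)" for v E
    by (rule second_order_condition_real_direction[OF assms])
  have "0 \<le> Re z" if "0 \<le> Re a" "0 \<le> Re b" "a + b = 4 * z" for a b z
  proof -
    have "Re a + Re b = 4 * Re z" using arg_cong[OF that(3), of Re] by (simp del: mult_cancel_left)
    then show ?thesis using that(1,2) by linarith
  qed
  from this[OF A A eq] show ?thesis .
qed

end

section \<open>The algebraic inequality behind the evolution equation\<close>

text \<open>Changing one coordinate of \<open>w\<close> by \<open>x\<close> changes the form by a
  quadratic polynomial in \<open>x\<close> and its conjugate. Both cases of the factorization below
  choose \<open>x\<close> to exploit this polynomial.\<close>

lemma sesquilinear_shift:
  fixes P :: "'a::finite \<Rightarrow> 'a \<Rightarrow> complex"
  assumes herm: "\<And>a b. P b a = cnj (P a b)"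
  shows "(\<Sum>a\<in>UNIV. \<Sum>b\<in>UNIV. P a b * (w a - (if a = c then x else 0)) * cnj (w b - (if b = c then x else 0)))
    = (\<Sum>a\<in>UNIV. \<Sum>b\<in>UNIV. P a b * w a * cnj (w b)) - cnj x * (\<Sum>a\<in>UNIV. P a c * w a)
      - x * cnj (\<Sum>a\<in>UNIV. P a c * w a) + x * cnj x * P c c"
proof -
  have "P a b * (w a - (if a = c then x else 0)) * cnj (w b - (if b = c then x else 0))
    = P a b * w a * cnj (w b) - (if b = c then cnj x * (P a c * w a) else 0)
     - (if a = c then x * (P c b * cnj (w b)) else 0) + (if a = c then if b = c then x * cnj x * P c c else 0 else 0)" for a b
    by (auto simp: algebra_simps)
  moreover have "(\<Sum>b\<in>UNIV. x * (P c b * cnj (w b))) = x * cnj (\<Sum>a\<in>UNIV. P a c * w a)"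
    by (simp add: sum_distrib_left herm[of _ c])
  moreover have "(\<Sum>a\<in>UNIV. \<Sum>b\<in>UNIV. if a = c then x * (P c b * cnj (w b)) else 0) = (\<Sum>b\<in>UNIV. x * (P c b * cnj (w b)))"
    by (subst sum.swap) simp
  moreover have "(\<Sum>a\<in>UNIV. \<Sum>b\<in>UNIV. if a = c then if b = c then x * cnj x * P c c else 0 else 0) = x * cnj x * P c c"
    by (subst sum.swap) simp
  ultimately show ?thesis
    by (simp add: sum.distrib sum_subtractf sum_distrib_left)
qed

text \<open>Cholesky factorization, by induction on the support \<open>A\<close>. A zero pivot
  forces its whole column to vanish, a nonzero one is split off and leaves the Schur complement. At
  most one factor per index arises, so the index type itself can number the factors.\<close>

lemma psd_factorization:
  fixes P :: "'a::finite \<Rightarrow> 'a \<Rightarrow> complex"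
  assumes "finite A" and "\<And>a b. P b a = cnj (P a b)"
    and "\<And>w. 0 \<le> Re (\<Sum>a\<in>UNIV. \<Sum>b\<in>UNIV. P a b * w a * cnj (w b))"
    and "\<And>a b. a \<notin> A \<Longrightarrow> P a b = 0"
  shows "\<exists>V. \<forall>a b. P a b = (\<Sum>s\<in>A. V s a * cnj (V s b))"
  using assms
proof (induction A arbitrary: P rule: finite_induct)
  case empty
  then show ?case by auto
next
  case (insert c A)
  note herm = insert.prems(1) and psd = insert.prems(2) and supp = insert.prems(3)
  have real: "P c c = of_real (Re (P c c))" using herm[of c c] by (simp add: complex_eq_iff)
  show ?case
  proof (cases "P c c = 0")
    case True
    have Pac: "P a c = 0" for a
    proof (rule ccontr)
      assume n: "P a c \<noteq> 0"
      let ?w = "\<lambda>b. if b = a then 1 else 0::complex"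
      \<comment> \<open>Makes the real part of the shifted form equal to
        \<open>- Re (P a a) - 2\<close>, whereas \<open>Re (P a a)\<close> itself is
        nonnegative.\<close>
      let ?r = "of_real ((Re (P a a) + 1) / (norm (P a c))\<^sup>2) :: complex"
      let ?x = "?r * P a c"
      have e1: "(\<Sum>a'\<in>UNIV. \<Sum>b\<in>UNIV. P a' b * ?w a' * cnj (?w b)) = P a a"
        by (simp add: if_distrib[of "\<lambda>z. _ * z"] if_distrib[of cnj] if_distrib[of "\<lambda>z. z * _"] cong: if_cong)
      have e2: "(\<Sum>a'\<in>UNIV. P a' c * ?w a') = P a c"
        by (simp add: if_distrib[of "\<lambda>z. _ * z"] cong: if_cong)
      have "0 \<le> Re (P a a - cnj ?x * P a c - ?x * cnj (P a c) + ?x * cnj ?x * P c c)"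
        using psd[of "\<lambda>b. ?w b - (if b = c then ?x else 0)"]
        unfolding sesquilinear_shift[of P, OF herm] e1 e2 .
      also have "P a a - cnj ?x * P a c - ?x * cnj (P a c) + ?x * cnj ?x * P c c
          = P a a - 2 * ?r * (P a c * cnj (P a c))" using True by (simp add: algebra_simps)
      also have "Re \<dots> = Re (P a a) - 2 * ((Re (P a a) + 1) / (norm (P a c))\<^sup>2) * (norm (P a c))\<^sup>2"
        by (simp only: complex_norm_square[symmetric]) simp
      also have "\<dots> = - Re (P a a) - 2" using n by simp
      finally have "Re (P a a) < 0" by simp
      moreover have "0 \<le> Re (P a a)" using psd[of ?w] unfolding e1 .
      ultimately show False by simp
    qed
    have "P a b = 0" if "a \<notin> A" for a b
    proof (cases "a = c")
      case True
      then show ?thesis using Pac[of b] herm[of c b] by (metis complex_cnj_zero)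
    qed (use supp that in auto)
    from insert.IH[OF herm psd this] obtain V where V: "\<And>a b. P a b = (\<Sum>s\<in>A. V s a * cnj (V s b))"
      by auto
    show ?thesis
      by (rule exI[of _ "V(c := (\<lambda>_. 0))"], intro allI, subst sum.insert[OF insert.hyps])
         (use insert.hyps V in \<open>auto intro!: sum.cong\<close>)
  next
    case False
    have e1: "(\<Sum>a'\<in>UNIV. \<Sum>b\<in>UNIV. P a' b * (if a' = c then 1 else 0) * cnj (if b = c then 1 else 0)) = P c c"
      by (simp add: if_distrib[of "\<lambda>z. _ * z"] if_distrib[of cnj] if_distrib[of "\<lambda>z. z * _"] cong: if_cong)
    have "0 \<le> Re (P c c)" using psd[of "\<lambda>b. if b = c then 1 else 0"] unfolding e1 .
    moreover have "Re (P c c) \<noteq> 0" using False real by (metis of_real_0)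
    ultimately have pos: "Re (P c c) > 0" by simp
    \<comment> \<open>The Schur complement of the pivot \<open>c\<close>.\<close>
    define Q where "Q a b = P a b - P a c * P c b / P c c" for a b
    have Qherm: "Q b a = cnj (Q a b)" for a b
      by (simp add: Q_def herm[symmetric] mult.commute)
    have Qpsd: "0 \<le> Re (\<Sum>a\<in>UNIV. \<Sum>b\<in>UNIV. Q a b * w a * cnj (w b))" for w
    proof -
      let ?S = "\<Sum>a\<in>UNIV. P a c * w a"
      \<comment> \<open>The minimiser over the \<open>c\<close>-coordinate: the form of
        \<open>Q\<close> at \<open>w\<close> is that of \<open>P\<close> at \<open>w\<close> with
        \<open>?x\<close> subtracted from this coordinate.\<close>
      let ?x = "?S / P c c"
      have cx: "cnj ?x = cnj ?S / P c c" using real by (metis complex_cnj_complex_of_real complex_cnj_divide)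
      have "(\<Sum>a\<in>UNIV. \<Sum>b\<in>UNIV. P a c * P c b / P c c * w a * cnj (w b)) = ?S * cnj ?S / P c c"
        by (simp add: sum_product sum_distrib_left sum_distrib_right sum_divide_distrib herm[symmetric] algebra_simps) (rule sum.swap)
      then have "(\<Sum>a\<in>UNIV. \<Sum>b\<in>UNIV. Q a b * w a * cnj (w b))
          = (\<Sum>a\<in>UNIV. \<Sum>b\<in>UNIV. P a b * w a * cnj (w b)) - ?S * cnj ?S / P c c"
        by (simp add: Q_def left_diff_distrib sum_subtractf)
      also have "\<dots> = (\<Sum>a\<in>UNIV. \<Sum>b\<in>UNIV. P a b * w a * cnj (w b)) - cnj ?x * ?S - ?x * cnj ?S + ?x * cnj ?x * P c c"
        unfolding cx using False by (simp add: field_simps)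
      also have "\<dots> = (\<Sum>a\<in>UNIV. \<Sum>b\<in>UNIV. P a b * (w a - (if a = c then ?x else 0)) * cnj (w b - (if b = c then ?x else 0)))"
        by (rule sesquilinear_shift[of P, OF herm, symmetric])
      finally have e: "(\<Sum>a\<in>UNIV. \<Sum>b\<in>UNIV. Q a b * w a * cnj (w b)) = \<dots>" .
      show ?thesis unfolding e by (rule psd)
    qed
    have Qsupp: "Q a b = 0" if "a \<notin> A" for a b
      using that supp False by (cases "a = c") (auto simp: Q_def)
    from insert.IH[OF Qherm Qpsd Qsupp] obtain V where V: "\<And>a b. Q a b = (\<Sum>s\<in>A. V s a * cnj (V s b))"
      by auto
    let ?r = "of_real (sqrt (Re (P c c))) :: complex"
    have rr: "?r * ?r = P c c" using pos real by (metis abs_of_pos of_real_mult real_sqrt_mult_self)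
    let ?V = "V(c := (\<lambda>a. P a c / ?r))"
    have "P a b = (\<Sum>s\<in>insert c A. ?V s a * cnj (?V s b))" for a b
    proof -
      have "(\<Sum>s\<in>A. ?V s a * cnj (?V s b)) = Q a b"
        unfolding V using insert.hyps by (intro sum.cong refl) auto
      then have "(\<Sum>s\<in>insert c A. ?V s a * cnj (?V s b)) = P a c / ?r * cnj (P b c / ?r) + Q a b"
        by (subst sum.insert[OF insert.hyps]) simp
      also have "\<dots> = P a b" using rr by (simp add: Q_def herm[symmetric])
      finally show ?thesis ..
    qed
    then show ?thesis by blast
  qed
qed

section \<open>The reaction term as a sum of squares\<close>

lemma sum_UNIV_sum: "(\<Sum>s\<in>UNIV. f s) = (\<Sum>a\<in>UNIV. f (Inl a)) + (\<Sum>b\<in>UNIV. f (Inr b))"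
  for f :: "'a::finite + 'b::finite \<Rightarrow> 'c::comm_monoid_add"
  by (simp add: UNIV_Plus_UNIV[symmetric] sum.Plus del: UNIV_Plus_UNIV)

lemma sum_UNIV_option: "(\<Sum>s\<in>UNIV. f s) = f None + (\<Sum>a\<in>UNIV. f (Some a))"
  for f :: "'a::finite option \<Rightarrow> 'c::comm_monoid_add"
  by (simp add: UNIV_option_conv sum.reindex)

lemma sum_UNIV_prod: "(\<Sum>s\<in>UNIV. f s) = (\<Sum>a\<in>UNIV. \<Sum>b\<in>UNIV. f (a, b))"
  for f :: "'a::finite \<times> 'b::finite \<Rightarrow> 'c::comm_monoid_add"
  by (simp add: sum.cartesian_product UNIV_Times_UNIV[symmetric] del: UNIV_Times_UNIV)

text \<open>
  \<open>quad u P P\<close> is \<open>\<langle>(P\<^sup>2 - P\<^sup>#) u, u\<rangle>\<close>, the reaction term of the evolution of the curvature.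
\<close>

definition quad :: "('n::finite \<Rightarrow> 'n \<Rightarrow> complex) \<Rightarrow> ('n \<Rightarrow> 'n \<Rightarrow> 'n \<Rightarrow> 'n \<Rightarrow> complex) \<Rightarrow>
   ('n \<Rightarrow> 'n \<Rightarrow> 'n \<Rightarrow> 'n \<Rightarrow> complex) \<Rightarrow> complex" where
  "quad u P P' = (\<Sum>i\<in>UNIV. \<Sum>j\<in>UNIV. \<Sum>k\<in>UNIV. \<Sum>l\<in>UNIV. \<Sum>m\<in>UNIV. \<Sum>n\<in>UNIV.
     u i k * cnj (u j l) * (P i j m n * P' m n k l - P m j k n * P' i n m l))"

text \<open>The \<open>tr(u V_s V_t)\<close> of the overview: \<open>u i k\<close> has its upper
  index first and \<open>W i k\<close> its lower one, hence the contraction of equal index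
  positions.\<close>

definition ucube :: "('n::finite \<Rightarrow> 'n \<Rightarrow> complex) \<Rightarrow> ('n \<Rightarrow> 'n \<Rightarrow> complex) \<Rightarrow> ('n \<Rightarrow> 'n \<Rightarrow> complex) \<Rightarrow> complex" where
  "ucube u W W' = (\<Sum>i\<in>UNIV. \<Sum>k\<in>UNIV. \<Sum>m\<in>UNIV. u i k * W i m * W' m k)"

text \<open>Inserting the factorization turns both products in \<open>quad\<close> into sums over
  pairs of factors of the numbers \<open>ucube u (V s) (V t)\<close>: the first product pairs each
  number with itself, the second one with its transpose.\<close>

lemma quad_factorized:
  fixes V :: "'s::finite \<Rightarrow> 'n::finite \<Rightarrow> 'n \<Rightarrow> complex"
  assumes P: "\<And>i j k l. P i j k l = (\<Sum>s\<in>UNIV. V s i k * cnj (V s j l))"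
  shows "quad u P P = (\<Sum>s\<in>UNIV. \<Sum>t\<in>UNIV. ucube u (V s) (V t) * cnj (ucube u (V s) (V t))
     - ucube u (V t) (V s) * cnj (ucube u (V s) (V t)))"
proof -
  have 1: "(\<Sum>i\<in>UNIV. \<Sum>j\<in>UNIV. \<Sum>k\<in>UNIV. \<Sum>l\<in>UNIV. \<Sum>m\<in>UNIV. \<Sum>n\<in>UNIV.
     u i k * cnj (u j l) * (P i j m n * P m n k l)) =
     (\<Sum>s\<in>UNIV. \<Sum>t\<in>UNIV. ucube u (V s) (V t) * cnj (ucube u (V s) (V t)))"
    unfolding P ucube_def sum_product cnj_sum sum_distrib_left sum_distrib_right
    unfolding sum.cartesian_product UNIV_Times_UNIV
    by (rule sum.reindex_bij_witness[of _ "\<lambda>(s,t,j,l,n,i,k,m). (i,j,k,l,m,n,t,s)" "\<lambda>(i,j,k,l,m,n,s,t). (t,s,j,l,n,i,k,m)"])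
       (auto simp: algebra_simps)
  have 2: "(\<Sum>i\<in>UNIV. \<Sum>j\<in>UNIV. \<Sum>k\<in>UNIV. \<Sum>l\<in>UNIV. \<Sum>m\<in>UNIV. \<Sum>n\<in>UNIV.
     u i k * cnj (u j l) * (P m j k n * P i n m l)) =
     (\<Sum>s\<in>UNIV. \<Sum>t\<in>UNIV. ucube u (V t) (V s) * cnj (ucube u (V s) (V t)))"
    unfolding P ucube_def sum_product cnj_sum sum_distrib_left sum_distrib_right
    unfolding sum.cartesian_product UNIV_Times_UNIV
    by (rule sum.reindex_bij_witness[of _ "\<lambda>(s,t,j,l,n,i,k,m). (i,j,k,l,m,n,t,s)" "\<lambda>(i,j,k,l,m,n,s,t). (t,s,j,l,n,i,k,m)"])
       (auto simp: algebra_simps)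
  show ?thesis unfolding quad_def right_diff_distrib sum_subtractf 1 2 ..
qed

text \<open>With the transposed pairing subtracted, only the antisymmetric part of \<open>Y\<close>
  survives, and the expression becomes a sum of squares.\<close>

lemma sum_antisymmetrized:
  fixes Y :: "'s::finite \<Rightarrow> 's \<Rightarrow> complex"
  shows "(\<Sum>s\<in>UNIV. \<Sum>t\<in>UNIV. Y s t * cnj (Y s t) - Y t s * cnj (Y s t))
    = (\<Sum>s\<in>UNIV. \<Sum>t\<in>UNIV. (Y s t - Y t s) * cnj (Y s t - Y t s)) / 2"
proof -
  have "(\<Sum>s\<in>UNIV. \<Sum>t\<in>UNIV. (Y s t - Y t s) * cnj (Y s t - Y t s))
    = (\<Sum>s\<in>UNIV. \<Sum>t\<in>UNIV. Y s t * cnj (Y s t) - Y t s * cnj (Y s t)) +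
      (\<Sum>s\<in>UNIV. \<Sum>t\<in>UNIV. Y t s * cnj (Y t s) - Y s t * cnj (Y t s))"
    by (simp add: sum.distrib[symmetric] algebra_simps)
  also have "(\<Sum>s\<in>UNIV. \<Sum>t\<in>UNIV. Y t s * cnj (Y t s) - Y s t * cnj (Y t s))
     = (\<Sum>s\<in>UNIV. \<Sum>t\<in>UNIV. Y s t * cnj (Y s t) - Y t s * cnj (Y s t))"
    by (rule sum.swap)
  finally show ?thesis by simp
qed

lemma sum_antisymmetric_pairing:
  fixes X c :: "'q::finite \<Rightarrow> 'q \<Rightarrow> complex"
  assumes "\<And>q p. X p q = - X q p"
  shows "2 * (\<Sum>q\<in>UNIV. \<Sum>p\<in>UNIV. X q p * cnj (c q p)) = (\<Sum>q\<in>UNIV. \<Sum>p\<in>UNIV. X q p * cnj (c q p - c p q))"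
proof -
  have "(\<Sum>q\<in>UNIV. \<Sum>p\<in>UNIV. X q p * cnj (c p q)) = (\<Sum>q\<in>UNIV. \<Sum>p\<in>UNIV. X p q * cnj (c q p))"
    by (rule sum.swap)
  also have "\<dots> = - (\<Sum>q\<in>UNIV. \<Sum>p\<in>UNIV. X q p * cnj (c q p))"
    by (simp only: sum_negf[symmetric]) (intro sum.cong refl, subst assms, simp)
  finally show ?thesis by (simp add: right_diff_distrib sum_subtractf)
qed

text \<open>The commutator of \<open>N\<close> and \<open>u\<close> as endomorphisms; for
  \<open>N\<close> a first derivative of the inverse metric it is the \<open>u\<close>-part of the
  variation \<open>E_q\<close>.\<close>

definition comm_field :: "('n::finite \<Rightarrow> 'n \<Rightarrow> complex) \<Rightarrow> ('n \<Rightarrow> 'n \<Rightarrow> complex) \<Rightarrow> 'n \<Rightarrow> 'n \<Rightarrow> complex" where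
  "comm_field u N i k = (\<Sum>m\<in>UNIV. u m k * N m i - u i m * N k m)"

text \<open>Cyclicity of the trace. It identifies the value of a factored form on the commutator
  with the mixed squares of the reaction term.\<close>

lemma contract_comm_field:
  "(\<Sum>i\<in>UNIV. \<Sum>k\<in>UNIV. comm_field u N i k * W i k) = ucube u N W - ucube u W N"
proof -
  have 1: "(\<Sum>i\<in>UNIV. \<Sum>k\<in>UNIV. \<Sum>m\<in>UNIV. u m k * N m i * W i k) = ucube u N W"
    unfolding ucube_def unfolding sum.cartesian_product UNIV_Times_UNIV
    by (rule sum.reindex_bij_witness[of _ "\<lambda>(i,k,m). (m,k,i)" "\<lambda>(i,k,m). (m,k,i)"]) auto
  have 2: "(\<Sum>i\<in>UNIV. \<Sum>k\<in>UNIV. \<Sum>m\<in>UNIV. u i m * N k m * W i k) = ucube u W N"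
    unfolding ucube_def unfolding sum.cartesian_product UNIV_Times_UNIV
    by (rule sum.reindex_bij_witness[of _ "\<lambda>(i,k,m). (i,m,k)" "\<lambda>(i,k,m). (i,m,k)"]) auto
  show ?thesis
    unfolding comm_field_def sum_distrib_right left_diff_distrib sum_subtractf 1 2 ..
qed

text \<open>Factor \<open>O'\<close>; its factors \<open>W\<close> together with \<open>N\<close>
  then factor \<open>R\<close>. The squares in \<open>quad\<close> split into three blocks. Those of
  two \<open>W\<close> are simply nonnegative, the mixed ones are exactly the subtracted
  \<open>O'\<close>-terms by \<open>contract_comm_field\<close>, and those of two \<open>N\<close>
  combine with the terms in \<open>c\<close> to the squares of \<open>X + (c - transpose c)\<close>,
  where \<open>X\<close> is the antisymmetrised \<open>ucube\<close> of the \<open>N\<close>. The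
  matrix \<open>c\<close> is arbitrary.\<close>

lemma reaction_nonneg:
  fixes N :: "'q::finite \<Rightarrow> 'n::finite \<Rightarrow> 'n \<Rightarrow> complex" and c :: "'q \<Rightarrow> 'q \<Rightarrow> complex"
  assumes herm: "\<And>i j k l. O' j i l k = cnj (O' i j k l)"
    and psd: "\<And>u. 0 \<le> Re (\<Sum>i\<in>UNIV. \<Sum>k\<in>UNIV. \<Sum>j\<in>UNIV. \<Sum>l\<in>UNIV. O' i j k l * u i k * cnj (u j l))"
    and R: "\<And>i j k l. R i j k l = O' i j k l + (\<Sum>q\<in>UNIV. N q i k * cnj (N q j l))"
  shows "0 \<le> Re (quad u R R
      - (\<Sum>q\<in>UNIV. \<Sum>i\<in>UNIV. \<Sum>k\<in>UNIV. \<Sum>j\<in>UNIV. \<Sum>l\<in>UNIV.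
           O' i j k l * comm_field u (N q) i k * cnj (comm_field u (N q) j l))
      - (\<Sum>q\<in>UNIV. \<Sum>p\<in>UNIV. c q p * cnj (c p q)) + (\<Sum>q\<in>UNIV. \<Sum>p\<in>UNIV. c q p * cnj (c q p))
      + 2 * (\<Sum>q\<in>UNIV. \<Sum>p\<in>UNIV. (ucube u (N q) (N p) - ucube u (N p) (N q)) * cnj (c q p)))"
proof -
  define PP where "PP = (\<lambda>(i, k) (j, l). O' i j k l)"
  have "\<exists>V :: 'n \<times> 'n \<Rightarrow> 'n \<times> 'n \<Rightarrow> complex. \<forall>a b. PP a b = (\<Sum>s\<in>UNIV. V s a * cnj (V s b))"
  proof (rule psd_factorization[OF finite])
    show "PP b a = cnj (PP a b)" for a b by (cases a; cases b) (simp add: PP_def herm[symmetric])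
    show "0 \<le> Re (\<Sum>a\<in>UNIV. \<Sum>b\<in>UNIV. PP a b * w a * cnj (w b))" for w
      using psd[of "\<lambda>i k. w (i, k)"] by (simp add: sum_UNIV_prod PP_def)
  qed simp
  then obtain V :: "'n \<times> 'n \<Rightarrow> 'n \<times> 'n \<Rightarrow> complex"
    where V: "\<And>a b. PP a b = (\<Sum>s\<in>UNIV. V s a * cnj (V s b))" by blast
  define W where "W s i k = V s (i, k)" for s i k
  have W: "O' i j k l = (\<Sum>s\<in>UNIV. W s i k * cnj (W s j l))" for i j k l
    using V[of "(i, k)" "(j, l)"] by (simp add: PP_def W_def)
  define Y where "Y = (\<lambda>s t. ucube u (case_sum W N s) (case_sum W N t))"
  have Ysimps: "Y (Inr q) (Inr p) = ucube u (N q) (N p)" "Y (Inl s) (Inr p) = ucube u (W s) (N p)"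
    "Y (Inr p) (Inl s) = ucube u (N p) (W s)" for q p s by (simp_all add: Y_def)
  have "quad u R R = (\<Sum>s\<in>UNIV. \<Sum>t\<in>UNIV. Y s t * cnj (Y s t) - Y t s * cnj (Y s t))"
    unfolding Y_def by (rule quad_factorized) (simp add: R W sum_UNIV_sum)
  also have "\<dots> = (\<Sum>s\<in>UNIV. \<Sum>t\<in>UNIV. (Y s t - Y t s) * cnj (Y s t - Y t s)) / 2"
    by (rule sum_antisymmetrized)
  \<comment> \<open>The mixed block occurs twice by symmetry and so loses the factor 1/2.\<close>
  also have "\<dots> = (\<Sum>s\<in>UNIV. \<Sum>t\<in>UNIV. (Y (Inl s) (Inl t) - Y (Inl t) (Inl s)) * cnj (Y (Inl s) (Inl t) - Y (Inl t) (Inl s))) / 2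
     + (\<Sum>q\<in>UNIV. \<Sum>s\<in>UNIV. (Y (Inr q) (Inl s) - Y (Inl s) (Inr q)) * cnj (Y (Inr q) (Inl s) - Y (Inl s) (Inr q)))
     + (\<Sum>q\<in>UNIV. \<Sum>p\<in>UNIV. (Y (Inr q) (Inr p) - Y (Inr p) (Inr q)) * cnj (Y (Inr q) (Inr p) - Y (Inr p) (Inr q))) / 2"
    (is "_ = ?LL + ?LR + ?RR")
  proof -
    have "(\<Sum>s\<in>UNIV. \<Sum>q\<in>UNIV. (Y (Inl s) (Inr q) - Y (Inr q) (Inl s)) * cnj (Y (Inl s) (Inr q) - Y (Inr q) (Inl s))) = ?LR"
      by (subst sum.swap) (intro sum.cong refl, simp add: algebra_simps)
    then show ?thesis by (simp add: sum_UNIV_sum sum.distrib add_divide_distrib)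
  qed
  finally have q: "quad u R R = ?LL + ?LR + ?RR" .
  have LR: "(\<Sum>q\<in>UNIV. \<Sum>i\<in>UNIV. \<Sum>k\<in>UNIV. \<Sum>j\<in>UNIV. \<Sum>l\<in>UNIV.
           O' i j k l * comm_field u (N q) i k * cnj (comm_field u (N q) j l)) = ?LR"
  proof (rule sum.cong[OF refl])
    fix q
    let ?A = "comm_field u (N q)"
    have "(\<Sum>i\<in>UNIV. \<Sum>k\<in>UNIV. \<Sum>j\<in>UNIV. \<Sum>l\<in>UNIV. O' i j k l * ?A i k * cnj (?A j l))
      = (\<Sum>s\<in>UNIV. (\<Sum>i\<in>UNIV. \<Sum>k\<in>UNIV. ?A i k * W s i k) * cnj (\<Sum>i\<in>UNIV. \<Sum>k\<in>UNIV. ?A i k * W s i k))"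
      unfolding W sum_product cnj_sum sum_distrib_left sum_distrib_right
      unfolding sum.cartesian_product UNIV_Times_UNIV
      by (rule sum.reindex_bij_witness[of _ "\<lambda>(s,j,l,i,k). (i,k,j,l,s)" "\<lambda>(i,k,j,l,s). (s,j,l,i,k)"])
         (auto simp: algebra_simps)
    then show "(\<Sum>i\<in>UNIV. \<Sum>k\<in>UNIV. \<Sum>j\<in>UNIV. \<Sum>l\<in>UNIV. O' i j k l * ?A i k * cnj (?A j l))
      = (\<Sum>s\<in>UNIV. (Y (Inr q) (Inl s) - Y (Inl s) (Inr q)) * cnj (Y (Inr q) (Inl s) - Y (Inl s) (Inr q)))"
      by (simp add: contract_comm_field Ysimps)
  qed
  let ?X = "\<lambda>q p. ucube u (N q) (N p) - ucube u (N p) (N q)"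
  have anti: "?X p q = - ?X q p" for p q by simp
  have cc: "- (\<Sum>q\<in>UNIV. \<Sum>p\<in>UNIV. c q p * cnj (c p q)) + (\<Sum>q\<in>UNIV. \<Sum>p\<in>UNIV. c q p * cnj (c q p))
      = (\<Sum>q\<in>UNIV. \<Sum>p\<in>UNIV. (c q p - c p q) * cnj (c q p - c p q)) / 2"
    using sum_antisymmetrized[of c] sum.swap[of "\<lambda>q p. c q p * cnj (c p q)" UNIV UNIV]
    by (simp add: sum_subtractf)
  have XX: "2 * (\<Sum>q\<in>UNIV. \<Sum>p\<in>UNIV. ?X q p * cnj (c q p)) = (\<Sum>q\<in>UNIV. \<Sum>p\<in>UNIV. ?X q p * cnj (c q p - c p q))"
    by (rule sum_antisymmetric_pairing[of ?X, OF anti])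
  have sq: "Re (\<Sum>q\<in>UNIV. \<Sum>p\<in>UNIV. (?X q p + (c q p - c p q)) * cnj (?X q p + (c q p - c p q))) / 2
     = Re (?RR + (\<Sum>q\<in>UNIV. \<Sum>p\<in>UNIV. (c q p - c p q) * cnj (c q p - c p q)) / 2
        + (\<Sum>q\<in>UNIV. \<Sum>p\<in>UNIV. ?X q p * cnj (c q p - c p q)))"
  proof -
    have "Re ((x + d) * cnj (x + d)) / 2 = Re (x * cnj x) / 2 + Re (d * cnj d) / 2 + Re (x * cnj d)" for x d
      by (simp add: field_simps)
    then have "(\<Sum>q\<in>UNIV. \<Sum>p\<in>UNIV. Re ((?X q p + (c q p - c p q)) * cnj (?X q p + (c q p - c p q))) / 2)
       = (\<Sum>q\<in>UNIV. \<Sum>p\<in>UNIV. Re (?X q p * cnj (?X q p)) / 2 + Re ((c q p - c p q) * cnj (c q p - c p q)) / 2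
           + Re (?X q p * cnj (c q p - c p q)))"
      by (intro sum.cong refl) blast
    then show ?thesis unfolding Ysimps
      by (simp only: sum.distrib sum_divide_distrib Re_sum plus_complex.sel Re_divide_numeral)
  qed
  have nn: "0 \<le> Re (\<Sum>q\<in>A. \<Sum>p\<in>B. h q p * cnj (h q p))" for A :: "'x set" and B :: "'y set" and h
    unfolding Re_sum by (intro sum_nonneg) simp
  have LL: "0 \<le> Re ?LL"
    unfolding Re_divide_numeral by (rule divide_nonneg_nonneg[OF nn]) simp
  have RR: "0 \<le> Re (?RR + (\<Sum>q\<in>UNIV. \<Sum>p\<in>UNIV. (c q p - c p q) * cnj (c q p - c p q)) / 2
        + (\<Sum>q\<in>UNIV. \<Sum>p\<in>UNIV. ?X q p * cnj (c q p - c p q)))"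
    unfolding sq[symmetric] by (rule divide_nonneg_nonneg[OF nn]) simp
  have "z - m - A + B + x = l + (r + C + x)"
    if "z = l + m + r" "- A + B = C" for z l m r A B C x :: complex
    unfolding that(1) that(2)[symmetric] by (simp add: algebra_simps)
  note eq = this[OF q cc, of "2 * (\<Sum>q\<in>UNIV. \<Sum>p\<in>UNIV. ?X q p * cnj (c q p))"]
  show ?thesis
    unfolding LR eq unfolding XX plus_complex.sel(1)[of ?LL] by (rule add_nonneg_nonneg[OF LL RR])
qed

section \<open>The jet form of a Hermitian metric and its evolution\<close>

context chart_domain
begin

lemma cnj_wd: "sm f \<Longrightarrow> cnj (wd s i f p) = wd (cnj s) i (\<lambda>q. cnj (f q)) p"
  by (simp add: wd_cnj)

lemma cnj_Xop: "sm f \<Longrightarrow> cnj (Xop s a f p) = Xop (cnj s) (\<lambda>i. cnj (a i)) (\<lambda>q. cnj (f q)) p"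
  by (simp add: Xop_def wd_cnj)

lemma cnj_Dop: "sm f \<Longrightarrow> cnj (Dop s c a f p) = Dop (cnj s) (cnj c) (\<lambda>i. cnj (a i)) (\<lambda>q. cnj (f q)) p"
  by (simp add: Dop_def cnj_Xop)

lemma time_derivative_Dop:
  assumes J: "open J" "J \<subseteq> T" and f: "sm f" and P: "sm P"
    and der: "\<And>t x. t \<in> J \<Longrightarrow> x \<in> V \<Longrightarrow> ((\<lambda>s. f (s, x)) has_vector_derivative P (t, x)) (at t)"
    and t: "t \<in> J" and x: "x \<in> V"
  shows "((\<lambda>s. Dop r c a f (s, x)) has_vector_derivative Dop r c a P (t, x)) (at t)"
  unfolding Dop_def Xop_def
  by (intro has_vector_derivative_add has_vector_derivative_sum has_vector_derivative_mult_right
      der t x time_derivative_wd[OF assms])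

end

text \<open>
  \<open>G i j\<close> and \<open>H k l\<close> are the components of the metric and of its inverse.  They are taken to be
  hermitian also outside \<open>T \<times> V\<close>, where they have no meaning.
\<close>

locale hermitian_chart = chart_domain T V for T :: "real set" and V :: "(complex^'n::finite) set" +
  fixes G H :: "'n \<Rightarrow> 'n \<Rightarrow> real \<times> (complex^'n) \<Rightarrow> complex"
  assumes smooth_G: "smooth_on (T \<times> V) (G i j)" and smooth_H: "smooth_on (T \<times> V) (H k l)"
    and cnj_G: "cnj (G i j p) = G j i p" and cnj_H: "cnj (H k l p) = H l k p"
    and inverse1: "p \<in> T \<times> V \<Longrightarrow> (\<Sum>l\<in>UNIV. H k l p * G m l p) = (if k = m then 1 else 0)"
    and inverse2: "p \<in> T \<times> V \<Longrightarrow> (\<Sum>k\<in>UNIV. H k l p * G k m p) = (if l = m then 1 else 0)"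
    and H_pos: "p \<in> T \<times> V \<Longrightarrow> w \<noteq> (\<lambda>_. 0) \<Longrightarrow> 0 < Re (\<Sum>k\<in>UNIV. \<Sum>l\<in>UNIV. H k l p * w k * cnj (w l))"
begin

definition DK :: "('n \<Rightarrow> complex) \<Rightarrow> ('n \<Rightarrow> 'n \<Rightarrow> complex) \<Rightarrow> 'n \<Rightarrow>
    (real \<times> (complex^'n) \<Rightarrow> complex) \<Rightarrow> real \<times> (complex^'n) \<Rightarrow> complex" where
  "DK \<xi> u k = Dop (- \<i>) (\<xi> k) (\<lambda>i. u i k)"

definition DL :: "('n \<Rightarrow> complex) \<Rightarrow> ('n \<Rightarrow> 'n \<Rightarrow> complex) \<Rightarrow> 'n \<Rightarrow>
    (real \<times> (complex^'n) \<Rightarrow> complex) \<Rightarrow> real \<times> (complex^'n) \<Rightarrow> complex" where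
  "DL \<xi> u l = Dop \<i> (cnj (\<xi> l)) (\<lambda>j. cnj (u j l))"

definition XK :: "('n \<Rightarrow> 'n \<Rightarrow> complex) \<Rightarrow> 'n \<Rightarrow>
    (real \<times> (complex^'n) \<Rightarrow> complex) \<Rightarrow> real \<times> (complex^'n) \<Rightarrow> complex" where
  "XK u k = Xop (- \<i>) (\<lambda>i. u i k)"

definition XL :: "('n \<Rightarrow> 'n \<Rightarrow> complex) \<Rightarrow> 'n \<Rightarrow>
    (real \<times> (complex^'n) \<Rightarrow> complex) \<Rightarrow> real \<times> (complex^'n) \<Rightarrow> complex" where
  "XL u l = Xop \<i> (\<lambda>j. cnj (u j l))"

lemma DK_def': "DK \<xi> u k f = (\<lambda>p. \<xi> k * f p + (\<Sum>i\<in>UNIV. u i k * dz i f p))"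
  by (simp add: DK_def Dop_def[abs_def] Xop_def)

lemma DL_def': "DL \<xi> u l f = (\<lambda>p. cnj (\<xi> l) * f p + (\<Sum>j\<in>UNIV. cnj (u j l) * dzb j f p))"
  by (simp add: DL_def Dop_def[abs_def] Xop_def)

lemma XK_def': "XK u k f = (\<lambda>p. \<Sum>i\<in>UNIV. u i k * dz i f p)"
  by (simp add: XK_def Xop_def[abs_def])

lemma XL_def': "XL u l f = (\<lambda>p. \<Sum>j\<in>UNIV. cnj (u j l) * dzb j f p)"
  by (simp add: XL_def Xop_def[abs_def])

lemma smooth_DK: "sm f \<Longrightarrow> sm (DK \<xi> u k f)"
  and smooth_DL: "sm f \<Longrightarrow> sm (DL \<xi> u k f)"
  and smooth_XK: "sm f \<Longrightarrow> sm (XK u k f)"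
  and smooth_XL: "sm f \<Longrightarrow> sm (XL u k f)"
  by (simp_all add: DK_def DL_def XK_def XL_def smooth_Dop smooth_Xop)

lemmas sms = smooth_DK smooth_DL smooth_XK smooth_XL smooth_wd smooth_G smooth_H smooth_intros

text \<open>
  The hermitian form on pairs \<open>(\<xi>, u)\<close> given by the 1-jets of \<open>H\<close>: the curvature is its Schur complement.
\<close>

definition Mform :: "('n \<Rightarrow> complex) \<Rightarrow> ('n \<Rightarrow> 'n \<Rightarrow> complex) \<Rightarrow> real \<times> (complex^'n) \<Rightarrow> complex" where
  "Mform \<xi> u p = (\<Sum>k\<in>UNIV. \<Sum>l\<in>UNIV. DK \<xi> u k (DL \<xi> u l (H k l)) p)"

definition GH :: "real \<times> (complex^'n) \<Rightarrow> 'n \<Rightarrow> 'n \<Rightarrow> 'n \<Rightarrow> 'n \<Rightarrow> complex" where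
  "GH p i j k l = G i j p * H k l p"

definition Iform :: "('n \<Rightarrow> 'n \<Rightarrow> complex) \<Rightarrow> real \<times> (complex^'n) \<Rightarrow> complex" where
  "Iform u p = (\<Sum>k\<in>UNIV. \<Sum>l\<in>UNIV. \<Sum>i\<in>UNIV. \<Sum>j\<in>UNIV. GH p i j k l * u i k * cnj (u j l))"

definition flow_rhs :: "'n \<Rightarrow> 'n \<Rightarrow> real \<times> (complex^'n) \<Rightarrow> complex" where
  "flow_rhs k l p = (\<Sum>m\<in>UNIV. \<Sum>n\<in>UNIV. H m n p * dz m (dzb n (H k l)) p - dz m (H k n) p * dzb n (H m l) p)"

text \<open>The rule for differentiating an inverse matrix, applied to
  \<open>flow_rhs\<close>.\<close>

definition flow_rhs_low :: "'n \<Rightarrow> 'n \<Rightarrow> real \<times> (complex^'n) \<Rightarrow> complex" where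
  "flow_rhs_low i j p = - (\<Sum>k\<in>UNIV. \<Sum>l\<in>UNIV. G i l p * flow_rhs k l p * G k j p)"

lemma smooth_flow_rhs: "sm (flow_rhs k l)"
  unfolding flow_rhs_def[abs_def] by (intro sms)

definition Rz :: "real \<times> (complex^'n) \<Rightarrow> 'n \<Rightarrow> 'n \<Rightarrow> 'n \<Rightarrow> 'n \<Rightarrow> complex" where
  "Rz p i j k l = dz i (dzb j (H k l)) p"

text \<open>With the second slot filled by (\<xi>, u), this is the part of the conjugate
  \<open>n\<close>-th derivative of the polarised \<open>Mform\<close> on which the operators
  \<open>DK\<close> of the first slot act.\<close>

definition Cb :: "('n \<Rightarrow> complex) \<Rightarrow> ('n \<Rightarrow> 'n \<Rightarrow> complex) \<Rightarrow> 'n \<Rightarrow> 'n \<Rightarrow> real \<times> (complex^'n) \<Rightarrow> complex" where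
  "Cb \<xi> u n k p = (\<Sum>l\<in>UNIV. DL \<xi> u l (dzb n (H k l)) p)"

definition lap :: "(real \<times> (complex^'n) \<Rightarrow> complex) \<Rightarrow> real \<times> (complex^'n) \<Rightarrow> complex" where
  "lap f p = (\<Sum>m\<in>UNIV. \<Sum>n\<in>UNIV. H m n p * dz m (dzb n f) p)"

text \<open>The terms of the evolution, beyond the Laplacian, that contain third derivatives of
  \<open>H\<close>, up to conjugation. In this shape they match the first-order part of the
  second-order condition with the commutator as variation.\<close>

definition drift :: "('n \<Rightarrow> complex) \<Rightarrow> ('n \<Rightarrow> 'n \<Rightarrow> complex) \<Rightarrow> real \<times> (complex^'n) \<Rightarrow> complex" where
  "drift \<xi> u p = (\<Sum>i\<in>UNIV. \<Sum>k\<in>UNIV. \<Sum>n\<in>UNIV. comm_field u (\<lambda>i k. dz i (H k n) p) i k * dz i (Cb \<xi> u n k) p)"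

lemma cnj_Rz: "cnj (Rz p i j k l) = Rz p j i l k"
  by (simp add: Rz_def cnj_wd sms cnj_H wd_commute)

lemma cnj_GH: "cnj (GH p i j k l) = GH p j i l k"
  by (simp add: GH_def cnj_G cnj_H)

lemma cnj_Cb: "cnj (Cb \<xi> u n k p) = (\<Sum>l\<in>UNIV. DK \<xi> u l (dz n (H l k)) p)"
  by (simp add: Cb_def DK_def DL_def cnj_Dop cnj_wd sms cnj_H)

section \<open>Evolution of the jet form\<close>

lemma wd_DK: "sm f \<Longrightarrow> wd r j (DK \<xi> u k f) = DK \<xi> u k (wd r j f)"
  and wd_DL: "sm f \<Longrightarrow> wd r j (DL \<xi> u k f) = DL \<xi> u k (wd r j f)"
  and wd_XL: "sm f \<Longrightarrow> wd r j (XL u k f) = XL u k (wd r j f)"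
  by (simp_all add: DK_def DL_def XK_def XL_def wd_Dop wd_Xop)

lemma XK_DL: "sm f \<Longrightarrow> XK u k (DL \<xi> v l f) = DL \<xi> v l (XK u k f)"
  by (simp add: XK_def DL_def Xop_Dop)

text \<open>The Leibniz rule, with the zeroth-order parts of the operators always put on the matching index.\<close>

lemma jet_leibniz_laplacian:
  assumes "sm f" "sm h"
  shows "DK \<xi> u k (DL \<xi> u l (\<lambda>p. h p * f p)) = (\<lambda>p. h p * DK \<xi> u k (DL \<xi> u l f) p
     + XK u k h p * DL \<xi> u l f p + XL u l h p * DK \<xi> u k f p + XK u k (XL u l h) p * f p)"
proof -
  have "DL \<xi> u l (\<lambda>p. h p * f p) = (\<lambda>p. XL u l h p * f p + h p * DL \<xi> u l f p)"
    using assms by (simp add: DL_def XL_def Dop_mult2)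
  moreover have "DK \<xi> u k (\<lambda>p. XL u l h p * f p + h p * DL \<xi> u l f p) =
     (\<lambda>p. (XK u k (XL u l h) p * f p + XL u l h p * DK \<xi> u k f p) + (XK u k h p * DL \<xi> u l f p + h p * DK \<xi> u k (DL \<xi> u l f) p))"
    using assms by (simp add: DK_def XK_def Dop_add Dop_mult2 sms)
  ultimately show ?thesis by (simp add: algebra_simps)
qed

lemma jet_leibniz_gradient:
  assumes "sm f" "sm h"
  shows "DK \<xi> u k (DL \<xi> u l (\<lambda>p. f p * h p)) = (\<lambda>p. DK \<xi> u k (XL u l f) p * h p
     + XL u l f p * XK u k h p + DK \<xi> u k f p * DL \<xi> u l h p + f p * XK u k (DL \<xi> u l h) p)"
proof -
  have "DL \<xi> u l (\<lambda>p. f p * h p) = (\<lambda>p. XL u l f p * h p + f p * DL \<xi> u l h p)"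
    using assms by (simp add: DL_def XL_def Dop_mult2)
  moreover have "DK \<xi> u k (\<lambda>p. XL u l f p * h p + f p * DL \<xi> u l h p) =
     (\<lambda>p. (DK \<xi> u k (XL u l f) p * h p + XL u l f p * XK u k h p) + (DK \<xi> u k f p * DL \<xi> u l h p + f p * XK u k (DL \<xi> u l h) p))"
    using assms by (simp add: DK_def XK_def Dop_add Dop_mult1 sms)
  ultimately show ?thesis by (simp add: algebra_simps)
qed

lemma jet_flow_rhs_expand:
  "(\<Sum>k\<in>UNIV. \<Sum>l\<in>UNIV. DK \<xi> u k (DL \<xi> u l (flow_rhs k l)) p) =
    (\<Sum>k\<in>UNIV. \<Sum>l\<in>UNIV. \<Sum>m\<in>UNIV. \<Sum>n\<in>UNIV.
      (H m n p * DK \<xi> u k (DL \<xi> u l (dz m (dzb n (H k l)))) p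
       + XK u k (H m n) p * DL \<xi> u l (dz m (dzb n (H k l))) p
       + XL u l (H m n) p * DK \<xi> u k (dz m (dzb n (H k l))) p
       + XK u k (XL u l (H m n)) p * dz m (dzb n (H k l)) p)
      - (DK \<xi> u k (XL u l (dz m (H k n))) p * dzb n (H m l) p
       + XL u l (dz m (H k n)) p * XK u k (dzb n (H m l)) p
       + DK \<xi> u k (dz m (H k n)) p * DL \<xi> u l (dzb n (H m l)) p
       + dz m (H k n) p * XK u k (DL \<xi> u l (dzb n (H m l))) p))"
proof -
  have l: "DL \<xi> u l (flow_rhs k l) = (\<lambda>p. \<Sum>m\<in>UNIV. \<Sum>n\<in>UNIV.
      DL \<xi> u l (\<lambda>p. H m n p * dz m (dzb n (H k l)) p) p - DL \<xi> u l (\<lambda>p. dz m (H k n) p * dzb n (H m l) p) p)" for k l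
    unfolding flow_rhs_def[abs_def] DL_def by (simp add: Dop_sum Dop_diff sms)
  have "DK \<xi> u k (DL \<xi> u l (flow_rhs k l)) = (\<lambda>p. \<Sum>m\<in>UNIV. \<Sum>n\<in>UNIV.
      DK \<xi> u k (DL \<xi> u l (\<lambda>p. H m n p * dz m (dzb n (H k l)) p)) p
      - DK \<xi> u k (DL \<xi> u l (\<lambda>p. dz m (H k n) p * dzb n (H m l) p)) p)" for k l
    unfolding l unfolding DK_def by (simp add: Dop_sum Dop_diff sms)
  then show ?thesis
    by (simp add: jet_leibniz_laplacian[where h = "H m n" for m n]
        jet_leibniz_gradient[where f = "dz m (H k n)" for m k n] sms)
qed

text \<open>The two sums stem from the two products in the flow. Renaming the summation indices
  shows that they share the factor \<open>dz i (Cb \<xi> u n k) p\<close>, and what multiplies it is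
  the commutator; this is where the \<open>u\<close>-part of \<open>E_q\<close> comes from.\<close>

lemma drift_eq:
  "drift \<xi> u p = (\<Sum>k\<in>UNIV. \<Sum>l\<in>UNIV. \<Sum>m\<in>UNIV. \<Sum>n\<in>UNIV. XK u k (H m n) p * DL \<xi> u l (dz m (dzb n (H k l))) p)
    - (\<Sum>k\<in>UNIV. \<Sum>l\<in>UNIV. \<Sum>m\<in>UNIV. \<Sum>n\<in>UNIV. dz m (H k n) p * XK u k (DL \<xi> u l (dzb n (H m l))) p)"
proof -
  have C: "dz i (Cb \<xi> u n k) p = (\<Sum>l\<in>UNIV. DL \<xi> u l (dz i (dzb n (H k l))) p)" for i n k
    unfolding Cb_def[abs_def] by (simp add: wd_sum sms wd_DL)
  have "drift \<xi> u p = (\<Sum>i\<in>UNIV. \<Sum>k\<in>UNIV. \<Sum>n\<in>UNIV. \<Sum>m\<in>UNIV. u m k * dz m (H i n) p * dz i (Cb \<xi> u n k) p)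
     - (\<Sum>i\<in>UNIV. \<Sum>k\<in>UNIV. \<Sum>n\<in>UNIV. \<Sum>m\<in>UNIV. u i m * dz k (H m n) p * dz i (Cb \<xi> u n k) p)"
    unfolding drift_def comm_field_def by (simp only: sum_distrib_right left_diff_distrib sum_subtractf)
  also have "(\<Sum>i\<in>UNIV. \<Sum>k\<in>UNIV. \<Sum>n\<in>UNIV. \<Sum>m\<in>UNIV. u m k * dz m (H i n) p * dz i (Cb \<xi> u n k) p)
     = (\<Sum>k\<in>UNIV. \<Sum>l\<in>UNIV. \<Sum>m\<in>UNIV. \<Sum>n\<in>UNIV. XK u k (H m n) p * DL \<xi> u l (dz m (dzb n (H k l))) p)"
    unfolding C XK_def' sum_distrib_left sum_distrib_right
    unfolding sum.cartesian_product UNIV_Times_UNIV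
    by (rule sum.reindex_bij_witness[of _ "\<lambda>(k,l,m,n,i). (m,k,n,i,l)" "\<lambda>(i,k,n,m,l). (k,l,i,n,m)"])
       auto
  also have "(\<Sum>i\<in>UNIV. \<Sum>k\<in>UNIV. \<Sum>n\<in>UNIV. \<Sum>m\<in>UNIV. u i m * dz k (H m n) p * dz i (Cb \<xi> u n k) p)
     = (\<Sum>k\<in>UNIV. \<Sum>l\<in>UNIV. \<Sum>m\<in>UNIV. \<Sum>n\<in>UNIV. dz m (H k n) p * XK u k (DL \<xi> u l (dzb n (H m l))) p)"
    unfolding C unfolding XK_def' wd_DL[OF smooth_wd[OF smooth_H]] sum_distrib_left sum_distrib_right
    unfolding sum.cartesian_product UNIV_Times_UNIV
    by (rule sum.reindex_bij_witness[of _ "\<lambda>(k,l,m,n,i). (i,m,n,k,l)" "\<lambda>(i,k,n,m,l). (m,l,k,n,i)"])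
       auto
  finally show ?thesis .
qed

lemma cnj_drift_eq:
  "cnj (drift \<xi> u p) = (\<Sum>k\<in>UNIV. \<Sum>l\<in>UNIV. \<Sum>m\<in>UNIV. \<Sum>n\<in>UNIV. XL u l (H m n) p * DK \<xi> u k (dz m (dzb n (H k l))) p)
    - (\<Sum>k\<in>UNIV. \<Sum>l\<in>UNIV. \<Sum>m\<in>UNIV. \<Sum>n\<in>UNIV. DK \<xi> u k (XL u l (dz m (H k n))) p * dzb n (H m l) p)"
proof -
  have 1: "cnj (XK u k (H m n) p * DL \<xi> u l (dz m (dzb n (H k l))) p)
     = XL u k (H n m) p * DK \<xi> u l (dz n (dzb m (H l k))) p" for k l m n
    by (simp add: XK_def XL_def DK_def DL_def cnj_Dop cnj_Xop cnj_wd sms cnj_H wd_commute[of "H l k" "\<i>" m "-\<i>" n])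
  have 2: "cnj (dz m (H k n) p * XK u k (DL \<xi> u l (dzb n (H m l))) p)
     = DK \<xi> u l (XL u k (dz n (H l m))) p * dzb m (H n k) p" for k l m n
    by (simp add: XK_DL sms) (simp add: XK_def XL_def DK_def DL_def cnj_Dop cnj_Xop cnj_wd smooth_Xop sms cnj_H)
  show ?thesis unfolding drift_eq complex_cnj_diff cnj_sum 1 2
    unfolding sum.cartesian_product UNIV_Times_UNIV
    by (intro arg_cong2[where f = "(-)"] sum.reindex_bij_witness[of _ "\<lambda>(k,l,m,n). (l,k,n,m)" "\<lambda>(k,l,m,n). (l,k,n,m)"])
       auto
qed

text \<open>The zeroth-order parts of the operators do not occur in these two sums, since the
  Leibniz rules put them on the respective other factor; only products of second derivatives of
  \<open>H\<close> are left.\<close>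

lemma quad_eq:
  "quad u (Rz p) (Rz p) = (\<Sum>k\<in>UNIV. \<Sum>l\<in>UNIV. \<Sum>m\<in>UNIV. \<Sum>n\<in>UNIV. XK u k (XL u l (H m n)) p * dz m (dzb n (H k l)) p)
    - (\<Sum>k\<in>UNIV. \<Sum>l\<in>UNIV. \<Sum>m\<in>UNIV. \<Sum>n\<in>UNIV. XL u l (dz m (H k n)) p * XK u k (dzb n (H m l)) p)"
proof -
  have 1: "XK u k (XL u l (H m n)) p = (\<Sum>i\<in>UNIV. \<Sum>j\<in>UNIV. u i k * (cnj (u j l) * Rz p i j m n))" for k l m n
    unfolding XK_def' by (simp add: XL_def' wd_sum wd_cmult sms sum_distrib_left Rz_def)
  have 2: "XL u l (dz m (H k n)) p = (\<Sum>j\<in>UNIV. cnj (u j l) * Rz p m j k n)" for k l m n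
    by (simp add: XL_def' Rz_def wd_commute[of _ \<i> _ "-\<i>"] sms)
  have 3: "XK u k (dzb n (H m l)) p = (\<Sum>i\<in>UNIV. u i k * Rz p i n m l)" for k l m n
    by (simp add: XK_def' Rz_def)
  have 4: "dz m (dzb n (H k l)) p = Rz p m n k l" for k l m n
    by (simp add: Rz_def)
  have A: "(\<Sum>i\<in>UNIV. \<Sum>j\<in>UNIV. \<Sum>k\<in>UNIV. \<Sum>l\<in>UNIV. \<Sum>m\<in>UNIV. \<Sum>n\<in>UNIV. u i k * cnj (u j l) * (Rz p i j m n * Rz p m n k l))
     = (\<Sum>k\<in>UNIV. \<Sum>l\<in>UNIV. \<Sum>m\<in>UNIV. \<Sum>n\<in>UNIV. XK u k (XL u l (H m n)) p * dz m (dzb n (H k l)) p)"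
    unfolding 1 4 sum_distrib_right
    unfolding sum.cartesian_product UNIV_Times_UNIV
    by (rule sum.reindex_bij_witness[of _ "\<lambda>(k,l,m,n,i,j). (i,j,k,l,m,n)" "\<lambda>(i,j,k,l,m,n). (k,l,m,n,i,j)"])
       (auto simp: algebra_simps)
  have B: "(\<Sum>i\<in>UNIV. \<Sum>j\<in>UNIV. \<Sum>k\<in>UNIV. \<Sum>l\<in>UNIV. \<Sum>m\<in>UNIV. \<Sum>n\<in>UNIV. u i k * cnj (u j l) * (Rz p m j k n * Rz p i n m l))
     = (\<Sum>k\<in>UNIV. \<Sum>l\<in>UNIV. \<Sum>m\<in>UNIV. \<Sum>n\<in>UNIV. XL u l (dz m (H k n)) p * XK u k (dzb n (H m l)) p)"
    unfolding 2 3 sum_product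
    unfolding sum.cartesian_product UNIV_Times_UNIV
    by (rule sum.reindex_bij_witness[of _ "\<lambda>(k,l,m,n,j,i). (i,j,k,l,m,n)" "\<lambda>(i,j,k,l,m,n). (k,l,m,n,j,i)"])
       (auto simp: algebra_simps)
  show ?thesis unfolding quad_def right_diff_distrib sum_subtractf A B ..
qed

lemma gradient_square_eq:
  "(\<Sum>m\<in>UNIV. \<Sum>n\<in>UNIV. cnj (Cb \<xi> u m n p) * Cb \<xi> u n m p) =
   (\<Sum>k\<in>UNIV. \<Sum>l\<in>UNIV. \<Sum>m\<in>UNIV. \<Sum>n\<in>UNIV. DK \<xi> u k (dz m (H k n)) p * DL \<xi> u l (dzb n (H m l)) p)"
  unfolding cnj_Cb unfolding Cb_def sum_product
  unfolding sum.cartesian_product UNIV_Times_UNIV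
  by (rule sum.reindex_bij_witness[of _ "\<lambda>(k,l,m,n). (m,n,k,l)" "\<lambda>(m,n,k,l). (k,l,m,n)"]) auto

text \<open>The evolution of \<open>Mform\<close>: Laplacian, third-order terms, reaction and a
  gradient term. The last one pairs \<open>Cb\<close> with its transpose and has no sign of its
  own.\<close>

lemma jet_flow_rhs:
  "(\<Sum>k\<in>UNIV. \<Sum>l\<in>UNIV. DK \<xi> u k (DL \<xi> u l (flow_rhs k l)) p) =
    (\<Sum>k\<in>UNIV. \<Sum>l\<in>UNIV. \<Sum>m\<in>UNIV. \<Sum>n\<in>UNIV. H m n p * DK \<xi> u k (DL \<xi> u l (dz m (dzb n (H k l)))) p)
    + drift \<xi> u p + cnj (drift \<xi> u p) + quad u (Rz p) (Rz p)
    - (\<Sum>m\<in>UNIV. \<Sum>n\<in>UNIV. cnj (Cb \<xi> u m n p) * Cb \<xi> u n m p)"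
  unfolding jet_flow_rhs_expand gradient_square_eq quad_eq cnj_drift_eq unfolding drift_eq
  by (simp only: sum.distrib sum_subtractf) (simp only: algebra_simps)

end

section \<open>The second-order condition for the jet form\<close>

context hermitian_chart
begin

definition jz :: "'n option \<Rightarrow> (real \<times> (complex^'n) \<Rightarrow> complex) \<Rightarrow> real \<times> (complex^'n) \<Rightarrow> complex" where
  "jz a f = (case a of None \<Rightarrow> f | Some i \<Rightarrow> dz i f)"

definition jzb :: "'n option \<Rightarrow> (real \<times> (complex^'n) \<Rightarrow> complex) \<Rightarrow> real \<times> (complex^'n) \<Rightarrow> complex" where
  "jzb a f = (case a of None \<Rightarrow> f | Some i \<Rightarrow> dzb i f)"

text \<open>The pair (\<xi>, u) is encoded as one vector indexed by \<open>(k, a)\<close>, with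
  \<open>a = None\<close> for \<open>\<xi> k\<close> and \<open>a = Some i\<close> for
  \<open>u i k\<close>, so that the second-order condition for matrices of functions
  applies.\<close>

definition jet_matrix :: "complex \<Rightarrow> 'n \<times> 'n option \<Rightarrow> 'n \<times> 'n option \<Rightarrow> real \<times> (complex^'n) \<Rightarrow> complex" where
  "jet_matrix \<eta> = (\<lambda>(k, a) (l, c) p. jz a (jzb c (H k l)) p
     + (case a of None \<Rightarrow> 0 | Some i \<Rightarrow> (case c of None \<Rightarrow> 0 | Some j \<Rightarrow> \<eta> * GH p i j k l)))"

definition wpack :: "('n \<Rightarrow> complex) \<Rightarrow> ('n \<Rightarrow> 'n \<Rightarrow> complex) \<Rightarrow> 'n \<times> 'n option \<Rightarrow> complex" where
  "wpack \<xi> u = (\<lambda>(k, a). case a of None \<Rightarrow> \<xi> k | Some i \<Rightarrow> u i k)"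

lemma smooth_GH: "sm (\<lambda>p. GH p i j k l)"
  unfolding GH_def by (intro sms)

lemma DK_DL_expand:
  assumes "sm f"
  shows "DK \<xi> u k (DL \<xi>' u' l f) p = \<xi> k * cnj (\<xi>' l) * f p
     + (\<Sum>j\<in>UNIV. \<xi> k * cnj (u' j l) * dzb j f p)
     + (\<Sum>i\<in>UNIV. u i k * cnj (\<xi>' l) * dz i f p)
     + (\<Sum>i\<in>UNIV. \<Sum>j\<in>UNIV. u i k * cnj (u' j l) * dz i (dzb j f) p)"
proof -
  have "dz i (DL \<xi>' u' l f) p = cnj (\<xi>' l) * dz i f p + (\<Sum>j\<in>UNIV. cnj (u' j l) * dz i (dzb j f) p)" for i
    unfolding DL_def' using assms by (simp add: wd_add wd_cmult wd_sum sms)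
  then show ?thesis
    unfolding DK_def' by (simp add: DL_def' algebra_simps sum_distrib_left sum.distrib)
qed

lemma smooth_jz: "sm f \<Longrightarrow> sm (jz a f)" and smooth_jzb: "sm f \<Longrightarrow> sm (jzb a f)"
  by (auto simp: jz_def jzb_def smooth_wd split: option.splits)

lemma smooth_jet_matrix: "sm (jet_matrix \<eta> a c)"
proof -
  obtain k a' l c' where [simp]: "a = (k, a')" "c = (l, c')" by (cases a; cases c)
  have "sm (\<lambda>p. case a' of None \<Rightarrow> 0 | Some i \<Rightarrow> (case c' of None \<Rightarrow> 0 | Some j \<Rightarrow> \<eta> * GH p i j k l))"
    by (cases a'; cases c') (auto intro: sms smooth_GH)
  then show ?thesis
    unfolding jet_matrix_def by (simp add: smooth_on_add smooth_jz smooth_jzb smooth_H)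
qed

text \<open>One computation for any linear operator \<open>L\<close> that commutes with the
  coordinate derivatives; it serves for the identity, the derivative along a vector, its conjugate
  and their composition.\<close>

lemma jet_matrix_sum:
  assumes sm: "\<And>f. sm f \<Longrightarrow> sm (L f)"
    and add: "\<And>f g. sm f \<Longrightarrow> sm g \<Longrightarrow> L (\<lambda>p. f p + g p) = (\<lambda>p. L f p + L g p)"
    and cmult: "\<And>f c. sm f \<Longrightarrow> L (\<lambda>p. c * f p) = (\<lambda>p. c * L f p)"
    and wd: "\<And>f s i. sm f \<Longrightarrow> L (wd s i f) = wd s i (L f)"
  shows "(\<Sum>a\<in>UNIV. \<Sum>c\<in>UNIV. L (jet_matrix \<eta> a c) p * wpack \<xi> u a * cnj (wpack \<xi>' u' c)) =
     (\<Sum>k\<in>UNIV. \<Sum>l\<in>UNIV. DK \<xi> u k (DL \<xi>' u' l (L (H k l))) p)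
     + \<eta> * (\<Sum>k\<in>UNIV. \<Sum>l\<in>UNIV. \<Sum>i\<in>UNIV. \<Sum>j\<in>UNIV. L (\<lambda>p. GH p i j k l) p * u i k * cnj (u' j l))"
proof -
  let ?g = "\<lambda>k l a c. L (jet_matrix \<eta> (k, a) (l, c)) p * wpack \<xi> u (k, a) * cnj (wpack \<xi>' u' (l, c))"
  have "(\<Sum>a\<in>UNIV. \<Sum>c\<in>UNIV. L (jet_matrix \<eta> a c) p * wpack \<xi> u a * cnj (wpack \<xi>' u' c))
    = (\<Sum>k\<in>UNIV. \<Sum>a\<in>UNIV. \<Sum>l\<in>UNIV. \<Sum>c\<in>UNIV. ?g k l a c)"
    by (simp only: sum_UNIV_prod)
  also have "\<dots> = (\<Sum>k\<in>UNIV. \<Sum>l\<in>UNIV. \<Sum>a\<in>UNIV. \<Sum>c\<in>UNIV. ?g k l a c)"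
    by (intro sum.cong refl) (rule sum.swap)
  also have "\<dots> = (\<Sum>k\<in>UNIV. \<Sum>l\<in>UNIV. DK \<xi> u k (DL \<xi>' u' l (L (H k l))) p
     + \<eta> * (\<Sum>i\<in>UNIV. \<Sum>j\<in>UNIV. L (\<lambda>p. GH p i j k l) p * u i k * cnj (u' j l)))"
  proof (intro sum.cong refl)
    fix k l
    have 0: "?g k l None None = \<xi> k * cnj (\<xi>' l) * L (H k l) p"
      by (simp add: jet_matrix_def wpack_def jz_def jzb_def)
    have 1: "?g k l None (Some j) = \<xi> k * cnj (u' j l) * dzb j (L (H k l)) p" for j
      by (simp add: jet_matrix_def wpack_def jz_def jzb_def wd smooth_H)
    have 2: "?g k l (Some i) None = u i k * cnj (\<xi>' l) * dz i (L (H k l)) p" for i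
      by (simp add: jet_matrix_def wpack_def jz_def jzb_def wd smooth_H)
    have 3: "?g k l (Some i) (Some j) = u i k * cnj (u' j l) * dz i (dzb j (L (H k l))) p
        + \<eta> * (L (\<lambda>p. GH p i j k l) p * u i k * cnj (u' j l))" for i j
      by (simp add: jet_matrix_def wpack_def jz_def jzb_def wd sms smooth_GH add cmult algebra_simps)
    show "(\<Sum>a\<in>UNIV. \<Sum>c\<in>UNIV. ?g k l a c) = DK \<xi> u k (DL \<xi>' u' l (L (H k l))) p
     + \<eta> * (\<Sum>i\<in>UNIV. \<Sum>j\<in>UNIV. L (\<lambda>p. GH p i j k l) p * u i k * cnj (u' j l))"
      unfolding sum_UNIV_option 0 1 2 3 DK_DL_expand[OF sm[OF smooth_H]]
      by (simp add: sum.distrib sum_distrib_left)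
  qed
  finally show ?thesis by (simp add: sum.distrib sum_distrib_left)
qed

lemma jet_matrix_form:
  "(\<Sum>a\<in>UNIV. \<Sum>c\<in>UNIV. jet_matrix \<eta> a c p * wpack \<xi> u a * cnj (wpack \<xi> u c)) = Mform \<xi> u p + \<eta> * Iform u p"
  using jet_matrix_sum[of "\<lambda>f. f" \<eta> p \<xi> u \<xi> u] by (simp add: Mform_def Iform_def)

lemma wpack_surj: "w = wpack (\<lambda>k. w (k, None)) (\<lambda>i k. w (k, Some i))"
  by (auto simp: wpack_def fun_eq_iff split: option.splits)

text \<open>The two mixed terms of the second-order condition are complex conjugates of each other,
  so one of them is kept with the factor 2.\<close>

lemma null_second_order:
  assumes t: "t \<in> T" and x: "x \<in> V"
    and nonneg: "\<And>y \<xi> u. y \<in> V \<Longrightarrow> 0 \<le> Re (Mform \<xi> u (t, y) + of_real \<eta> * Iform u (t, y))"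
    and zero: "Re (Mform \<xi> u (t, x) + of_real \<eta> * Iform u (t, x)) = 0"
  defines "p \<equiv> (t, x)"
  shows "0 \<le> Re (
      (\<Sum>k\<in>UNIV. \<Sum>l\<in>UNIV. DK \<xi> u k (DL \<xi> u l (Xop (-\<i>) v (Xop \<i> (\<lambda>m. cnj (v m)) (H k l)))) p)
      + of_real \<eta> * (\<Sum>k\<in>UNIV. \<Sum>l\<in>UNIV. \<Sum>i\<in>UNIV. \<Sum>j\<in>UNIV.
           Xop (-\<i>) v (Xop \<i> (\<lambda>m. cnj (v m)) (\<lambda>p. GH p i j k l)) p * u i k * cnj (u j l))
      + 2 * ((\<Sum>k\<in>UNIV. \<Sum>l\<in>UNIV. DK \<zeta> A k (DL \<xi> u l (Xop \<i> (\<lambda>m. cnj (v m)) (H k l))) p)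
      + of_real \<eta> * (\<Sum>k\<in>UNIV. \<Sum>l\<in>UNIV. \<Sum>i\<in>UNIV. \<Sum>j\<in>UNIV.
           Xop \<i> (\<lambda>m. cnj (v m)) (\<lambda>p. GH p i j k l) p * A i k * cnj (u j l)))
      + (Mform \<zeta> A p + of_real \<eta> * Iform A p))"
proof -
  let ?M = "jet_matrix (of_real \<eta>)" and ?P = "Xop (- \<i>) v" and ?Q = "Xop \<i> (\<lambda>m. cnj (v m))"
  let ?w = "wpack \<xi> u" and ?E = "wpack \<zeta> A"
  have "0 \<le> Re (\<Sum>a\<in>UNIV. \<Sum>c\<in>UNIV. ?P (?Q (?M a c)) (t, x) * ?w a * cnj (?w c)
     + ?Q (?M a c) (t, x) * ?E a * cnj (?w c)
     + ?P (?M a c) (t, x) * ?w a * cnj (?E c)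
     + ?M a c (t, x) * ?E a * cnj (?E c))"
  proof (rule second_order_condition[OF smooth_jet_matrix t x])
    show "0 \<le> Re (\<Sum>a\<in>UNIV. \<Sum>c\<in>UNIV. ?M a c (t, y) * w a * cnj (w c))" if "y \<in> V" for y w
      by (subst (1 2) wpack_surj[of w]) (simp only: jet_matrix_form nonneg[OF that])
    show "Re (\<Sum>a\<in>UNIV. \<Sum>c\<in>UNIV. ?M a c (t, x) * ?w a * cnj (?w c)) = 0"
      by (simp only: jet_matrix_form zero)
  qed
  moreover have "(\<Sum>a\<in>UNIV. \<Sum>c\<in>UNIV. ?P (?Q (?M a c)) p * ?w a * cnj (?w c)) =
      (\<Sum>k\<in>UNIV. \<Sum>l\<in>UNIV. DK \<xi> u k (DL \<xi> u l (?P (?Q (H k l)))) p)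
      + of_real \<eta> * (\<Sum>k\<in>UNIV. \<Sum>l\<in>UNIV. \<Sum>i\<in>UNIV. \<Sum>j\<in>UNIV.
           ?P (?Q (\<lambda>p. GH p i j k l)) p * u i k * cnj (u j l))"
    by (rule jet_matrix_sum[of "\<lambda>f. ?P (?Q f)"]) (simp_all add: smooth_Xop Xop_add Xop_cmult wd_Xop)
  moreover have "(\<Sum>a\<in>UNIV. \<Sum>c\<in>UNIV. ?Q (?M a c) p * ?E a * cnj (?w c)) =
      (\<Sum>k\<in>UNIV. \<Sum>l\<in>UNIV. DK \<zeta> A k (DL \<xi> u l (?Q (H k l))) p)
      + of_real \<eta> * (\<Sum>k\<in>UNIV. \<Sum>l\<in>UNIV. \<Sum>i\<in>UNIV. \<Sum>j\<in>UNIV.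
           ?Q (\<lambda>p. GH p i j k l) p * A i k * cnj (u j l))" (is "_ = ?CR")
    by (rule jet_matrix_sum[of ?Q]) (simp_all add: smooth_Xop Xop_add Xop_cmult wd_Xop)
  moreover have "(\<Sum>a\<in>UNIV. \<Sum>c\<in>UNIV. ?P (?M a c) p * ?w a * cnj (?E c)) =
      (\<Sum>k\<in>UNIV. \<Sum>l\<in>UNIV. DK \<xi> u k (DL \<zeta> A l (?P (H k l))) p)
      + of_real \<eta> * (\<Sum>k\<in>UNIV. \<Sum>l\<in>UNIV. \<Sum>i\<in>UNIV. \<Sum>j\<in>UNIV.
           ?P (\<lambda>p. GH p i j k l) p * u i k * cnj (A j l))"
    by (rule jet_matrix_sum[of ?P]) (simp_all add: smooth_Xop Xop_add Xop_cmult wd_Xop)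
  moreover have "\<dots> = cnj ?CR"
  proof -
    have 1: "cnj (DK \<zeta> A k (DL \<xi> u l (?Q (H k l))) p) = DK \<xi> u l (DL \<zeta> A k (?P (H l k))) p" for k l
      by (simp add: DK_def DL_def cnj_Dop cnj_Xop smooth_Xop smooth_Dop sms cnj_H Dop_commute)
    have 2: "cnj (?Q (\<lambda>p. GH p i j k l) p * A i k * cnj (u j l)) = ?P (\<lambda>p. GH p j i l k) p * u j l * cnj (A i k)" for i j k l
      by (simp add: cnj_Xop smooth_GH cnj_GH)
    have 3: "cnj (\<Sum>k\<in>UNIV. \<Sum>l\<in>UNIV. \<Sum>i\<in>UNIV. \<Sum>j\<in>UNIV. ?Q (\<lambda>p. GH p i j k l) p * A i k * cnj (u j l))
       = (\<Sum>k\<in>UNIV. \<Sum>l\<in>UNIV. \<Sum>i\<in>UNIV. \<Sum>j\<in>UNIV. ?P (\<lambda>p. GH p i j k l) p * u i k * cnj (A j l))"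
      unfolding cnj_sum 2
      unfolding sum.cartesian_product UNIV_Times_UNIV
      by (rule sum.reindex_bij_witness[of _ "\<lambda>(k,l,i,j). (l,k,j,i)" "\<lambda>(k,l,i,j). (l,k,j,i)"]) auto
    have 4: "cnj (\<Sum>k\<in>UNIV. \<Sum>l\<in>UNIV. DK \<zeta> A k (DL \<xi> u l (?Q (H k l))) p)
       = (\<Sum>k\<in>UNIV. \<Sum>l\<in>UNIV. DK \<xi> u k (DL \<zeta> A l (?P (H k l))) p)"
      unfolding cnj_sum 1 by (rule sum.swap)
    show ?thesis by (simp only: complex_cnj_add complex_cnj_mult 3 4 complex_cnj_complex_of_real)
  qed
  moreover have "(\<Sum>a\<in>UNIV. \<Sum>c\<in>UNIV. ?M a c p * ?E a * cnj (?E c)) = Mform \<zeta> A p + of_real \<eta> * Iform A p"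
    by (rule jet_matrix_form)
  moreover have "Re (a + c + cnj c + d) = Re (a + 2 * c + d)" for a c d by simp
  ultimately show ?thesis unfolding p_def[symmetric] by (simp only: sum.distrib)
qed

section \<open>Frames at a point and the Schur complement\<close>

text \<open>At a point where \<open>b\<close> factors \<open>H\<close>, the second derivatives along
  the frame vectors sum to the trace with \<open>H\<close>. The frame has constant coefficients, so
  only the value of \<open>H\<close> at \<open>p\<close> matters.\<close>

lemma sum_frame_lap:
  assumes b: "\<And>k l. H k l p = (\<Sum>q\<in>UNIV. b k q * cnj (b l q))" and f: "sm f"
  shows "(\<Sum>q\<in>UNIV. Xop (-\<i>) (\<lambda>m. b m q) (Xop \<i> (\<lambda>m. cnj (b m q)) f) p) = lap f p"
proof -
  have 1: "Xop (-\<i>) v (Xop \<i> (\<lambda>m. cnj (v m)) f) p = (\<Sum>m\<in>UNIV. \<Sum>n\<in>UNIV. v m * cnj (v n) * dz m (dzb n f) p)" for v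
    by (subst Xop_def, subst Xop_def[abs_def])
       (simp add: wd_sum wd_cmult sms f sum_distrib_left algebra_simps)
  show ?thesis unfolding 1 lap_def b sum_distrib_right
    unfolding sum.cartesian_product UNIV_Times_UNIV
    by (rule sum.reindex_bij_witness[of _ "\<lambda>(m,n,q). (q,m,n)" "\<lambda>(q,m,n). (m,n,q)"]) auto
qed

lemma sum_frame_jet_lap:
  assumes b: "\<And>k l. H k l p = (\<Sum>q\<in>UNIV. b k q * cnj (b l q))" and f: "sm f"
  shows "(\<Sum>q\<in>UNIV. DK \<xi> u k (DL \<xi> u l (Xop (-\<i>) (\<lambda>m. b m q) (Xop \<i> (\<lambda>m. cnj (b m q)) f))) p)
    = (\<Sum>m\<in>UNIV. \<Sum>n\<in>UNIV. H m n p * DK \<xi> u k (DL \<xi> u l (dz m (dzb n f))) p)"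
proof -
  have 1: "DK \<xi> u k (DL \<xi> u l (Xop s v (Xop s' v' f))) = Xop s v (Xop s' v' (DK \<xi> u k (DL \<xi> u l f)))" for s v s' v'
    unfolding DK_def DL_def by (simp add: Xop_Dop smooth_Xop smooth_Dop f)
  have 2: "DK \<xi> u k (DL \<xi> u l (dz m (dzb n f))) = dz m (dzb n (DK \<xi> u k (DL \<xi> u l f)))" for m n
    by (simp add: wd_DK wd_DL sms f)
  show ?thesis unfolding 1 2 sum_frame_lap[OF b sms(1)[OF sms(2)[OF f]]] lap_def ..
qed

text \<open>
  In a unitary frame \<open>b\<close> at a point, \<open>N q\<close> is the derivative of \<open>H\<close> with its second index referred to the frame.
\<close>

lemma unitary_frame:
  assumes p: "p \<in> T \<times> V"
  obtains b \<beta> :: "'n \<Rightarrow> 'n \<Rightarrow> complex" and N :: "'n \<Rightarrow> 'n \<Rightarrow> 'n \<Rightarrow> complex" where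
    "\<And>k l. H k l p = (\<Sum>q\<in>UNIV. b k q * cnj (b l q))"
    "\<And>k m. (\<Sum>q\<in>UNIV. b k q * \<beta> q m) = (if k = m then 1 else 0)"
    "\<And>S r. (\<Sum>k\<in>UNIV. (\<Sum>q\<in>UNIV. \<beta> q k * S q) * b k r) = S r"
    "\<And>i j. G i j p = (\<Sum>q\<in>UNIV. \<beta> q i * cnj (\<beta> q j))"
    "\<And>i k l. dz i (H k l) p = (\<Sum>q\<in>UNIV. N q i k * cnj (b l q))"
    "\<And>q i k. N q i k = (\<Sum>l\<in>UNIV. dz i (H k l) p * cnj (\<beta> q l))"
proof -
  have "\<exists>V :: 'n \<Rightarrow> 'n \<Rightarrow> complex. \<forall>a b. H a b p = (\<Sum>s\<in>UNIV. V s a * cnj (V s b))"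
  proof (rule psd_factorization[OF finite])
    show "H b a p = cnj (H a b p)" for a b by (simp add: cnj_H)
    show "0 \<le> Re (\<Sum>k\<in>UNIV. \<Sum>l\<in>UNIV. H k l p * w k * cnj (w l))" for w
      using H_pos[OF p, of w] by (cases "w = (\<lambda>_. 0)") auto
  qed simp
  then obtain V :: "'n \<Rightarrow> 'n \<Rightarrow> complex" where V: "\<And>a b. H a b p = (\<Sum>s\<in>UNIV. V s a * cnj (V s b))"
    by blast
  define b where "b k q = V q k" for k q
  \<comment> \<open>The inverse of \<open>b\<close>, read off from the factorization of
    \<open>H\<close>: the adjoint of \<open>b\<close> followed by the metric.\<close>
  define \<beta> where "\<beta> q m = (\<Sum>l\<in>UNIV. cnj (b l q) * G m l p)" for q m
  have 1: "H k l p = (\<Sum>q\<in>UNIV. b k q * cnj (b l q))" for k l by (simp add: b_def V)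
  have 2: "(\<Sum>q\<in>UNIV. b k q * \<beta> q m) = (if k = m then 1 else 0)" for k m
  proof -
    have "(\<Sum>q\<in>UNIV. b k q * \<beta> q m) = (\<Sum>l\<in>UNIV. H k l p * G m l p)"
      unfolding \<beta>_def 1 sum_distrib_left sum_distrib_right
      by (subst sum.swap) (simp add: algebra_simps)
    then show ?thesis using inverse1[OF p] by simp
  qed
  let ?B = "\<chi> k q. b k q" and ?C = "\<chi> q k. \<beta> q k"
  have "?B ** ?C = mat 1"
    by (simp add: matrix_matrix_mult_def mat_def vec_eq_iff 2)
  then have "?C ** ?B = mat 1" by (simp add: matrix_left_right_inverse)
  then have 3: "(\<Sum>k\<in>UNIV. \<beta> q k * b k r) = (if q = r then 1 else 0)" for q r
    by (simp add: matrix_matrix_mult_def mat_def vec_eq_iff)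
  have 4: "G i j p = (\<Sum>q\<in>UNIV. \<beta> q i * cnj (\<beta> q j))" for i j
  proof -
    have "(\<Sum>q\<in>UNIV. \<beta> q i * cnj (\<beta> q j)) = (\<Sum>q\<in>UNIV. \<Sum>l\<in>UNIV. \<beta> q i * b l q * G l j p)"
      by (simp add: \<beta>_def[of _ j] cnj_G sum_distrib_left algebra_simps)
    also have "\<dots> = (\<Sum>l\<in>UNIV. (\<Sum>q\<in>UNIV. b l q * \<beta> q i) * G l j p)"
      by (subst sum.swap) (simp add: sum_distrib_right sum_distrib_left algebra_simps)
    also have "\<dots> = G i j p" unfolding 2 by (simp add: if_distrib[of "\<lambda>z. z * _"] cong: if_cong)
    finally show ?thesis ..
  qed
  have 5: "(\<Sum>k\<in>UNIV. (\<Sum>q\<in>UNIV. \<beta> q k * S q) * b k r) = S r" for S r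
  proof -
    have "(\<Sum>k\<in>UNIV. (\<Sum>q\<in>UNIV. \<beta> q k * S q) * b k r) = (\<Sum>q\<in>UNIV. (\<Sum>k\<in>UNIV. \<beta> q k * b k r) * S q)"
      unfolding sum_distrib_left sum_distrib_right by (subst sum.swap) (simp add: algebra_simps)
    then show ?thesis unfolding 3 by (simp add: if_distrib[of "\<lambda>z. z * _"] cong: if_cong)
  qed
  define N where "N q i k = (\<Sum>l\<in>UNIV. dz i (H k l) p * cnj (\<beta> q l))" for q i k
  have 6: "dz i (H k l) p = (\<Sum>q\<in>UNIV. N q i k * cnj (b l q))" for i k l
  proof -
    have "(\<Sum>q\<in>UNIV. N q i k * cnj (b l q)) = (\<Sum>m\<in>UNIV. dz i (H k m) p * cnj (\<Sum>q\<in>UNIV. b l q * \<beta> q m))"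
      unfolding N_def sum_distrib_left sum_distrib_right cnj_sum
      by (subst sum.swap) (simp add: algebra_simps)
    then show ?thesis
      unfolding 2 by (simp add: if_distrib[of cnj] if_distrib[of "\<lambda>z. _ * z"] cong: if_cong)
  qed
  show thesis by (rule that[OF 1 2 5 4 6 N_def])
qed

text \<open>Completing the square in \<xi>. For an invertible \<open>b\<close> the squared vector
  takes every value as \<xi> varies, so the first sum is the minimum of the form over \<xi>, that is
  its Schur complement.\<close>

lemma Mform_schur:
  fixes b :: "'n \<Rightarrow> 'n \<Rightarrow> complex"
  assumes b: "\<And>k l. H k l p = (\<Sum>q\<in>UNIV. b k q * cnj (b l q))"
    and N: "\<And>i k l. dz i (H k l) p = (\<Sum>q\<in>UNIV. N q i k * cnj (b l q))"
  shows "Mform \<xi> u p = (\<Sum>i\<in>UNIV. \<Sum>k\<in>UNIV. \<Sum>j\<in>UNIV. \<Sum>l\<in>UNIV.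
        (Rz p i j k l - (\<Sum>q\<in>UNIV. N q i k * cnj (N q j l))) * u i k * cnj (u j l))
     + (\<Sum>q\<in>UNIV. ((\<Sum>i\<in>UNIV. \<Sum>k\<in>UNIV. u i k * N q i k) + (\<Sum>k\<in>UNIV. \<xi> k * b k q)) *
         cnj ((\<Sum>i\<in>UNIV. \<Sum>k\<in>UNIV. u i k * N q i k) + (\<Sum>k\<in>UNIV. \<xi> k * b k q)))"
proof -
  have Nb: "dzb j (H k l) p = (\<Sum>q\<in>UNIV. b k q * cnj (N q j l))" for j k l
  proof -
    have "dzb j (H k l) p = cnj (dz j (H l k) p)" by (simp add: cnj_wd sms cnj_H)
    then show ?thesis by (simp add: N mult.commute)
  qed
  have M: "Mform \<xi> u p = (\<Sum>k\<in>UNIV. \<Sum>l\<in>UNIV. \<xi> k * cnj (\<xi> l) * H k l p)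
     + (\<Sum>k\<in>UNIV. \<Sum>l\<in>UNIV. \<Sum>j\<in>UNIV. \<xi> k * cnj (u j l) * dzb j (H k l) p)
     + (\<Sum>k\<in>UNIV. \<Sum>l\<in>UNIV. \<Sum>i\<in>UNIV. u i k * cnj (\<xi> l) * dz i (H k l) p)
     + (\<Sum>k\<in>UNIV. \<Sum>l\<in>UNIV. \<Sum>i\<in>UNIV. \<Sum>j\<in>UNIV. u i k * cnj (u j l) * Rz p i j k l)"
    unfolding Mform_def DK_DL_expand[OF smooth_H] Rz_def by (simp only: sum.distrib)
  have 1: "(\<Sum>k\<in>UNIV. \<Sum>l\<in>UNIV. \<xi> k * cnj (\<xi> l) * H k l p)
      = (\<Sum>q\<in>UNIV. (\<Sum>k\<in>UNIV. \<xi> k * b k q) * cnj (\<Sum>k\<in>UNIV. \<xi> k * b k q))"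
    unfolding b cnj_sum sum_distrib_left sum_distrib_right
    unfolding sum.cartesian_product UNIV_Times_UNIV
    by (rule sum.reindex_bij_witness[of _ "\<lambda>(q,l,k). (k,l,q)" "\<lambda>(k,l,q). (q,l,k)"]) (auto simp: algebra_simps)
  have 2: "(\<Sum>k\<in>UNIV. \<Sum>l\<in>UNIV. \<Sum>j\<in>UNIV. \<xi> k * cnj (u j l) * dzb j (H k l) p)
      = (\<Sum>q\<in>UNIV. (\<Sum>k\<in>UNIV. \<xi> k * b k q) * cnj (\<Sum>i\<in>UNIV. \<Sum>k\<in>UNIV. u i k * N q i k))"
    unfolding Nb cnj_sum sum_distrib_left sum_distrib_right
    unfolding sum.cartesian_product UNIV_Times_UNIV
    by (rule sum.reindex_bij_witness[of _ "\<lambda>(q,j,l,k). (k,l,j,q)" "\<lambda>(k,l,j,q). (q,j,l,k)"]) (auto simp: algebra_simps)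
  have 3: "(\<Sum>k\<in>UNIV. \<Sum>l\<in>UNIV. \<Sum>i\<in>UNIV. u i k * cnj (\<xi> l) * dz i (H k l) p)
      = (\<Sum>q\<in>UNIV. (\<Sum>i\<in>UNIV. \<Sum>k\<in>UNIV. u i k * N q i k) * cnj (\<Sum>k\<in>UNIV. \<xi> k * b k q))"
    unfolding N cnj_sum sum_distrib_left sum_distrib_right
    unfolding sum.cartesian_product UNIV_Times_UNIV
    by (rule sum.reindex_bij_witness[of _ "\<lambda>(q,l,i,k). (k,l,i,q)" "\<lambda>(k,l,i,q). (q,l,i,k)"]) (auto simp: algebra_simps)
  have 4: "(\<Sum>k\<in>UNIV. \<Sum>l\<in>UNIV. \<Sum>i\<in>UNIV. \<Sum>j\<in>UNIV. u i k * cnj (u j l) * Rz p i j k l)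
     = (\<Sum>i\<in>UNIV. \<Sum>k\<in>UNIV. \<Sum>j\<in>UNIV. \<Sum>l\<in>UNIV. Rz p i j k l * u i k * cnj (u j l))"
    unfolding sum.cartesian_product UNIV_Times_UNIV
    by (rule sum.reindex_bij_witness[of _ "\<lambda>(i,k,j,l). (k,l,i,j)" "\<lambda>(k,l,i,j). (i,k,j,l)"]) (auto simp: algebra_simps)
  have 5: "(\<Sum>i\<in>UNIV. \<Sum>k\<in>UNIV. \<Sum>j\<in>UNIV. \<Sum>l\<in>UNIV. (\<Sum>q\<in>UNIV. N q i k * cnj (N q j l)) * u i k * cnj (u j l))
     = (\<Sum>q\<in>UNIV. (\<Sum>i\<in>UNIV. \<Sum>k\<in>UNIV. u i k * N q i k) * cnj (\<Sum>i\<in>UNIV. \<Sum>k\<in>UNIV. u i k * N q i k))"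
    unfolding cnj_sum sum_distrib_left sum_distrib_right
    unfolding sum.cartesian_product UNIV_Times_UNIV
    by (rule sum.reindex_bij_witness[of _ "\<lambda>(q,j,l,i,k). (i,k,j,l,q)" "\<lambda>(i,k,j,l,q). (q,j,l,i,k)"]) (auto simp: algebra_simps)
  have e: "(\<Sum>q\<in>UNIV. (S q + X q) * cnj (S q + X q)) = (\<Sum>q\<in>UNIV. X q * cnj (X q)) + (\<Sum>q\<in>UNIV. X q * cnj (S q))
     + (\<Sum>q\<in>UNIV. S q * cnj (X q)) + (\<Sum>q\<in>UNIV. S q * cnj (S q))" for S X :: "'n \<Rightarrow> complex"
    by (simp add: algebra_simps sum.distrib)
  show ?thesis
    unfolding M 1 2 3 4 left_diff_distrib sum_subtractf 5 e by (simp only: algebra_simps)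
qed

end

section \<open>The parabolic inequality at a null vector\<close>

context hermitian_chart
begin

lemma comm_field_sum:
  "comm_field u (\<lambda>i k. \<Sum>q\<in>UNIV. N q i k * c q) i k = (\<Sum>q\<in>UNIV. comm_field u (N q) i k * c q)"
  unfolding comm_field_def sum_distrib_left sum_distrib_right sum_subtractf[symmetric]
  by (subst sum.swap) (simp add: algebra_simps)

definition GH_lap :: "('n \<Rightarrow> 'n \<Rightarrow> complex) \<Rightarrow> real \<times> (complex^'n) \<Rightarrow> complex" where
  "GH_lap u p = (\<Sum>k\<in>UNIV. \<Sum>l\<in>UNIV. \<Sum>i\<in>UNIV. \<Sum>j\<in>UNIV. lap (\<lambda>p. GH p i j k l) p * u i k * cnj (u j l))"

definition GH_drift :: "('n \<Rightarrow> 'n \<Rightarrow> complex) \<Rightarrow> real \<times> (complex^'n) \<Rightarrow> complex" where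
  "GH_drift u p = (\<Sum>k\<in>UNIV. \<Sum>l\<in>UNIV. \<Sum>i\<in>UNIV. \<Sum>j\<in>UNIV. \<Sum>n\<in>UNIV.
     dzb n (\<lambda>p. GH p i j k l) p * comm_field u (\<lambda>i k. dz i (H k n) p) i k * cnj (u j l))"

text \<open>Summing the second-order condition over the frame yields the Laplacian and twice the
  third-order terms; comparing with \<open>jet_flow_rhs\<close> leaves only what
  \<open>reaction_nonneg\<close> controls. Everything happens at one fixed time. The terms with
  \<eta> are kept explicit, since they make up the error.\<close>

lemma null_flow_inequality:
  assumes t: "t \<in> T" and x: "x \<in> V"
    and nonneg: "\<And>y \<xi> u. y \<in> V \<Longrightarrow> 0 \<le> Re (Mform \<xi> u (t, y) + of_real \<eta> * Iform u (t, y))"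
    and zero: "Re (Mform \<xi> u (t, x) + of_real \<eta> * Iform u (t, x)) = 0"
  defines "p \<equiv> (t, x)"
  defines "R\<eta> \<equiv> (\<lambda>i j k l. Rz p i j k l + of_real \<eta> * GH p i j k l)"
  shows "0 \<le> Re ((\<Sum>k\<in>UNIV. \<Sum>l\<in>UNIV. DK \<xi> u k (DL \<xi> u l (flow_rhs k l)) p)
     + of_real \<eta> * (GH_lap u p + 2 * GH_drift u p) + quad u R\<eta> R\<eta> - quad u (Rz p) (Rz p))"
proof -
  have p: "p \<in> T \<times> V" using t x by (simp add: p_def)
  obtain b \<beta> :: "'n \<Rightarrow> 'n \<Rightarrow> complex" and N :: "'n \<Rightarrow> 'n \<Rightarrow> 'n \<Rightarrow> complex" where b: "\<And>k l. H k l p = (\<Sum>q\<in>UNIV. b k q * cnj (b l q))"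
    and b\<beta>: "\<And>k m. (\<Sum>q\<in>UNIV. b k q * \<beta> q m) = (if k = m then 1 else 0)"
    and solve: "\<And>S r. (\<Sum>k\<in>UNIV. (\<Sum>q\<in>UNIV. \<beta> q k * S q) * b k r) = S r"
    and N: "\<And>i k l. dz i (H k l) p = (\<Sum>q\<in>UNIV. N q i k * cnj (b l q))"
    by (rule unitary_frame[OF p]) (rule that)
  define A where "A q = comm_field u (N q)" for q
  \<comment> \<open>The conjugate of \<open>Cb\<close> written in the frame; its pairing with the
    transpose is frame independent, which is \<open>CT\<close> below.\<close>
  define c where "c q r = (\<Sum>m\<in>UNIV. \<Sum>n\<in>UNIV. b m q * cnj (Cb \<xi> u m n p) * cnj (\<beta> r n))" for q r
  define X where "X q r = ucube u (N q) (N r) - ucube u (N r) (N q)" for q r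
  \<comment> \<open>Minimises \<open>2 Re (B cnj c) + |X + B|^2\<close>, the part of the
    second-order condition that depends on the \<xi>-part of the variation.\<close>
  define B where "B q r = - c q r - X q r" for q r
  \<comment> \<open>The \<xi>-part whose frame components are \<open>B q r\<close>.\<close>
  define \<zeta> where "\<zeta> q k = (\<Sum>r\<in>UNIV. \<beta> r k * B q r)" for q k
  have \<zeta>: "(\<Sum>k\<in>UNIV. \<zeta> q k * b k r) = B q r" for q r unfolding \<zeta>_def by (rule solve)
  define Oe where "Oe i j k l = Rz p i j k l - (\<Sum>q\<in>UNIV. N q i k * cnj (N q j l)) + of_real \<eta> * GH p i j k l" for i j k l
  note schur = Mform_schur[OF b N]
  have I: "Iform u p = (\<Sum>i\<in>UNIV. \<Sum>k\<in>UNIV. \<Sum>j\<in>UNIV. \<Sum>l\<in>UNIV. GH p i j k l * u i k * cnj (u j l))" for u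
    unfolding Iform_def
    unfolding sum.cartesian_product UNIV_Times_UNIV
    by (rule sum.reindex_bij_witness[of _ "\<lambda>(i,k,j,l). (k,l,i,j)" "\<lambda>(k,l,i,j). (i,k,j,l)"]) auto
  have Oe: "Mform \<xi> u p + of_real \<eta> * Iform u p =
     (\<Sum>i\<in>UNIV. \<Sum>k\<in>UNIV. \<Sum>j\<in>UNIV. \<Sum>l\<in>UNIV. Oe i j k l * u i k * cnj (u j l))
     + (\<Sum>q\<in>UNIV. ((\<Sum>i\<in>UNIV. \<Sum>k\<in>UNIV. u i k * N q i k) + (\<Sum>k\<in>UNIV. \<xi> k * b k q)) *
         cnj ((\<Sum>i\<in>UNIV. \<Sum>k\<in>UNIV. u i k * N q i k) + (\<Sum>k\<in>UNIV. \<xi> k * b k q)))" for \<xi> u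
    unfolding schur I Oe_def by (simp only: distrib_right sum.distrib sum_distrib_left) (simp only: algebra_simps)
  have react: "0 \<le> Re (quad u R\<eta> R\<eta>
      - (\<Sum>q\<in>UNIV. \<Sum>i\<in>UNIV. \<Sum>k\<in>UNIV. \<Sum>j\<in>UNIV. \<Sum>l\<in>UNIV. Oe i j k l * A q i k * cnj (A q j l))
      - (\<Sum>q\<in>UNIV. \<Sum>r\<in>UNIV. c q r * cnj (c r q)) + (\<Sum>q\<in>UNIV. \<Sum>r\<in>UNIV. c q r * cnj (c q r))
      + 2 * (\<Sum>q\<in>UNIV. \<Sum>r\<in>UNIV. X q r * cnj (c q r)))"
    unfolding A_def X_def
  proof (rule reaction_nonneg)
    show "Oe j i l k = cnj (Oe i j k l)" for i j k l
      by (simp add: Oe_def cnj_Rz cnj_GH mult.commute)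
    show "R\<eta> i j k l = Oe i j k l + (\<Sum>q\<in>UNIV. N q i k * cnj (N q j l))" for i j k l
      by (simp add: R\<eta>_def Oe_def)
    show "0 \<le> Re (\<Sum>i\<in>UNIV. \<Sum>k\<in>UNIV. \<Sum>j\<in>UNIV. \<Sum>l\<in>UNIV. Oe i j k l * u i k * cnj (u j l))" for u
    proof -
      let ?S = "\<lambda>q. \<Sum>i\<in>UNIV. \<Sum>k\<in>UNIV. u i k * N q i k"
      \<comment> \<open>Chosen so that the completed square vanishes; the form then equals its Schur
        complement.\<close>
      let ?\<xi> = "\<lambda>k. \<Sum>r\<in>UNIV. \<beta> r k * (- ?S r)"
      have "Mform ?\<xi> u p + of_real \<eta> * Iform u p =
        (\<Sum>i\<in>UNIV. \<Sum>k\<in>UNIV. \<Sum>j\<in>UNIV. \<Sum>l\<in>UNIV. Oe i j k l * u i k * cnj (u j l))"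
        unfolding Oe solve by simp
      then show ?thesis using nonneg[OF x, of ?\<xi> u] by (simp only: p_def)
    qed
  qed
  let ?P = "\<lambda>q. Xop (- \<i>) (\<lambda>m. b m q)" and ?Q = "\<lambda>q. Xop \<i> (\<lambda>m. cnj (b m q))"
  let ?t1 = "\<lambda>q. \<Sum>k\<in>UNIV. \<Sum>l\<in>UNIV. DK \<xi> u k (DL \<xi> u l (?P q (?Q q (H k l)))) p"
  let ?t2 = "\<lambda>q. \<Sum>k\<in>UNIV. \<Sum>l\<in>UNIV. \<Sum>i\<in>UNIV. \<Sum>j\<in>UNIV. ?P q (?Q q (\<lambda>p. GH p i j k l)) p * u i k * cnj (u j l)"
  let ?t3 = "\<lambda>q. \<Sum>k\<in>UNIV. \<Sum>l\<in>UNIV. DK (\<zeta> q) (A q) k (DL \<xi> u l (?Q q (H k l))) p"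
  let ?t4 = "\<lambda>q. \<Sum>k\<in>UNIV. \<Sum>l\<in>UNIV. \<Sum>i\<in>UNIV. \<Sum>j\<in>UNIV. ?Q q (\<lambda>p. GH p i j k l) p * A q i k * cnj (u j l)"
  let ?t5 = "\<lambda>q. Mform (\<zeta> q) (A q) p + of_real \<eta> * Iform (A q) p"
  have "0 \<le> Re (?t1 q + of_real \<eta> * ?t2 q + 2 * (?t3 q + of_real \<eta> * ?t4 q) + ?t5 q)" for q
    unfolding p_def by (rule null_second_order[OF t x nonneg zero])
  then have "0 \<le> (\<Sum>q\<in>UNIV. Re (?t1 q + of_real \<eta> * ?t2 q + 2 * (?t3 q + of_real \<eta> * ?t4 q) + ?t5 q))"
    by (intro sum_nonneg)
  then have test: "0 \<le> Re ((\<Sum>q\<in>UNIV. ?t1 q) + of_real \<eta> * (\<Sum>q\<in>UNIV. ?t2 q)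
      + 2 * ((\<Sum>q\<in>UNIV. ?t3 q) + of_real \<eta> * (\<Sum>q\<in>UNIV. ?t4 q)) + (\<Sum>q\<in>UNIV. ?t5 q))"
    by (simp only: Re_sum[symmetric] sum.distrib sum_distrib_left[symmetric])
  have t1: "(\<Sum>q\<in>UNIV. ?t1 q) = (\<Sum>k\<in>UNIV. \<Sum>l\<in>UNIV. \<Sum>m\<in>UNIV. \<Sum>n\<in>UNIV.
      H m n p * DK \<xi> u k (DL \<xi> u l (dz m (dzb n (H k l)))) p)"
    by (subst sum.swap, rule sum.cong[OF refl], subst sum.swap, rule sum.cong[OF refl],
        rule sum_frame_jet_lap[OF b smooth_H])
  have t2: "(\<Sum>q\<in>UNIV. ?t2 q) = GH_lap u p"
    unfolding GH_lap_def
    by (subst sum.swap, rule sum.cong[OF refl], subst sum.swap, rule sum.cong[OF refl],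
        subst sum.swap, rule sum.cong[OF refl], subst sum.swap, rule sum.cong[OF refl])
       (simp only: sum_distrib_right[symmetric] sum_frame_lap[OF b smooth_GH])
  have AH: "(\<Sum>q\<in>UNIV. A q i k * cnj (b n q)) = comm_field u (\<lambda>i k. dz i (H k n) p) i k" for i k n
    unfolding A_def N by (rule comm_field_sum[symmetric])
  have t4_term: "(\<Sum>q\<in>UNIV. ?Q q (\<lambda>p. GH p i j k l) p * A q i k * cnj (u j l))
      = (\<Sum>n\<in>UNIV. dzb n (\<lambda>p. GH p i j k l) p * comm_field u (\<lambda>i k. dz i (H k n) p) i k * cnj (u j l))" for k l i j
    unfolding AH[symmetric] Xop_def sum_distrib_left sum_distrib_right
    by (subst sum.swap) (simp add: algebra_simps)
  have t4: "(\<Sum>q\<in>UNIV. ?t4 q) = GH_drift u p"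
    unfolding GH_drift_def t4_term[symmetric]
    by (subst sum.swap, rule sum.cong[OF refl], subst sum.swap, rule sum.cong[OF refl],
        subst sum.swap, rule sum.cong[OF refl], subst sum.swap, rule refl)
  have t3q: "?t3 q = (\<Sum>r\<in>UNIV. B q r * cnj (c q r))
     + (\<Sum>i\<in>UNIV. \<Sum>k\<in>UNIV. \<Sum>n\<in>UNIV. (A q i k * cnj (b n q)) * dz i (Cb \<xi> u n k) p)" for q
  proof -
    have 1: "DL \<xi> u l (?Q q (H k l)) = (\<lambda>p. \<Sum>n\<in>UNIV. cnj (b n q) * DL \<xi> u l (dzb n (H k l)) p)" for k l
      by (subst Xop_def[abs_def]) (simp add: DL_def Dop_sum Dop_cmult sms)
    have 2: "(\<Sum>l\<in>UNIV. DK (\<zeta> q) (A q) k (DL \<xi> u l (?Q q (H k l))) p)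
       = (\<Sum>n\<in>UNIV. cnj (b n q) * DK (\<zeta> q) (A q) k (Cb \<xi> u n k) p)" for k
    proof -
      have "DK (\<zeta> q) (A q) k (Cb \<xi> u n k) p = (\<Sum>l\<in>UNIV. DK (\<zeta> q) (A q) k (DL \<xi> u l (dzb n (H k l))) p)" for n
        unfolding Cb_def[abs_def] by (simp add: DK_def Dop_sum sms)
      moreover have "DK (\<zeta> q) (A q) k (DL \<xi> u l (?Q q (H k l))) p
         = (\<Sum>n\<in>UNIV. cnj (b n q) * DK (\<zeta> q) (A q) k (DL \<xi> u l (dzb n (H k l))) p)" for l
        unfolding 1 by (simp add: DK_def Dop_sum Dop_cmult sms)
      ultimately show ?thesis by (simp add: sum_distrib_left) (rule sum.swap)
    qed
    have 3: "(\<Sum>k\<in>UNIV. \<Sum>n\<in>UNIV. cnj (b n q) * (\<zeta> q k * Cb \<xi> u n k p)) = (\<Sum>r\<in>UNIV. B q r * cnj (c q r))"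
      unfolding \<zeta>_def c_def cnj_sum sum_distrib_left sum_distrib_right
      unfolding sum.cartesian_product UNIV_Times_UNIV
      by (rule sum.reindex_bij_witness[of _ "\<lambda>(r,n,k). (k,n,r)" "\<lambda>(k,n,r). (r,n,k)"]) (auto simp: algebra_simps)
    have 4: "(\<Sum>k\<in>UNIV. \<Sum>n\<in>UNIV. cnj (b n q) * (\<Sum>i\<in>UNIV. A q i k * dz i (Cb \<xi> u n k) p))
       = (\<Sum>i\<in>UNIV. \<Sum>k\<in>UNIV. \<Sum>n\<in>UNIV. (A q i k * cnj (b n q)) * dz i (Cb \<xi> u n k) p)"
      unfolding sum_distrib_left
      unfolding sum.cartesian_product UNIV_Times_UNIV
      by (rule sum.reindex_bij_witness[of _ "\<lambda>(i,k,n). (k,n,i)" "\<lambda>(k,n,i). (i,k,n)"]) (auto simp: algebra_simps)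
    show ?thesis
      unfolding 2 unfolding DK_def'[of "\<zeta> q"] distrib_left sum.distrib 3 4 ..
  qed
  have t3: "(\<Sum>q\<in>UNIV. ?t3 q) = (\<Sum>q\<in>UNIV. \<Sum>r\<in>UNIV. B q r * cnj (c q r)) + drift \<xi> u p"
  proof -
    have "(\<Sum>q\<in>UNIV. \<Sum>i\<in>UNIV. \<Sum>k\<in>UNIV. \<Sum>n\<in>UNIV. (A q i k * cnj (b n q)) * dz i (Cb \<xi> u n k) p) = drift \<xi> u p"
      unfolding drift_def AH[symmetric] sum_distrib_right
      unfolding sum.cartesian_product UNIV_Times_UNIV
      by (rule sum.reindex_bij_witness[of _ "\<lambda>(i,k,n,q). (q,i,k,n)" "\<lambda>(q,i,k,n). (i,k,n,q)"]) auto
    then show ?thesis unfolding t3q sum.distrib by simp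
  qed
  have t5: "(\<Sum>q\<in>UNIV. ?t5 q) = (\<Sum>q\<in>UNIV. \<Sum>i\<in>UNIV. \<Sum>k\<in>UNIV. \<Sum>j\<in>UNIV. \<Sum>l\<in>UNIV. Oe i j k l * A q i k * cnj (A q j l))
     + (\<Sum>q\<in>UNIV. \<Sum>r\<in>UNIV. c q r * cnj (c q r))"
  proof -
    \<comment> \<open>The commutator contributes \<open>X\<close> and \<zeta> contributes
      \<open>B\<close>, so the choice of \<open>B\<close> leaves only
      \<open>- c q r\<close>.\<close>
    have e: "(\<Sum>i\<in>UNIV. \<Sum>k\<in>UNIV. A q i k * N r i k) + (\<Sum>k\<in>UNIV. \<zeta> q k * b k r) = - c q r" for q r
      unfolding \<zeta> unfolding A_def contract_comm_field by (simp add: B_def X_def)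
    show ?thesis unfolding Oe e sum.distrib by simp
  qed
  have CT: "(\<Sum>q\<in>UNIV. \<Sum>r\<in>UNIV. c q r * cnj (c r q)) = (\<Sum>m\<in>UNIV. \<Sum>n\<in>UNIV. cnj (Cb \<xi> u m n p) * Cb \<xi> u n m p)"
  proof -
    have "(\<Sum>q\<in>UNIV. \<Sum>r\<in>UNIV. c q r * cnj (c r q)) = (\<Sum>m\<in>UNIV. \<Sum>n\<in>UNIV. \<Sum>m'\<in>UNIV. \<Sum>n'\<in>UNIV.
       (cnj (Cb \<xi> u m n p) * Cb \<xi> u m' n' p) * (\<Sum>q\<in>UNIV. b m q * \<beta> q n') * cnj (\<Sum>r\<in>UNIV. b m' r * \<beta> r n))"
      unfolding c_def cnj_sum sum_product sum_distrib_left sum_distrib_right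
      unfolding sum.cartesian_product UNIV_Times_UNIV
      by (rule sum.reindex_bij_witness[of _ "\<lambda>(m,n,m',n',r,q). (q,r,m',n',m,n)" "\<lambda>(q,r,m',n',m,n). (m,n,m',n',r,q)"])
         (auto simp: algebra_simps)
    also have "\<dots> = (\<Sum>m\<in>UNIV. \<Sum>n\<in>UNIV. \<Sum>m'\<in>UNIV. \<Sum>n'\<in>UNIV.
       if m' = n then (if m = n' then cnj (Cb \<xi> u m n p) * Cb \<xi> u m' n' p else 0) else 0)"
      unfolding b\<beta> by (intro sum.cong refl) auto
    also have "\<dots> = (\<Sum>m\<in>UNIV. \<Sum>n\<in>UNIV. cnj (Cb \<xi> u m n p) * Cb \<xi> u n m p)"
    proof (intro sum.cong refl)
      fix m n
      have "(\<Sum>n'\<in>UNIV. if m' = n then (if m = n' then cnj (Cb \<xi> u m n p) * Cb \<xi> u m' n' p else 0) else 0)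
         = (if m' = n then cnj (Cb \<xi> u m n p) * Cb \<xi> u m' m p else 0)" for m'
        by (cases "m' = n") simp_all
      then show "(\<Sum>m'\<in>UNIV. \<Sum>n'\<in>UNIV. if m' = n then (if m = n' then cnj (Cb \<xi> u m n p) * Cb \<xi> u m' n' p else 0) else 0)
        = cnj (Cb \<xi> u m n p) * Cb \<xi> u n m p" by simp
    qed
    finally show ?thesis .
  qed
  have BC: "(\<Sum>q\<in>UNIV. \<Sum>r\<in>UNIV. B q r * cnj (c q r)) =
     - (\<Sum>q\<in>UNIV. \<Sum>r\<in>UNIV. c q r * cnj (c q r)) - (\<Sum>q\<in>UNIV. \<Sum>r\<in>UNIV. X q r * cnj (c q r))"
    unfolding B_def left_diff_distrib sum_subtractf by (simp add: sum_negf)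
  \<comment> \<open>In real parts, twice the third-order term \<open>D\<close> of the second-order
    condition cancels against \<open>D + cnj D\<close> of the evolution.\<close>
  have lin: "0 \<le> Re ((L1 + D + cnj D + q0 - CT) + e * (\<Lambda> + 2 * \<Lambda>') + q1 - q0)"
    if "0 \<le> Re (L1 + e * \<Lambda> + 2 * ((- CC - XC) + D + e * \<Lambda>') + (OA + CC))"
       "0 \<le> Re (q1 - OA - CT + CC + 2 * XC)" for L1 D q0 CT e \<Lambda> \<Lambda>' q1 CC XC OA :: complex
    using that by (simp add: algebra_simps)
  show ?thesis
    unfolding jet_flow_rhs
    by (rule lin[OF test[unfolded t1 t2 t3 t4 t5 BC] react[unfolded CT]])
qed

end

section \<open>First touching and domination of the error\<close>

text \<open>Bilinearity of \<open>quad\<close> in its two curvature arguments; it makes the error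
  caused by the perturbation proportional to the size of the perturbation.\<close>

lemma quad_add_scaled:
  "quad u (\<lambda>i j k l. R i j k l + e * P i j k l) (\<lambda>i j k l. R i j k l + e * P i j k l)
    = quad u R R + e * (quad u P R + quad u R P + e * quad u P P)"
  unfolding quad_def sum_distrib_left sum.distrib[symmetric]
  by (intro sum.cong refl) (simp add: algebra_simps)

lemma continuous_on_quad:
  assumes "\<And>i k. continuous_on X (\<lambda>z. u z i k)" "\<And>i j k l. continuous_on X (\<lambda>z. P z i j k l)"
    and "\<And>i j k l. continuous_on X (\<lambda>z. P' z i j k l)"
  shows "continuous_on X (\<lambda>z. quad (u z) (P z) (P' z))"
  unfolding quad_def by (intro continuous_intros assms)

lemma derivative_nonpos_at_first_zero:
  fixes f :: "real \<Rightarrow> real"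
  assumes "(f has_field_derivative D) (at t)" "d > 0"
    and "\<And>s. t - d < s \<Longrightarrow> s \<le> t \<Longrightarrow> 0 \<le> f s" "f t = 0"
  shows "D \<le> 0"
proof (rule ccontr)
  assume "\<not> D \<le> 0"
  then obtain e where e: "e > 0" "\<And>h. h > 0 \<Longrightarrow> h < e \<Longrightarrow> f (t - h) < f t"
    using DERIV_pos_inc_left[OF assms(1)] by auto
  define h where "h = min d e / 2"
  have "0 < h" "h < d" "h < e" using e(1) assms(2) by (auto simp: h_def)
  then show False using e(2)[of h] assms(3)[of "t - h"] assms(4) by simp
qed

context hermitian_chart
begin

definition GH_dt :: "('n \<Rightarrow> 'n \<Rightarrow> complex) \<Rightarrow> real \<times> (complex^'n) \<Rightarrow> complex" where
  "GH_dt u p = (\<Sum>k\<in>UNIV. \<Sum>l\<in>UNIV. \<Sum>i\<in>UNIV. \<Sum>j\<in>UNIV.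
     (flow_rhs_low i j p * H k l p + G i j p * flow_rhs k l p) * u i k * cnj (u j l))"

text \<open>What multiplies \<eta> in the inequality at a touching point, apart from \<kappa> times
  \<open>Iform\<close>. It does not contain \<xi>, which makes a uniform bound over a compact set
  possible.\<close>

definition Err :: "real \<Rightarrow> ('n \<Rightarrow> 'n \<Rightarrow> complex) \<Rightarrow> real \<times> (complex^'n) \<Rightarrow> complex" where
  "Err \<eta> u p = GH_dt u p - (GH_lap u p + 2 * GH_drift u p)
     - (quad u (GH p) (Rz p) + quad u (Rz p) (GH p) + of_real \<eta> * quad u (GH p) (GH p))"

text \<open>At a touching point the time derivative of the perturbed form on the fixed vector is
  nonpositive, while \<open>null_flow_inequality\<close> bounds the contribution of
  \<open>Mform\<close> from below. Both bounds combine to a multiple of the positive number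
  \<open>\<epsilon> * exp (\<kappa> * t)\<close>, which is divided out.\<close>

lemma touching_inequality:
  assumes J: "open J" "J \<subseteq> T" "t \<in> J" and x: "x \<in> V"
    and flow_H: "\<And>s y k l. s \<in> J \<Longrightarrow> y \<in> V \<Longrightarrow> ((\<lambda>s. H k l (s, y)) has_vector_derivative flow_rhs k l (s, y)) (at s)"
    and flow_G: "\<And>i j. ((\<lambda>s. G i j (s, x)) has_vector_derivative flow_rhs_low i j (t, x)) (at t)"
    and \<epsilon>: "\<epsilon> > 0"
    and nonneg: "\<And>s y \<xi> u. s \<in> J \<Longrightarrow> s \<le> t \<Longrightarrow> y \<in> V \<Longrightarrow>
        0 \<le> Re (Mform \<xi> u (s, y) + of_real (\<epsilon> * exp (\<kappa> * s)) * Iform u (s, y))"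
    and zero: "Re (Mform \<xi> u (t, x) + of_real (\<epsilon> * exp (\<kappa> * t)) * Iform u (t, x)) = 0"
  shows "\<kappa> * Re (Iform u (t, x)) + Re (Err (\<epsilon> * exp (\<kappa> * t)) u (t, x)) \<le> 0"
proof -
  let ?p = "(t, x)" and ?\<eta> = "\<epsilon> * exp (\<kappa> * t)"
  let ?F = "\<Sum>k\<in>UNIV. \<Sum>l\<in>UNIV. DK \<xi> u k (DL \<xi> u l (flow_rhs k l)) ?p"
  have tT: "t \<in> T" using J by blast
  have M: "((\<lambda>s. Mform \<xi> u (s, x)) has_vector_derivative ?F) (at t)"
    unfolding Mform_def
  proof (intro has_vector_derivative_sum)
    fix k l
    have "((\<lambda>s. DL \<xi> u l (H k l) (s, y)) has_vector_derivative DL \<xi> u l (flow_rhs k l) (s, y)) (at s)"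
      if "s \<in> J" "y \<in> V" for s y
      unfolding DL_def by (rule time_derivative_Dop[OF J(1,2) smooth_H smooth_flow_rhs flow_H that])
    then show "((\<lambda>s. DK \<xi> u k (DL \<xi> u l (H k l)) (s, x)) has_vector_derivative DK \<xi> u k (DL \<xi> u l (flow_rhs k l)) (t, x)) (at t)"
      unfolding DK_def by (intro time_derivative_Dop[OF J(1,2) _ _ _ J(3) x] smooth_DL smooth_H smooth_flow_rhs)
  qed
  have I: "((\<lambda>s. Iform u (s, x)) has_vector_derivative GH_dt u ?p) (at t)"
    unfolding Iform_def GH_dt_def GH_def
  proof (intro has_vector_derivative_sum)
    fix k l i j
    have "((\<lambda>s. (G i j (s, x) * H k l (s, x)) * (u i k * cnj (u j l))) has_vector_derivative
       (G i j (t, x) * flow_rhs k l (t, x) + flow_rhs_low i j (t, x) * H k l (t, x)) * (u i k * cnj (u j l))) (at t)"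
      by (intro has_vector_derivative_mult_left has_vector_derivative_mult flow_G flow_H J x)
    then show "((\<lambda>s. G i j (s, x) * H k l (s, x) * u i k * cnj (u j l)) has_vector_derivative
       (flow_rhs_low i j (t, x) * H k l (t, x) + G i j (t, x) * flow_rhs k l (t, x)) * u i k * cnj (u j l)) (at t)"
      by (simp add: algebra_simps)
  qed
  have Re: "((\<lambda>s. Re (h s)) has_field_derivative Re h') (at t)"
    if "(h has_vector_derivative h') (at t)" for h h'
    using bounded_linear.has_vector_derivative[OF bounded_linear_Re that]
    by (simp add: has_real_derivative_iff_has_vector_derivative)
  let ?f = "\<lambda>s. Re (Mform \<xi> u (s, x)) + \<epsilon> * exp (\<kappa> * s) * Re (Iform u (s, x))"
  have f: "?f s = Re (Mform \<xi> u (s, x) + of_real (\<epsilon> * exp (\<kappa> * s)) * Iform u (s, x))" for s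
    by simp
  have D: "(?f has_field_derivative (Re ?F + (?\<eta> * \<kappa> * Re (Iform u ?p) + ?\<eta> * Re (GH_dt u ?p)))) (at t)"
    by (rule derivative_eq_intros Re[OF M] Re[OF I] refl | simp add: algebra_simps)+
  obtain d where d: "d > 0" "ball t d \<subseteq> J" using J open_contains_ball by blast
  have "Re ?F + (?\<eta> * \<kappa> * Re (Iform u ?p) + ?\<eta> * Re (GH_dt u ?p)) \<le> 0"
  proof (rule derivative_nonpos_at_first_zero[OF D d(1)])
    show "?f t = 0" unfolding f by (rule zero)
    fix s assume s: "t - d < s" "s \<le> t"
    then have "s \<in> ball t d" by (simp add: dist_real_def)
    then show "0 \<le> ?f s" unfolding f using nonneg s d x by blast
  qed
  moreover have "0 \<le> Re (?F + of_real ?\<eta> * (GH_lap u ?p + 2 * GH_drift u ?p)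
      + of_real ?\<eta> * (quad u (GH ?p) (Rz ?p) + quad u (Rz ?p) (GH ?p) + of_real ?\<eta> * quad u (GH ?p) (GH ?p)))"
    using null_flow_inequality[OF tT x nonneg[OF J(3) order_refl] zero]
    unfolding quad_add_scaled by (simp add: algebra_simps)
  ultimately have "?\<eta> * (\<kappa> * Re (Iform u ?p) + Re (Err ?\<eta> u ?p)) \<le> 0"
    unfolding Err_def by (simp add: algebra_simps)
  moreover have "?\<eta> > 0" using \<epsilon> by simp
  ultimately show ?thesis by (meson mult_pos_pos not_less)
qed

text \<open>The form is the sum of the squared moduli of the entries \<open>z\<close> of
  \<open>u\<close> in a unitary frame, and \<open>uz\<close> recovers \<open>u\<close> from
  them.\<close>

lemma Iform_pos:
  assumes p: "p \<in> T \<times> V" and u: "u \<noteq> (\<lambda>_ _. 0)"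
  shows "0 < Re (Iform u p)"
proof -
  obtain b \<beta> :: "'n \<Rightarrow> 'n \<Rightarrow> complex" and N :: "'n \<Rightarrow> 'n \<Rightarrow> 'n \<Rightarrow> complex" where b: "\<And>k l. H k l p = (\<Sum>q\<in>UNIV. b k q * cnj (b l q))"
    and b\<beta>: "\<And>k m. (\<Sum>q\<in>UNIV. b k q * \<beta> q m) = (if k = m then 1 else 0)"
    and G: "\<And>i j. G i j p = (\<Sum>q\<in>UNIV. \<beta> q i * cnj (\<beta> q j))"
    by (rule unitary_frame[OF p]) (rule that)
  define z where "z q r = (\<Sum>i\<in>UNIV. \<Sum>k\<in>UNIV. \<beta> q i * u i k * b k r)" for q r
  have "Iform u p = (\<Sum>q\<in>UNIV. \<Sum>r\<in>UNIV. z q r * cnj (z q r))"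
    unfolding Iform_def GH_def b G z_def cnj_sum sum_distrib_left sum_distrib_right
    unfolding sum.cartesian_product UNIV_Times_UNIV
    by (rule sum.reindex_bij_witness[of _ "\<lambda>(q,r,j,l,i,k). (k,l,i,j,r,q)" "\<lambda>(k,l,i,j,r,q). (q,r,j,l,i,k)"])
       (auto simp: algebra_simps)
  then have I: "Re (Iform u p) = (\<Sum>q\<in>UNIV. \<Sum>r\<in>UNIV. (norm (z q r))\<^sup>2)"
    by (simp add: complex_norm_square[symmetric] del: of_real_power)
  have uz: "u i k = (\<Sum>q\<in>UNIV. \<Sum>r\<in>UNIV. b i q * z q r * \<beta> r k)" for i k
  proof -
    have "(\<Sum>q\<in>UNIV. \<Sum>r\<in>UNIV. b i q * z q r * \<beta> r k)
       = (\<Sum>i'\<in>UNIV. \<Sum>k'\<in>UNIV. u i' k' * (\<Sum>q\<in>UNIV. b i q * \<beta> q i') * (\<Sum>r\<in>UNIV. b k' r * \<beta> r k))"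
      unfolding z_def sum_distrib_left sum_distrib_right
      unfolding sum.cartesian_product UNIV_Times_UNIV
      by (rule sum.reindex_bij_witness[of _ "\<lambda>(i',k',r,q). (q,r,i',k')" "\<lambda>(q,r,i',k'). (i',k',r,q)"])
         (auto simp: algebra_simps)
    also have "\<dots> = (\<Sum>i'\<in>UNIV. \<Sum>k'\<in>UNIV. if i = i' then (if k' = k then u i' k' else 0) else 0)"
      unfolding b\<beta> by (intro sum.cong refl) auto
    also have "\<dots> = u i k" by (subst sum.swap) simp
    finally show ?thesis ..
  qed
  have "\<exists>q r. z q r \<noteq> 0"
  proof (rule ccontr)
    assume "\<not> ?thesis"
    then have "u i k = 0" for i k unfolding uz[of i k] by simp
    with u show False by (auto simp: fun_eq_iff)
  qed
  then obtain q r where "z q r \<noteq> 0" by blast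
  then have "0 < (norm (z q r))\<^sup>2" by simp
  also have "\<dots> \<le> (\<Sum>r\<in>UNIV. (norm (z q r))\<^sup>2)" by (rule member_le_sum) auto
  also have "\<dots> \<le> (\<Sum>q\<in>UNIV. \<Sum>r\<in>UNIV. (norm (z q r))\<^sup>2)"
    by (rule member_le_sum[of q UNIV "\<lambda>q. \<Sum>r\<in>UNIV. (norm (z q r))\<^sup>2"]) (auto intro: sum_nonneg)
  finally show ?thesis unfolding I .
qed

lemma continuous_on_smooth_fst:
  assumes "sm f" "\<And>z. z \<in> X \<Longrightarrow> fst z \<in> T \<times> V"
  shows "continuous_on X (\<lambda>z. f (fst z))"
  by (rule continuous_on_compose2[OF smooth_on_continuous[OF assms(1)] continuous_on_fst[OF continuous_on_id]])
     (use assms(2) in auto)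

lemma smooth_flow_rhs_low: "sm (flow_rhs_low i j)"
  unfolding flow_rhs_low_def[abs_def] by (intro sms smooth_flow_rhs)

lemma smooth_lap: "sm f \<Longrightarrow> sm (lap f)"
  unfolding lap_def[abs_def] by (intro sms)

lemma smooth_Rz: "sm (\<lambda>p. Rz p i j k l)"
  unfolding Rz_def by (intro sms)

lemma continuous_on_Iform:
  assumes "\<And>z. z \<in> X \<Longrightarrow> fst z \<in> T \<times> V" "\<And>i k. continuous_on X (\<lambda>z. u z i k)"
  shows "continuous_on X (\<lambda>z. Iform (u z) (fst z))"
  unfolding Iform_def
  by (intro continuous_intros continuous_on_smooth_fst[OF smooth_GH assms(1)] assms(2))

lemma continuous_on_Mform:
  assumes "\<And>z. z \<in> X \<Longrightarrow> fst z \<in> T \<times> V" "\<And>k. continuous_on X (\<lambda>z. \<xi> z k)" "\<And>i k. continuous_on X (\<lambda>z. u z i k)"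
  shows "continuous_on X (\<lambda>z. Mform (\<xi> z) (u z) (fst z))"
  unfolding Mform_def DK_DL_expand[OF smooth_H]
  by (intro continuous_intros continuous_on_smooth_fst[OF _ assms(1)] assms(2,3) sms)

lemma continuous_on_Err:
  assumes X: "\<And>z. z \<in> X \<Longrightarrow> fst z \<in> T \<times> V" and u: "\<And>i k. continuous_on X (\<lambda>z. u z i k)"
    and h: "continuous_on X h"
  shows "continuous_on X (\<lambda>z. Err (h z) (u z) (fst z))"
proof -
  note c = continuous_on_smooth_fst[OF _ X]
  have "continuous_on X (\<lambda>z. GH_dt (u z) (fst z))"
    unfolding GH_dt_def by (intro continuous_intros u c smooth_flow_rhs smooth_flow_rhs_low smooth_G smooth_H)
  moreover have "continuous_on X (\<lambda>z. GH_lap (u z) (fst z))"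
    unfolding GH_lap_def by (intro continuous_intros u c smooth_lap smooth_GH)
  moreover have "continuous_on X (\<lambda>z. GH_drift (u z) (fst z))"
    unfolding GH_drift_def comm_field_def by (intro continuous_intros u c smooth_wd smooth_GH smooth_H)
  moreover have "continuous_on X (\<lambda>z. quad (u z) (GH (fst z)) (Rz (fst z)))"
    "continuous_on X (\<lambda>z. quad (u z) (Rz (fst z)) (GH (fst z)))"
    "continuous_on X (\<lambda>z. quad (u z) (GH (fst z)) (GH (fst z)))"
    by (auto intro!: continuous_on_quad u c[OF smooth_GH] c[OF smooth_Rz])
  ultimately show ?thesis
    unfolding Err_def by (intro continuous_intros h)
qed

text \<open>On a compact set of points and normalised \<open>U\<close> the error is bounded and
  \<open>Iform\<close> has a positive minimum. Admitting all \<eta> in [0, 1] makes the bound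
  independent of \<epsilon>, so \<kappa> can be fixed before \<epsilon>.\<close>

lemma Err_dominated:
  assumes I: "compact I" "I \<subseteq> T" and K: "compact K" "K \<subseteq> V"
  shows "\<exists>\<kappa>0\<ge>0. \<forall>\<kappa>\<ge>\<kappa>0. \<forall>t\<in>I. \<forall>x\<in>K. \<forall>\<eta>\<in>{0..1}. \<forall>U :: complex^'n^'n. norm U = 1 \<longrightarrow>
     0 < \<kappa> * Re (Iform (\<lambda>i k. U $ i $ k) (t, x)) + Re (Err \<eta> (\<lambda>i k. U $ i $ k) (t, x))"
proof -
  let ?X = "(I \<times> K) \<times> (sphere 0 1 :: (complex^'n^'n) set) \<times> {0..1::real}"
  have cX: "compact ?X" by (intro compact_Times I K compact_sphere compact_Icc)
  have fX: "fst z \<in> T \<times> V" if "z \<in> ?X" for z using that I K by (auto simp: mem_Times_iff)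
  let ?i = "\<lambda>z. Re (Iform (\<lambda>i k. fst (snd z) $ i $ k) (fst z))"
  let ?e = "\<lambda>z. Re (Err (snd (snd z)) (\<lambda>i k. fst (snd z) $ i $ k) (fst z))"
  have ci: "continuous_on ?X ?i" by (intro continuous_intros continuous_on_Iform fX)
  have ce: "continuous_on ?X ?e" by (intro continuous_intros continuous_on_Err fX)
  show ?thesis
  proof (cases "?X = {}")
    case True
    then show ?thesis by (intro exI[of _ 0]) (auto simp: sphere_def)
  next
    case False
    obtain z0 where z0: "z0 \<in> ?X" "\<And>z. z \<in> ?X \<Longrightarrow> ?i z0 \<le> ?i z"
      using continuous_attains_inf[OF cX False ci] by blast
    obtain z1 where z1: "z1 \<in> ?X" "\<And>z. z \<in> ?X \<Longrightarrow> ?e z1 \<le> ?e z"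
      using continuous_attains_inf[OF cX False ce] by blast
    have ip: "?i z0 > 0"
    proof (rule Iform_pos[OF fX[OF z0(1)]])
      have "norm (fst (snd z0)) = 1" using z0(1) by (auto simp: mem_Times_iff)
      then have "fst (snd z0) \<noteq> 0" by auto
      then show "(\<lambda>i k. fst (snd z0) $ i $ k) \<noteq> (\<lambda>_ _. 0)" by (auto simp: vec_eq_iff fun_eq_iff)
    qed
    \<comment> \<open>Times the minimum of \<open>Iform\<close> this exceeds the absolute value of
      the minimal error by 1.\<close>
    define \<kappa>0 where "\<kappa>0 = (\<bar>?e z1\<bar> + 1) / ?i z0"
    have k0: "\<kappa>0 \<ge> 0" unfolding \<kappa>0_def using ip by (intro divide_nonneg_nonneg) auto
    have "0 < \<kappa> * Re (Iform (\<lambda>i k. U $ i $ k) (t, x)) + Re (Err \<eta> (\<lambda>i k. U $ i $ k) (t, x))"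
      if "\<kappa> \<ge> \<kappa>0" "t \<in> I" "x \<in> K" "\<eta> \<in> {0..1}" "norm U = 1" for \<kappa> t x \<eta> and U :: "complex^'n^'n"
    proof -
      have zX: "((t, x), U, \<eta>) \<in> ?X" using that by auto
      have "\<bar>?e z1\<bar> + 1 = \<kappa>0 * ?i z0" unfolding \<kappa>0_def using ip by simp
      also have "\<dots> \<le> \<kappa> * Re (Iform (\<lambda>i k. U $ i $ k) (t, x))"
        using z0(2)[OF zX] that(1) k0 ip by (intro mult_mono) auto
      finally show ?thesis using z1(2)[OF zX] by auto
    qed
    then show ?thesis using k0 by blast
  qed
qed

lemma Mform_no_u: "Mform \<xi> (\<lambda>_ _. 0) p = (\<Sum>k\<in>UNIV. \<Sum>l\<in>UNIV. H k l p * \<xi> k * cnj (\<xi> l))"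
  unfolding Mform_def DK_DL_expand[OF smooth_H] by (simp add: algebra_simps)

lemma form_scale:
  "Mform (\<lambda>k. c * \<xi> k) (\<lambda>i k. c * u i k) p + \<eta> * Iform (\<lambda>i k. c * u i k) p
    = c * cnj c * (Mform \<xi> u p + \<eta> * Iform u p)"
proof -
  have "wpack (\<lambda>k. c * \<xi> k) (\<lambda>i k. c * u i k) = (\<lambda>a. c * wpack \<xi> u a)"
    by (auto simp: wpack_def fun_eq_iff split: option.splits)
  then show ?thesis
    unfolding jet_matrix_form[symmetric] by (simp add: sum_distrib_left algebra_simps)
qed

section \<open>Curvature as a Schur complement\<close>

definition curv :: "real \<times> (complex^'n) \<Rightarrow> 'n \<Rightarrow> 'n \<Rightarrow> 'n \<Rightarrow> 'n \<Rightarrow> complex" where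
  "curv p i j k l = Rz p i j k l - (\<Sum>a\<in>UNIV. \<Sum>b\<in>UNIV. dzb j (H a l) p * G a b p * dz i (H k b) p)"

text \<open>A form is semidefinite if and only if its Schur complement is: in one direction the
  square is nonnegative, in the other \<xi> is chosen to make it vanish. Hermitian symmetry makes
  the values of the curvature form real.\<close>

lemma curv_nonneg_iff:
  assumes p: "p \<in> T \<times> V"
  shows "(\<forall>u. (\<Sum>i\<in>UNIV. \<Sum>j\<in>UNIV. \<Sum>k\<in>UNIV. \<Sum>l\<in>UNIV. curv p i j k l * u i k * cnj (u j l)) \<in> \<real>\<^sub>\<ge>\<^sub>0)
    \<longleftrightarrow> (\<forall>\<xi> u. 0 \<le> Re (Mform \<xi> u p))"
proof -
  obtain b \<beta> :: "'n \<Rightarrow> 'n \<Rightarrow> complex" and N :: "'n \<Rightarrow> 'n \<Rightarrow> 'n \<Rightarrow> complex" where b: "\<And>k l. H k l p = (\<Sum>q\<in>UNIV. b k q * cnj (b l q))"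
    and solve: "\<And>S r. (\<Sum>k\<in>UNIV. (\<Sum>q\<in>UNIV. \<beta> q k * S q) * b k r) = S r"
    and G: "\<And>i j. G i j p = (\<Sum>q\<in>UNIV. \<beta> q i * cnj (\<beta> q j))"
    and N: "\<And>i k l. dz i (H k l) p = (\<Sum>q\<in>UNIV. N q i k * cnj (b l q))"
    and N_eq: "\<And>q i k. N q i k = (\<Sum>l\<in>UNIV. dz i (H k l) p * cnj (\<beta> q l))"
    by (rule unitary_frame[OF p]) (rule that)
  have NN: "(\<Sum>q\<in>UNIV. N q i k * cnj (N q j l)) = (\<Sum>a\<in>UNIV. \<Sum>c\<in>UNIV. dzb j (H a l) p * G a c p * dz i (H k c) p)" for i j k l
  proof -
    have d: "dzb j (H a l) p = cnj (dz j (H l a) p)" for a by (simp add: cnj_wd sms cnj_H)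
    show ?thesis
      unfolding N_eq d G cnj_sum sum_product sum_distrib_left sum_distrib_right
      unfolding sum.cartesian_product UNIV_Times_UNIV
      by (rule sum.reindex_bij_witness[of _ "\<lambda>(a,c,q). (q,a,c)" "\<lambda>(q,a,c). (a,c,q)"])
         (auto simp: algebra_simps)
  qed
  define Z where "Z u = (\<Sum>i\<in>UNIV. \<Sum>k\<in>UNIV. \<Sum>j\<in>UNIV. \<Sum>l\<in>UNIV. curv p i j k l * u i k * cnj (u j l))" for u
  have order: "(\<Sum>i\<in>UNIV. \<Sum>j\<in>UNIV. \<Sum>k\<in>UNIV. \<Sum>l\<in>UNIV. curv p i j k l * u i k * cnj (u j l)) = Z u" for u
    unfolding Z_def by (rule sum.cong[OF refl], rule sum.swap)
  have cnj_curv: "cnj (curv p i j k l) = curv p j i l k" for i j k l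
    unfolding curv_def NN[symmetric] by (simp add: cnj_Rz mult.commute)
  have real: "cnj (Z u) = Z u" for u
    unfolding Z_def cnj_sum complex_cnj_mult cnj_curv
    unfolding sum.cartesian_product UNIV_Times_UNIV
    by (rule sum.reindex_bij_witness[of _ "\<lambda>(j,l,i,k). (i,k,j,l)" "\<lambda>(i,k,j,l). (j,l,i,k)"]) auto
  have M: "Mform \<xi> u p = Z u + (\<Sum>q\<in>UNIV. ((\<Sum>i\<in>UNIV. \<Sum>k\<in>UNIV. u i k * N q i k) + (\<Sum>k\<in>UNIV. \<xi> k * b k q)) *
         cnj ((\<Sum>i\<in>UNIV. \<Sum>k\<in>UNIV. u i k * N q i k) + (\<Sum>k\<in>UNIV. \<xi> k * b k q)))" for \<xi> u
    unfolding Mform_schur[OF b N] Z_def curv_def NN ..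
  have Zre: "Z u \<in> \<real>\<^sub>\<ge>\<^sub>0 \<longleftrightarrow> 0 \<le> Re (Z u)" for u
    using real[of u] by (auto simp: complex_nonneg_Reals_iff complex_eq_iff)
  have "(\<forall>u. 0 \<le> Re (Z u)) \<longleftrightarrow> (\<forall>\<xi> u. 0 \<le> Re (Mform \<xi> u p))"
  proof (intro iffI allI)
    fix \<xi> u assume "\<forall>u. 0 \<le> Re (Z u)"
    moreover have "0 \<le> Re (\<Sum>q\<in>UNIV. h q * cnj (h q))" for h :: "'n \<Rightarrow> complex"
      unfolding Re_sum by (intro sum_nonneg) simp
    ultimately show "0 \<le> Re (Mform \<xi> u p)" unfolding M plus_complex.sel by (intro add_nonneg_nonneg) blast+
  next
    fix u assume *: "\<forall>\<xi> u. 0 \<le> Re (Mform \<xi> u p)"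
    let ?S = "\<lambda>q. \<Sum>i\<in>UNIV. \<Sum>k\<in>UNIV. u i k * N q i k"
    have eq: "Mform (\<lambda>k. \<Sum>r\<in>UNIV. \<beta> r k * (- ?S r)) u p = Z u"
      unfolding M solve by simp
    show "0 \<le> Re (Z u)" unfolding eq[symmetric] by (rule *[rule_format])
  qed
  then show ?thesis unfolding order Zre .
qed

end

section \<open>The flow and the curvature in terms of the inverse metric\<close>

locale metric_chart = hermitian_chart T V G H
  for T :: "real set" and V :: "(complex^'n::finite) set" and G H +
  fixes Gm :: "real \<Rightarrow> complex^'n \<Rightarrow> complex^'n^'n"
  assumes Gm: "(t, x) \<in> T \<times> V \<Longrightarrow> Gm t x $ i $ j = G i j (t, x)"
    and inv_Gm: "(t, x) \<in> T \<times> V \<Longrightarrow> inv_comp (Gm t) x k l = H k l (t, x)"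
begin

lemma wirtinger_Gm:
  assumes "(t, x) \<in> T \<times> V"
  shows "wirtinger i (\<lambda>y. Gm t y $ k $ l) x = dz i (G k l) (t, x)"
    and "wirtinger_bar j (\<lambda>y. Gm t y $ k $ l) x = dzb j (G k l) (t, x)"
    and "wirtinger i (wirtinger_bar j (\<lambda>y. Gm t y $ k $ l)) x = dz i (dzb j (G k l)) (t, x)"
proof -
  let ?f = "\<lambda>p. Gm (fst p) (snd p) $ k $ l"
  have e: "wd s i (G k l) = wd s i ?f" for s i
    by (rule wd_cong[OF _ smooth_G]) (auto simp: Gm)
  show "wirtinger i (\<lambda>y. Gm t y $ k $ l) x = dz i (G k l) (t, x)"
    unfolding e dz_eq_wirtinger[OF assms] by simp
  show "wirtinger_bar j (\<lambda>y. Gm t y $ k $ l) x = dzb j (G k l) (t, x)"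
    unfolding e dzb_eq_wirtinger_bar[OF assms] by simp
  let ?g = "\<lambda>p. wirtinger_bar j (\<lambda>y. Gm (fst p) y $ k $ l) (snd p)"
  have e2: "dz i (dzb j (G k l)) = dz i ?g"
  proof (rule wd_cong[OF _ smooth_wd[OF smooth_G]])
    fix p assume "p \<in> T \<times> V"
    then show "dzb j (G k l) p = ?g p" unfolding e by (simp add: dzb_eq_wirtinger_bar)
  qed
  show "wirtinger i (wirtinger_bar j (\<lambda>y. Gm t y $ k $ l)) x = dz i (dzb j (G k l)) (t, x)"
    unfolding e2 dz_eq_wirtinger[OF assms] by simp
qed

lemma delta_sums:
  "(\<Sum>m\<in>UNIV. (if k = m then 1 else 0) * f m) = f k" "(\<Sum>m\<in>UNIV. f m * (if k = m then 1 else 0)) = f k"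
  "(\<Sum>m\<in>UNIV. (if m = k then 1 else 0) * f m) = f k" "(\<Sum>m\<in>UNIV. f m * (if m = k then 1 else 0)) = f k"
  for f :: "'n \<Rightarrow> complex"
  by (simp_all add: if_distrib[of "\<lambda>z. z * _"] if_distrib[of "\<lambda>z. _ * z"] cong: if_cong)

lemma wd_inverse_relation:
  assumes p: "p \<in> T \<times> V"
  shows "(\<Sum>l\<in>UNIV. wd s i (H k l) p * G m l p) = - (\<Sum>l\<in>UNIV. H k l p * wd s i (G m l) p)"
proof -
  have "wd s i (\<lambda>p. if k = m then 1 else 0) = wd s i (\<lambda>p. \<Sum>l\<in>UNIV. H k l p * G m l p)"
    by (rule wd_cong[OF _ smooth_on_const]) (simp add: inverse1)
  then have "(\<lambda>p. \<Sum>l\<in>UNIV. wd s i (H k l) p * G m l p + H k l p * wd s i (G m l) p) = (\<lambda>p. 0)"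
    by (simp add: wd_const wd_sum wd_mult sms)
  from fun_cong[OF this, of p] show ?thesis
    by (simp add: sum.distrib add_eq_0_iff2)
qed

text \<open>An equality of functions, true also off the domain because both sides vanish there, so
  that it can be differentiated once more in \<open>Om_raised\<close>.\<close>

lemma wd_H:
  "wd s i (H k b) = (\<lambda>p. - (\<Sum>m\<in>UNIV. \<Sum>n\<in>UNIV. H k n p * wd s i (G m n) p * H m b p))"
proof
  fix p show "wd s i (H k b) p = - (\<Sum>m\<in>UNIV. \<Sum>n\<in>UNIV. H k n p * wd s i (G m n) p * H m b p)"
  proof (cases "p \<in> T \<times> V")
    case True
    have "wd s i (H k b) p = (\<Sum>l\<in>UNIV. wd s i (H k l) p * (\<Sum>m\<in>UNIV. H m b p * G m l p))"
      unfolding inverse2[OF True] delta_sums ..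
    also have "\<dots> = (\<Sum>m\<in>UNIV. (\<Sum>l\<in>UNIV. wd s i (H k l) p * G m l p) * H m b p)"
      unfolding sum_distrib_left sum_distrib_right by (subst sum.swap) (simp add: algebra_simps)
    also have "\<dots> = - (\<Sum>m\<in>UNIV. \<Sum>n\<in>UNIV. H k n p * wd s i (G m n) p * H m b p)"
      unfolding wd_inverse_relation[OF True] by (simp add: sum_distrib_right sum_negf)
    finally show ?thesis .
  qed (simp add: wd_outside)
qed

definition Om :: "real \<times> (complex^'n) \<Rightarrow> 'n \<Rightarrow> 'n \<Rightarrow> 'n \<Rightarrow> 'n \<Rightarrow> complex" where
  "Om p i j k l = - dz i (dzb j (G k l)) p + (\<Sum>a\<in>UNIV. \<Sum>b\<in>UNIV. H a b p * dzb j (G a l) p * dz i (G k b) p)"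

lemma chern_curvature_eq: "(t, x) \<in> T \<times> V \<Longrightarrow> chern_curvature (Gm t) x i j k l = Om (t, x) i j k l"
  by (simp only: chern_curvature_def Om_def wirtinger_Gm inv_Gm)

text \<open>Differentiating the inverse metric twice gives three terms: one with second derivatives
  of the metric, one that is the quadratic term of the Chern curvature after raising indices, and
  one that \<open>curv\<close> subtracts.\<close>

lemma Om_raised:
  assumes p: "p \<in> T \<times> V"
  shows "(\<Sum>m\<in>UNIV. \<Sum>n\<in>UNIV. Om p i j m n * H m l p * H k n p) = curv p i j k l"
proof -
  let ?Hz = "\<lambda>k l. dz i (H k l) p" and ?Gz = "\<lambda>k l. dz i (G k l) p"
  let ?Hb = "\<lambda>k l. dzb j (H k l) p" and ?Gb = "\<lambda>k l. dzb j (G k l) p"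
  let ?dd = "\<lambda>k l. dz i (dzb j (G k l)) p"
  have R: "Rz p i j k l = - (\<Sum>m\<in>UNIV. \<Sum>n\<in>UNIV. ?Hz k n * ?Gb m n * H m l p)
      - (\<Sum>m\<in>UNIV. \<Sum>n\<in>UNIV. H k n p * ?dd m n * H m l p)
      - (\<Sum>m\<in>UNIV. \<Sum>n\<in>UNIV. H k n p * ?Gb m n * ?Hz m l)"
  proof -
    have "Rz p i j k l = - (\<Sum>m\<in>UNIV. \<Sum>n\<in>UNIV.
       (?Hz k n * ?Gb m n + H k n p * ?dd m n) * H m l p + H k n p * ?Gb m n * ?Hz m l)"
      unfolding Rz_def wd_H[of \<i>] by (simp add: wd_uminus wd_sum wd_mult sms)
    then show ?thesis
      by (simp only: distrib_right sum.distrib minus_add_distrib diff_conv_add_uminus add.assoc)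
  qed
  have A: "(\<Sum>a\<in>UNIV. \<Sum>b\<in>UNIV. ?Hb a l * G a b p * ?Hz k b) = - (\<Sum>m\<in>UNIV. \<Sum>n\<in>UNIV. ?Hz k n * ?Gb m n * H m l p)"
  proof -
    have "(\<Sum>a\<in>UNIV. \<Sum>b\<in>UNIV. ?Hb a l * G a b p * ?Hz k b)
      = - (\<Sum>m\<in>UNIV. \<Sum>n\<in>UNIV. \<Sum>b\<in>UNIV. (\<Sum>a\<in>UNIV. H a n p * G a b p) * (?Gb m n * H m l p * ?Hz k b))"
      unfolding wd_H[of \<i>] minus_mult_left[symmetric] sum_negf sum_distrib_left sum_distrib_right
      unfolding sum.cartesian_product UNIV_Times_UNIV
      by (rule arg_cong[of _ _ uminus], rule sum.reindex_bij_witness[of _ "\<lambda>(m,n,b,a). (a,b,m,n)" "\<lambda>(a,b,m,n). (m,n,b,a)"])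
         (auto simp: algebra_simps)
    then show ?thesis unfolding inverse2[OF p] delta_sums by (simp add: algebra_simps)
  qed
  have B: "(\<Sum>m\<in>UNIV. \<Sum>n\<in>UNIV. (\<Sum>a\<in>UNIV. \<Sum>b\<in>UNIV. H a b p * ?Gb a n * ?Gz m b) * H m l p * H k n p)
     = - (\<Sum>m\<in>UNIV. \<Sum>n\<in>UNIV. H k n p * ?Gb m n * ?Hz m l)"
    unfolding wd_H[of "-\<i>"] mult_minus_right sum_negf minus_minus sum_distrib_left sum_distrib_right
    unfolding sum.cartesian_product UNIV_Times_UNIV
    by (rule sum.reindex_bij_witness[of _ "\<lambda>(a,n,m,b). (m,n,a,b)" "\<lambda>(m,n,a,b). (a,n,m,b)"])
       (auto simp: algebra_simps)
  have "(\<Sum>m\<in>UNIV. \<Sum>n\<in>UNIV. Om p i j m n * H m l p * H k n p)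
    = - (\<Sum>m\<in>UNIV. \<Sum>n\<in>UNIV. H k n p * ?dd m n * H m l p)
      + (\<Sum>m\<in>UNIV. \<Sum>n\<in>UNIV. (\<Sum>a\<in>UNIV. \<Sum>b\<in>UNIV. H a b p * ?Gb a n * ?Gz m b) * H m l p * H k n p)"
    unfolding Om_def distrib_right sum.distrib by (simp add: sum_negf algebra_simps)
  then show ?thesis unfolding B curv_def R A by simp
qed

lemma curvature_up_eq:
  assumes p: "(t, x) \<in> T \<times> V"
  shows "curvature_up (Gm t) x i j l k = curv (t, x) i j k l"
  unfolding curvature_up_def chern_curvature_eq[OF p] inv_Gm[OF p] by (rule Om_raised[OF p])

section \<open>Torsion and the flow of the inverse metric\<close>

lemma torsion_low_eq:
  assumes p: "(t, x) \<in> T \<times> V"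
  shows "torsion_low (Gm t) x i j l = dz i (G j l) (t, x) - dz j (G i l) (t, x)"
proof -
  have "torsion_low (Gm t) x i j l = (\<Sum>b\<in>UNIV. (\<Sum>k\<in>UNIV. H k b (t, x) * G k l (t, x)) *
     (dz i (G j b) (t, x) - dz j (G i b) (t, x)))"
    unfolding torsion_low_def torsion_def wirtinger_Gm[OF p] inv_Gm[OF p] Gm[OF p] sum_distrib_right
    by (subst sum.swap) (simp add: algebra_simps)
  then show ?thesis unfolding inverse2[OF p] delta_sums .
qed

definition Qlow :: "real \<times> (complex^'n) \<Rightarrow> 'n \<Rightarrow> 'n \<Rightarrow> complex" where
  "Qlow p i j = (1/2) * (\<Sum>m\<in>UNIV. \<Sum>n\<in>UNIV. \<Sum>q\<in>UNIV. \<Sum>s\<in>UNIV. H m n p * H q s p *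
     (dz m (G q j) p - dz q (G m j) p) * cnj (dz n (G s i) p - dz s (G n i) p))"

definition Slow :: "real \<times> (complex^'n) \<Rightarrow> 'n \<Rightarrow> 'n \<Rightarrow> complex" where
  "Slow p i j = (\<Sum>m\<in>UNIV. \<Sum>n\<in>UNIV. H m n p * Om p m n i j)"

lemma torsion_Q_eq: "(t, x) \<in> T \<times> V \<Longrightarrow> torsion_Q (Gm t) x i j = Qlow (t, x) i j"
  by (simp only: torsion_Q_def torsion_low_bar_def torsion_low_eq inv_Gm Qlow_def)

lemma second_chern_ricci_eq: "(t, x) \<in> T \<times> V \<Longrightarrow> second_chern_ricci (Gm t) x i j = Slow (t, x) i j"
  by (simp only: second_chern_ricci_def chern_curvature_eq inv_Gm Slow_def)

lemma Slow_raised: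
  assumes p: "p \<in> T \<times> V"
  shows "(\<Sum>i\<in>UNIV. \<Sum>j\<in>UNIV. H k j p * Slow p i j * H i l p) = (\<Sum>m\<in>UNIV. \<Sum>n\<in>UNIV. H m n p * curv p m n k l)"
  unfolding Slow_def Om_raised[OF p, symmetric] sum_distrib_left sum_distrib_right
  unfolding sum.cartesian_product UNIV_Times_UNIV
  by (rule sum.reindex_bij_witness[of _ "\<lambda>(m,n,i,j). (i,j,m,n)" "\<lambda>(i,j,m,n). (m,n,i,j)"]) (auto simp: algebra_simps)

text \<open>The product of two antisymmetrised factors expands into four sums. Exchanging the two
  contracted index pairs shows that they agree in pairs, which absorbs the factor 1/2.\<close>

lemma Qlow_raised:
  assumes p: "p \<in> T \<times> V"
  shows "(\<Sum>i\<in>UNIV. \<Sum>j\<in>UNIV. H k j p * Qlow p i j * H i l p) =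
    (\<Sum>m\<in>UNIV. \<Sum>n\<in>UNIV. H m n p * (\<Sum>a\<in>UNIV. \<Sum>b\<in>UNIV. dzb n (H a l) p * G a b p * dz m (H k b) p))
    - (\<Sum>m\<in>UNIV. \<Sum>n\<in>UNIV. dz m (H k n) p * dzb n (H m l) p)"
proof -
  \<comment> \<open>Up to sign the connection coefficients of the Chern connection, expressed by
    derivatives of \<open>H\<close>; the torsion is their antisymmetrisation.\<close>
  define \<alpha> where "\<alpha> m q k = (\<Sum>c\<in>UNIV. dz m (H k c) p * G q c p)" for m q k
  have \<alpha>: "(\<Sum>j\<in>UNIV. H k j p * dz m (G q j) p) = - \<alpha> m q k" for m q k
    unfolding \<alpha>_def wd_inverse_relation[OF p] by simp
  have low: "(\<Sum>j\<in>UNIV. H k j p * (dz m (G q j) p - dz q (G m j) p)) = \<alpha> q m k - \<alpha> m q k" for m q k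
    by (simp add: right_diff_distrib sum_subtractf \<alpha>)
  have low': "(\<Sum>i\<in>UNIV. cnj (dz n (G s i) p - dz s (G n i) p) * H i l p) = cnj (\<alpha> s n l - \<alpha> n s l)" for n s
    unfolding low[symmetric] cnj_sum complex_cnj_mult cnj_H by (simp add: mult.commute)
  have "(\<Sum>i\<in>UNIV. \<Sum>j\<in>UNIV. H k j p * Qlow p i j * H i l p) = (1/2) * (\<Sum>m\<in>UNIV. \<Sum>n\<in>UNIV. \<Sum>q\<in>UNIV. \<Sum>s\<in>UNIV.
      H m n p * H q s p * ((\<Sum>j\<in>UNIV. H k j p * (dz m (G q j) p - dz q (G m j) p)) *
        (\<Sum>i\<in>UNIV. cnj (dz n (G s i) p - dz s (G n i) p) * H i l p)))"
    unfolding Qlow_def sum_product sum_distrib_left sum_distrib_right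
    unfolding sum.cartesian_product UNIV_Times_UNIV
    by (rule sum.reindex_bij_witness[of _ "\<lambda>(m,n,q,s,i,j). (i,j,m,n,q,s)" "\<lambda>(i,j,m,n,q,s). (m,n,q,s,i,j)"])
       (auto simp: algebra_simps)
  also have "\<dots> = (1/2) * (\<Sum>m\<in>UNIV. \<Sum>n\<in>UNIV. \<Sum>q\<in>UNIV. \<Sum>s\<in>UNIV.
      H m n p * H q s p * (\<alpha> q m k * cnj (\<alpha> s n l)) + H m n p * H q s p * (\<alpha> m q k * cnj (\<alpha> n s l))
      - H m n p * H q s p * (\<alpha> q m k * cnj (\<alpha> n s l)) - H m n p * H q s p * (\<alpha> m q k * cnj (\<alpha> s n l)))"
    unfolding low low' by (simp add: algebra_simps)
  also have "\<dots> = (\<Sum>m\<in>UNIV. \<Sum>n\<in>UNIV. \<Sum>q\<in>UNIV. \<Sum>s\<in>UNIV. H m n p * H q s p * (\<alpha> m q k * cnj (\<alpha> n s l)))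
     - (\<Sum>m\<in>UNIV. \<Sum>n\<in>UNIV. \<Sum>q\<in>UNIV. \<Sum>s\<in>UNIV. H m n p * H q s p * (\<alpha> m q k * cnj (\<alpha> s n l)))"
  proof -
    have 1: "(\<Sum>m\<in>UNIV. \<Sum>n\<in>UNIV. \<Sum>q\<in>UNIV. \<Sum>s\<in>UNIV. H m n p * H q s p * (\<alpha> q m k * cnj (\<alpha> s n l)))
       = (\<Sum>m\<in>UNIV. \<Sum>n\<in>UNIV. \<Sum>q\<in>UNIV. \<Sum>s\<in>UNIV. H m n p * H q s p * (\<alpha> m q k * cnj (\<alpha> n s l)))"
      unfolding sum.cartesian_product UNIV_Times_UNIV
      by (rule sum.reindex_bij_witness[of _ "\<lambda>(m,n,q,s). (q,s,m,n)" "\<lambda>(m,n,q,s). (q,s,m,n)"]) (auto simp: algebra_simps)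
    have 2: "(\<Sum>m\<in>UNIV. \<Sum>n\<in>UNIV. \<Sum>q\<in>UNIV. \<Sum>s\<in>UNIV. H m n p * H q s p * (\<alpha> q m k * cnj (\<alpha> n s l)))
       = (\<Sum>m\<in>UNIV. \<Sum>n\<in>UNIV. \<Sum>q\<in>UNIV. \<Sum>s\<in>UNIV. H m n p * H q s p * (\<alpha> m q k * cnj (\<alpha> s n l)))"
      unfolding sum.cartesian_product UNIV_Times_UNIV
      by (rule sum.reindex_bij_witness[of _ "\<lambda>(m,n,q,s). (q,s,m,n)" "\<lambda>(m,n,q,s). (q,s,m,n)"]) (auto simp: algebra_simps)
    show ?thesis unfolding sum_subtractf sum.distrib 1 2 by simp
  qed
  also have "(\<Sum>m\<in>UNIV. \<Sum>n\<in>UNIV. \<Sum>q\<in>UNIV. \<Sum>s\<in>UNIV. H m n p * H q s p * (\<alpha> m q k * cnj (\<alpha> n s l)))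
    = (\<Sum>m\<in>UNIV. \<Sum>n\<in>UNIV. H m n p * (\<Sum>a\<in>UNIV. \<Sum>b\<in>UNIV. dzb n (H a l) p * G a b p * dz m (H k b) p))"
  proof (intro sum.cong refl)
    fix m n
    have c: "cnj (\<alpha> n s l) = (\<Sum>a\<in>UNIV. dzb n (H a l) p * G a s p)" for s
      by (simp add: \<alpha>_def cnj_wd sms cnj_H cnj_G)
    have h: "(\<Sum>q\<in>UNIV. H q s p * \<alpha> m q k) = dz m (H k s) p" for s
    proof -
      have "(\<Sum>q\<in>UNIV. H q s p * \<alpha> m q k) = (\<Sum>c\<in>UNIV. dz m (H k c) p * (\<Sum>q\<in>UNIV. H q s p * G q c p))"
        unfolding \<alpha>_def sum_distrib_left by (subst sum.swap) (simp add: algebra_simps)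
      then show ?thesis unfolding inverse2[OF p] delta_sums .
    qed
    have "(\<Sum>q\<in>UNIV. \<Sum>s\<in>UNIV. H m n p * H q s p * (\<alpha> m q k * cnj (\<alpha> n s l)))
      = (\<Sum>s\<in>UNIV. H m n p * ((\<Sum>q\<in>UNIV. H q s p * \<alpha> m q k) * cnj (\<alpha> n s l)))"
      unfolding sum_distrib_left sum_distrib_right by (subst sum.swap) (simp add: algebra_simps)
    also have "\<dots> = H m n p * (\<Sum>a\<in>UNIV. \<Sum>b\<in>UNIV. dzb n (H a l) p * G a b p * dz m (H k b) p)"
      unfolding h c sum_distrib_left by (subst sum.swap) (simp add: algebra_simps)
    finally show "(\<Sum>q\<in>UNIV. \<Sum>s\<in>UNIV. H m n p * H q s p * (\<alpha> m q k * cnj (\<alpha> n s l)))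
      = H m n p * (\<Sum>a\<in>UNIV. \<Sum>b\<in>UNIV. dzb n (H a l) p * G a b p * dz m (H k b) p)" .
  qed
  also have "(\<Sum>m\<in>UNIV. \<Sum>n\<in>UNIV. \<Sum>q\<in>UNIV. \<Sum>s\<in>UNIV. H m n p * H q s p * (\<alpha> m q k * cnj (\<alpha> s n l)))
    = (\<Sum>m\<in>UNIV. \<Sum>n\<in>UNIV. dz m (H k n) p * dzb n (H m l) p)"
  proof -
    have 1: "(\<Sum>q\<in>UNIV. H q s p * \<alpha> m q k) = dz m (H k s) p" for s m
    proof -
      have "(\<Sum>q\<in>UNIV. H q s p * \<alpha> m q k) = (\<Sum>c\<in>UNIV. dz m (H k c) p * (\<Sum>q\<in>UNIV. H q s p * G q c p))"
        unfolding \<alpha>_def sum_distrib_left by (subst sum.swap) (simp add: algebra_simps)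
      then show ?thesis unfolding inverse2[OF p] delta_sums .
    qed
    have 2: "(\<Sum>n\<in>UNIV. H m n p * cnj (\<alpha> s n l)) = dzb s (H m l) p" for m s
    proof -
      have "(\<Sum>n\<in>UNIV. H m n p * cnj (\<alpha> s n l)) = (\<Sum>c\<in>UNIV. (\<Sum>n\<in>UNIV. H m n p * G c n p) * dzb s (H c l) p)"
        by (simp add: \<alpha>_def cnj_wd sms cnj_H cnj_G sum_distrib_left sum_distrib_right, subst sum.swap)
           (simp add: algebra_simps)
      then show ?thesis unfolding inverse1[OF p] delta_sums .
    qed
    have "(\<Sum>m\<in>UNIV. \<Sum>n\<in>UNIV. \<Sum>q\<in>UNIV. \<Sum>s\<in>UNIV. H m n p * H q s p * (\<alpha> m q k * cnj (\<alpha> s n l)))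
       = (\<Sum>m\<in>UNIV. \<Sum>s\<in>UNIV. (\<Sum>q\<in>UNIV. H q s p * \<alpha> m q k) * (\<Sum>n\<in>UNIV. H m n p * cnj (\<alpha> s n l)))"
      unfolding sum_product
      unfolding sum.cartesian_product UNIV_Times_UNIV
      by (rule sum.reindex_bij_witness[of _ "\<lambda>(m,s,q,n). (m,n,q,s)" "\<lambda>(m,n,q,s). (m,s,q,n)"]) (auto simp: algebra_simps)
    then show ?thesis unfolding 1 2 .
  qed
  finally show ?thesis .
qed

text \<open>The first sum in \<open>Qlow_raised\<close> cancels the term by which
  \<open>curv\<close> differs from the second derivatives of \<open>H\<close>. This is why the flow
  of \<open>H\<close> does not involve \<open>G\<close>.\<close>

lemma flow_rhs_eq_raised:
  assumes p: "p \<in> T \<times> V"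
  shows "flow_rhs k l p = (\<Sum>i\<in>UNIV. \<Sum>j\<in>UNIV. H k j p * (Slow p i j + Qlow p i j) * H i l p)"
proof -
  have "(\<Sum>i\<in>UNIV. \<Sum>j\<in>UNIV. H k j p * (Slow p i j + Qlow p i j) * H i l p) =
    (\<Sum>i\<in>UNIV. \<Sum>j\<in>UNIV. H k j p * Slow p i j * H i l p) + (\<Sum>i\<in>UNIV. \<Sum>j\<in>UNIV. H k j p * Qlow p i j * H i l p)"
    by (simp add: distrib_left distrib_right sum.distrib)
  also have "\<dots> = flow_rhs k l p"
    unfolding Slow_raised[OF p] Qlow_raised[OF p] flow_rhs_def curv_def Rz_def right_diff_distrib sum_subtractf
    by simp
  finally show ?thesis ..
qed

lemma flow_rhs_low_eq:
  assumes p: "p \<in> T \<times> V"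
  shows "flow_rhs_low i j p = - (Slow p i j + Qlow p i j)"
proof -
  let ?W = "\<lambda>i j. Slow p i j + Qlow p i j"
  have "(\<Sum>k\<in>UNIV. \<Sum>l\<in>UNIV. G i l p * flow_rhs k l p * G k j p)
    = (\<Sum>a\<in>UNIV. \<Sum>b\<in>UNIV. (\<Sum>k\<in>UNIV. H k b p * G k j p) * ?W a b * (\<Sum>l\<in>UNIV. H a l p * G i l p))"
    unfolding flow_rhs_eq_raised[OF p] sum_distrib_left sum_distrib_right
    unfolding sum.cartesian_product UNIV_Times_UNIV
    by (rule sum.reindex_bij_witness[of _ "\<lambda>(a,b,l,k). (k,l,a,b)" "\<lambda>(k,l,a,b). (a,b,l,k)"]) (auto simp: algebra_simps)
  also have "\<dots> = ?W i j"
    unfolding inverse1[OF p] inverse2[OF p]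
    by (subst sum.swap) (simp add: if_distrib[of "\<lambda>z. z * _"] if_distrib[of "\<lambda>z. _ * z"] cong: if_cong)
  finally show ?thesis unfolding flow_rhs_low_def by simp
qed

text \<open>The flow is given for the metric. That \<open>H\<close> has a time derivative at all
  follows from its joint smoothness, and its value from differentiating the inverse
  relation.\<close>

lemma flow_equations:
  assumes J: "open J" "J \<subseteq> T" "t \<in> J" and x: "x \<in> V"
    and flow: "\<And>i j. ((\<lambda>s. Gm s x $ i $ j) has_vector_derivative
       - second_chern_ricci (Gm t) x i j - torsion_Q (Gm t) x i j) (at t)"
  shows "((\<lambda>s. G i j (s, x)) has_vector_derivative flow_rhs_low i j (t, x)) (at t)"
    and "((\<lambda>s. H k l (s, x)) has_vector_derivative flow_rhs k l (t, x)) (at t)"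
proof -
  have p: "(t, x) \<in> T \<times> V" using J x by blast
  have G: "((\<lambda>s. G i j (s, x)) has_vector_derivative flow_rhs_low i j (t, x)) (at t)" for i j
  proof (rule has_vector_derivative_transform_within_open[OF _ J(1,3)])
    show "((\<lambda>s. Gm s x $ i $ j) has_vector_derivative flow_rhs_low i j (t, x)) (at t)"
      using flow[of i j] by (simp add: flow_rhs_low_eq[OF p] torsion_Q_eq[OF p] second_chern_ricci_eq[OF p])
  qed (use J x in \<open>auto intro!: Gm\<close>)
  then show "((\<lambda>s. G i j (s, x)) has_vector_derivative flow_rhs_low i j (t, x)) (at t)" .
  have "\<exists>P. ((\<lambda>s. H k l (s, x)) has_vector_derivative P) (at t)" for k l
  proof -
    have "Ck_on (Suc 0) (T \<times> V) (H k l)" using smooth_H unfolding smooth_on_def by blast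
    then obtain f' where "(H k l has_derivative f') (at (t, x) within T \<times> V)"
      unfolding Ck_on.simps using p by blast
    then have "(H k l has_derivative f') (at (t, x) within J \<times> V)"
      by (rule has_derivative_subset) (use J in auto)
    then have d: "(H k l has_derivative f') (at (t, x))"
      using at_within_open[of "(t, x)" "J \<times> V"] J x open_V by (simp add: open_Times)
    have "((\<lambda>s. (s, x)) has_derivative (\<lambda>c. (c, 0))) (at t)"
      by (auto intro!: derivative_eq_intros)
    from has_derivative_has_vector_derivative[OF has_derivative_compose[OF this d]] show ?thesis by blast
  qed
  then obtain P where P: "\<And>k l. ((\<lambda>s. H k l (s, x)) has_vector_derivative P k l) (at t)" by metis
  have rel: "(\<Sum>l\<in>UNIV. P k l * G m l (t, x)) = - (\<Sum>l\<in>UNIV. H k l (t, x) * flow_rhs_low m l (t, x))" for k m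
  proof -
    have "((\<lambda>s. \<Sum>l\<in>UNIV. H k l (s, x) * G m l (s, x)) has_vector_derivative
        (\<Sum>l\<in>UNIV. H k l (t, x) * flow_rhs_low m l (t, x) + P k l * G m l (t, x))) (at t)"
      by (intro has_vector_derivative_sum has_vector_derivative_mult P G)
    moreover have "((\<lambda>s. \<Sum>l\<in>UNIV. H k l (s, x) * G m l (s, x)) has_vector_derivative 0) (at t)"
    proof (rule has_vector_derivative_transform_within_open[OF has_vector_derivative_const[of "if k = m then 1 else 0"] J(1,3)])
      fix s assume "s \<in> J"
      then have "(s, x) \<in> T \<times> V" using J x by blast
      from inverse1[OF this] show "(if k = m then 1 else 0) = (\<Sum>l\<in>UNIV. H k l (s, x) * G m l (s, x))" ..
    qed
    ultimately have "(\<Sum>l\<in>UNIV. H k l (t, x) * flow_rhs_low m l (t, x) + P k l * G m l (t, x)) = 0"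
      by (rule vector_derivative_unique_at)
    then show ?thesis by (simp add: sum.distrib add_eq_0_iff)
  qed
  have "P k l = (\<Sum>b\<in>UNIV. P k b * (\<Sum>m\<in>UNIV. H m l (t, x) * G m b (t, x)))"
    unfolding inverse2[OF p] delta_sums ..
  also have "\<dots> = (\<Sum>m\<in>UNIV. (\<Sum>b\<in>UNIV. P k b * G m b (t, x)) * H m l (t, x))"
    unfolding sum_distrib_left sum_distrib_right by (subst sum.swap) (simp add: algebra_simps)
  also have "\<dots> = flow_rhs k l (t, x)"
    unfolding rel flow_rhs_low_eq[OF p] flow_rhs_eq_raised[OF p]
    by (simp only: mult_minus_right sum_negf minus_minus sum_distrib_right)
  finally have "P k l = flow_rhs k l (t, x)" .
  with P[of k l] show "((\<lambda>s. H k l (s, x)) has_vector_derivative flow_rhs k l (t, x)) (at t)" by simp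
qed

end

section \<open>Holomorphic maps of several variables are smooth\<close>

lemma bounded_linear_vector_scalar_mult_left: "bounded_linear (\<lambda>\<zeta>::complex. \<zeta> *s (e :: complex^'n::finite))"
  by (simp add: linear_conv_bounded_linear[symmetric] linear_iff vec_eq_iff algebra_simps)

lemma complex_linear_expand:
  fixes L :: "complex^'n::finite \<Rightarrow> complex"
  assumes "linear L" "\<And>a v. L (a *s v) = a * L v"
  shows "L v = (\<Sum>i\<in>UNIV. v $ i * L (axis i 1))"
proof -
  have "v = (\<Sum>i\<in>UNIV. v $ i *s axis i 1)"
    by (simp add: vec_eq_iff axis_def if_distrib[of "\<lambda>z. _ * z"] cong: if_cong)
  then have "L v = L (\<Sum>i\<in>UNIV. v $ i *s axis i 1)" by simp
  also have "\<dots> = (\<Sum>i\<in>UNIV. L (v $ i *s axis i 1))" by (rule linear_sum[OF assms(1)])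
  finally show ?thesis by (simp add: assms(2))
qed

text \<open>Cauchy's formula on a disc in the complex line through \<open>z\<close> in the
  \<open>i\<close>-th direction. Its kernel does not depend on \<open>z\<close>, which allows
  differentiation under the integral.\<close>

lemma Cauchy_partial_derivative:
  fixes f :: "complex^'n::finite \<Rightarrow> complex" and i :: 'n and r :: real
  assumes r: "r > 0" and S: "open S" "\<And>\<zeta>. norm \<zeta> \<le> r \<Longrightarrow> z + \<zeta> *s axis i 1 \<in> S"
    and D: "\<And>x. x \<in> S \<Longrightarrow> (f has_derivative D x) (at x)" "\<And>x a v. x \<in> S \<Longrightarrow> D x (a *s v) = a * D x v"
  defines "\<gamma> \<equiv> circlepath 0 r"
  shows "D z (axis i 1) = integral (cbox 0 1) (\<lambda>t. f (z + \<gamma> t *s axis i 1) *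
     (vector_derivative \<gamma> (at t) / (\<gamma> t) ^ 2 / (2 * pi * \<i>)))"
proof -
  define g where "g \<zeta> = f (z + \<zeta> *s axis i 1)" for \<zeta>
  have dl: "((\<lambda>\<zeta>. z + \<zeta> *s axis i 1) has_derivative (\<lambda>\<zeta>. \<zeta> *s axis i 1)) (at \<zeta>)" for \<zeta>
    by (auto intro!: derivative_eq_intros bounded_linear.has_derivative[OF bounded_linear_vector_scalar_mult_left])
  have g: "(g has_field_derivative D (z + \<zeta> *s axis i 1) (axis i 1)) (at \<zeta>)" if "norm \<zeta> \<le> r" for \<zeta>
  proof -
    note m = S(2)[OF that]
    have "(g has_derivative (\<lambda>\<xi>. D (z + \<zeta> *s axis i 1) (\<xi> *s axis i 1))) (at \<zeta>)"
      unfolding g_def by (rule has_derivative_compose[OF dl D(1)[OF m]])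
    then show ?thesis by (simp add: has_field_derivative_def D(2)[OF m] mult.commute[of _ "D _ _"])
  qed
  have z: "z + 0 *s axis i 1 = z" by simp
  have d0: "deriv g 0 = D z (axis i 1)" using DERIV_imp_deriv[OF g[of 0]] r by (simp add: z)
  have "((\<lambda>u. g u / (u - 0) ^ Suc 1) has_contour_integral ((2 * pi * \<i>) / fact 1 * (deriv ^^ 1) g 0)) (circlepath 0 r)"
  proof (rule Cauchy_has_contour_integral_higher_derivative_circlepath)
    show "continuous_on (cball 0 r) g"
      by (rule continuous_at_imp_continuous_on) (auto intro: DERIV_isCont[OF g])
    show "g holomorphic_on ball 0 r"
      unfolding holomorphic_on_open[OF open_ball] using g by (force simp: dist_norm)
  qed (use r in simp)
  then have "((\<lambda>t. g (\<gamma> t) / (\<gamma> t) ^ 2 * vector_derivative \<gamma> (at t)) has_integral (2 * pi * \<i>) * D z (axis i 1)) {0..1}"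
    unfolding has_contour_integral \<gamma>_def[symmetric] by (simp add: d0 power2_eq_square)
  then have "((\<lambda>t. (1 / (2 * pi * \<i>)) * (g (\<gamma> t) / (\<gamma> t) ^ 2 * vector_derivative \<gamma> (at t))) has_integral
      (1 / (2 * pi * \<i>)) * ((2 * pi * \<i>) * D z (axis i 1))) {0..1}"
    by (rule has_integral_mult_right)
  then have "integral {0..1} (\<lambda>t. (1 / (2 * pi * \<i>)) * (g (\<gamma> t) / (\<gamma> t) ^ 2 * vector_derivative \<gamma> (at t))) = D z (axis i 1)"
    by (simp add: integral_unique)
  then show ?thesis by (simp add: g_def cbox_interval field_simps)
qed

text \<open>In the Cauchy formula \<open>z\<close> enters only through \<open>f\<close>. So
  continuity of \<open>f\<close> gives continuity of the partial derivatives, and with these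
  continuous the integral can be differentiated in \<open>z\<close>; complex linearity passes
  through the integral.\<close>

lemma holomorphic_partial_derivative:
  fixes f :: "complex^'n::finite \<Rightarrow> complex"
  assumes S: "open S"
    and D: "\<And>x. x \<in> S \<Longrightarrow> (f has_derivative D x) (at x)" "\<And>x a v. x \<in> S \<Longrightarrow> D x (a *s v) = a * D x v"
  shows "continuous_on S (\<lambda>x. D x v)"
    and "x0 \<in> S \<Longrightarrow> \<exists>D'. ((\<lambda>x. D x (axis i 1)) has_derivative D') (at x0) \<and> (\<forall>a v. D' (a *s v) = a * D' v)"
proof -
  have contf: "continuous_on S f"
    using D(1) has_derivative_continuous continuous_at_imp_continuous_on by blast
  have lin: "linear (D x)" if "x \<in> S" for x
    using D(1)[OF that] has_derivative_bounded_linear bounded_linear.linear by blast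
  have local_formula: "\<exists>r>0. cball x (2 * r) \<subseteq> S \<and> (\<forall>z\<in>ball x r. \<forall>i.
      D z (axis i 1) = integral (cbox 0 1) (\<lambda>t. f (z + circlepath 0 r t *s axis i 1) *
     (vector_derivative (circlepath 0 r) (at t) / (circlepath 0 r t) ^ 2 / (2 * pi * \<i>))))
     \<and> (\<forall>z\<in>ball x r. \<forall>t i. z + circlepath 0 r t *s axis i 1 \<in> S)" if x: "x \<in> S" for x
  proof -
    obtain e where e: "e > 0" "cball x e \<subseteq> S" using S x open_contains_cball by blast
    \<comment> \<open>Half the radius, so that the circles of radius \<open>r\<close> around all
      points of \<open>ball x r\<close> stay in \<open>S\<close>.\<close>
    define r where "r = e / 2"
    have r: "r > 0" "cball x (2 * r) \<subseteq> S" using e by (auto simp: r_def)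
    have m: "z + \<zeta> *s axis i 1 \<in> S" if "z \<in> ball x r" "norm \<zeta> \<le> r" for z \<zeta> i
    proof -
      have "norm (\<zeta> *s axis i 1 :: complex^'n) = norm \<zeta>"
        by (simp add: norm_vec_def L2_set_def axis_def norm_mult power_mult_distrib if_distrib[of norm]
            if_distrib[of "\<lambda>x. x\<^sup>2"] if_distrib[of "\<lambda>x. _ * x"] cong: if_cong)
      then have "dist x (z + \<zeta> *s axis i 1) \<le> 2 * r"
        using that norm_triangle_ineq4[of "x - z" "\<zeta> *s axis i 1"] by (simp add: dist_norm algebra_simps)
      then show ?thesis using r by auto
    qed
    have "norm (circlepath 0 r t) \<le> r" for t using r(1) by (simp add: circlepath norm_mult)
    then show ?thesis using r m Cauchy_partial_derivative[OF r(1) S _ D] by (intro exI[of _ r]) blast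
  qed
  define \<kappa> where "\<kappa> r t = vector_derivative (circlepath 0 r) (at t) / (circlepath 0 r t) ^ 2 / (2 * pi * \<i>)" for r t :: real
  have cont_\<kappa>: "continuous_on A (\<lambda>z. \<kappa> r (h z))" if "r > 0" "continuous_on A h" for r A and h :: "'x::topological_space \<Rightarrow> real"
    unfolding \<kappa>_def vector_derivative_circlepath unfolding circlepath using that by (intro continuous_intros) auto
  have cont_shift: "continuous_on (U \<times> cbox 0 1) (\<lambda>(z, t). z + circlepath 0 r t *s axis i 1)"
    for U and r :: real and i :: 'n
    unfolding circlepath split_beta
    by (intro continuous_intros bounded_linear.continuous_on[OF bounded_linear_vector_scalar_mult_left])
  have cont1: "continuous_on S (\<lambda>x. D x (axis i 1))" for i
  proof (rule continuous_at_imp_continuous_on, rule ballI)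
    fix x assume "x \<in> S"
    from local_formula[OF this] obtain r where r: "r > 0"
      and eq: "\<And>z. z \<in> ball x r \<Longrightarrow> D z (axis i 1) = integral (cbox 0 1) (\<lambda>t. f (z + circlepath 0 r t *s axis i 1) * \<kappa> r t)"
      and m: "\<And>z t i. z \<in> ball x r \<Longrightarrow> z + circlepath 0 r t *s axis i 1 \<in> S"
      unfolding \<kappa>_def by blast
    have "continuous_on (ball x r \<times> cbox 0 1) (\<lambda>(z, t). f (z + circlepath 0 r t *s axis i 1) * \<kappa> r t)"
      unfolding split_beta
      by (intro continuous_intros cont_\<kappa>[OF r] continuous_on_compose2[OF contf] cont_shift[unfolded split_beta])
         (use m in auto)
    then have "continuous_on (ball x r) (\<lambda>z. integral (cbox 0 1) (\<lambda>t. f (z + circlepath 0 r t *s axis i 1) * \<kappa> r t))"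
      by (rule integral_continuous_on_param)
    then have "continuous_on (ball x r) (\<lambda>z. D z (axis i 1))"
      by (rule continuous_on_eq) (simp add: eq)
    then show "isCont (\<lambda>x. D x (axis i 1)) x" using r by (simp add: continuous_on_eq_continuous_at)
  qed
  have expand: "D x v = (\<Sum>i\<in>UNIV. v $ i * D x (axis i 1))" if "x \<in> S" for x v
    by (rule complex_linear_expand[OF lin[OF that] D(2)[OF that]])
  show contD: "continuous_on S (\<lambda>x. D x v)" for v
  proof -
    have "continuous_on S (\<lambda>x. \<Sum>i\<in>UNIV. v $ i * D x (axis i 1))" by (intro continuous_intros cont1)
    then show ?thesis by (rule continuous_on_eq) (simp add: expand)
  qed
  show "\<exists>D'. ((\<lambda>x. D x (axis i 1)) has_derivative D') (at x0) \<and> (\<forall>a v. D' (a *s v) = a * D' v)" if x0: "x0 \<in> S"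
  proof -
    from local_formula[OF x0] obtain r where r: "r > 0"
      and eq: "\<And>z. z \<in> ball x0 r \<Longrightarrow> D z (axis i 1) = integral (cbox 0 1) (\<lambda>t. f (z + circlepath 0 r t *s axis i 1) * \<kappa> r t)"
      and m: "\<And>z t i. z \<in> ball x0 r \<Longrightarrow> z + circlepath 0 r t *s axis i 1 \<in> S"
      unfolding \<kappa>_def by blast
    let ?c = "\<lambda>t. circlepath 0 r t *s axis i 1 :: complex^'n"
    define F where "F z t = Blinfun (\<lambda>v. D (z + ?c t) v * \<kappa> r t)" for z t
    have F: "blinfun_apply (F z t) = (\<lambda>v. D (z + ?c t) v * \<kappa> r t)" if "z \<in> ball x0 r" for z t
      unfolding F_def
      by (rule bounded_linear_Blinfun_apply)
         (intro bounded_linear_mult_const has_derivative_bounded_linear[OF D(1)] m that)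
    have contF: "continuous_on (ball x0 r \<times> cbox 0 1) (\<lambda>(z, t). F z t)"
      unfolding split_beta
    proof (rule continuous_on_blinfun_componentwise)
      fix v :: "complex^'n"
      have "continuous_on (ball x0 r \<times> cbox 0 1) (\<lambda>p. D (fst p + ?c (snd p)) v * \<kappa> r (snd p))"
        by (intro continuous_intros cont_\<kappa>[OF r] continuous_on_compose2[OF contD] cont_shift[unfolded split_beta])
           (use m in auto)
      then show "continuous_on (ball x0 r \<times> cbox 0 1) (\<lambda>p. blinfun_apply (F (fst p) (snd p)) v)"
        by (rule continuous_on_eq) (auto simp: F)
    qed
    have "((\<lambda>z. integral (cbox 0 1) (\<lambda>t. f (z + ?c t) * \<kappa> r t)) has_derivative
        integral (cbox 0 1) (F x0)) (at x0 within ball x0 r)"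
    proof (rule leibniz_rule[OF _ _ contF])
      fix z t assume z: "z \<in> ball x0 r"
      have "((\<lambda>z. z + ?c t) has_derivative (\<lambda>v. v)) (at z)" by (auto intro!: derivative_eq_intros)
      from has_derivative_compose[OF this D(1)[OF m[OF z]]]
      have "((\<lambda>z. f (z + ?c t) * \<kappa> r t) has_derivative (\<lambda>v. D (z + ?c t) v * \<kappa> r t)) (at z)"
        by (intro has_derivative_mult_left)
      then show "((\<lambda>z. f (z + ?c t) * \<kappa> r t) has_derivative blinfun_apply (F z t)) (at z within ball x0 r)"
        unfolding F[OF z] by (rule has_derivative_at_withinI)
    next
      fix z assume z: "z \<in> ball x0 r"
      show "(\<lambda>t. f (z + ?c t) * \<kappa> r t) integrable_on cbox 0 1"
      proof (rule integrable_continuous)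
        have c: "continuous_on (cbox 0 1) (\<lambda>t. z + ?c t)"
          unfolding circlepath
          by (intro continuous_intros bounded_linear.continuous_on[OF bounded_linear_vector_scalar_mult_left])
        show "continuous_on (cbox 0 1) (\<lambda>t. f (z + ?c t) * \<kappa> r t)"
          by (intro continuous_intros cont_\<kappa>[OF r] continuous_on_compose2[OF contf c]) (use m z in auto)
      qed
    qed (use r in auto)
    then have "((\<lambda>z. integral (cbox 0 1) (\<lambda>t. f (z + ?c t) * \<kappa> r t)) has_derivative
        integral (cbox 0 1) (F x0)) (at x0)"
      using r at_within_open[of x0 "ball x0 r"] by simp
    then have "((\<lambda>z. D z (axis i 1)) has_derivative integral (cbox 0 1) (F x0)) (at x0)"
      by (rule has_derivative_transform_within_open[OF _ open_ball[of x0 r]]) (use r eq in auto)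
    moreover have "integral (cbox 0 1) (F x0) (a *s v) = a * integral (cbox 0 1) (F x0) v" for a v
    proof -
      have x0r: "x0 \<in> ball x0 r" using r by simp
      have "continuous_on (cbox 0 1) (\<lambda>t::real. (x0, t))"
        by (rule continuous_on_Pair[OF continuous_on_const continuous_on_id])
      moreover have "(\<lambda>t. (x0, t)) ` cbox 0 1 \<subseteq> ball x0 r \<times> cbox (0::real) 1" using r by auto
      ultimately have "continuous_on (cbox 0 1) (F x0)"
        using continuous_on_compose2[OF contF, of "cbox 0 1" "\<lambda>t. (x0, t)"] by simp
      then have int: "F x0 integrable_on cbox 0 1" by (rule integrable_continuous)
      show ?thesis
        unfolding blinfun_apply_integral[OF int] F[OF x0r] D(2)[OF m[OF x0r]] mult.assoc by simp
    qed
    ultimately show ?thesis by blast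
  qed
qed

text \<open>Complex differentiability is inherited by the partial derivatives, so the hypothesis
  reproduces itself in the induction on \<open>k\<close>.\<close>

lemma Ck_on_holomorphic:
  fixes f :: "complex^'n::finite \<Rightarrow> complex"
  assumes S: "open S"
  shows "(\<And>x. x \<in> S \<Longrightarrow> \<exists>D. (f has_derivative D) (at x) \<and> (\<forall>a v. D (a *s v) = a * D v)) \<Longrightarrow> Ck_on k S f"
proof (induction k arbitrary: f)
  case 0
  then show ?case
    by (simp add: continuous_at_imp_continuous_on) (meson has_derivative_continuous continuous_at_imp_continuous_on)
next
  case (Suc k)
  then obtain D where D: "\<And>x. x \<in> S \<Longrightarrow> (f has_derivative D x) (at x)" "\<And>x a v. x \<in> S \<Longrightarrow> D x (a *s v) = a * D x v"
    by metis
  have lin: "linear (D x)" if "x \<in> S" for x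
    using D(1)[OF that] has_derivative_bounded_linear bounded_linear.linear by blast
  have part: "Ck_on k S (\<lambda>x. D x (axis i 1))" for i
    by (rule Suc.IH) (rule holomorphic_partial_derivative(2)[OF S D])
  have sum: "Ck_on k S (\<lambda>x. \<Sum>i\<in>I. v $ i * D x (axis i 1))" for v and I :: "'n set"
  proof (induction I rule: infinite_finite_induct)
    case (insert i I)
    then show ?case using Ck_on_add[OF Ck_on_mult[OF Ck_on_const[of k S "v $ i"] part[of i]] insert.IH] by simp
  qed (auto intro: Ck_on_const)
  have "Ck_on k S (\<lambda>x. D x v)" for v
    by (rule Ck_on_cong[OF sum[of v UNIV]])
       (simp add: complex_linear_expand[OF lin D(2), symmetric])
  moreover have "\<forall>x\<in>S. (f has_derivative D x) (at x within S)"
    using D(1) has_derivative_at_withinI by blast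
  ultimately show ?case by auto
qed

lemma Ck_on_snd: "Ck_on k S f \<Longrightarrow> Ck_on k (T \<times> S) (\<lambda>p. f (snd p))"
proof (induction k arbitrary: f)
  case 0
  then show ?case by (auto intro!: continuous_on_compose2[of S f] continuous_intros)
next
  case (Suc k)
  then obtain f' where f': "\<forall>x\<in>S. (f has_derivative f' x) (at x within S)" "\<forall>v. Ck_on k S (\<lambda>x. f' x v)"
    by auto
  have "((\<lambda>p. f (snd p)) has_derivative (\<lambda>v. f' (snd p) (snd v))) (at p within T \<times> S)" if "p \<in> T \<times> S" for p
  proof (rule has_derivative_in_compose[of snd snd p "T \<times> S" f "f' (snd p)"])
    show "(snd has_derivative snd) (at p within T \<times> S)" by (auto intro!: derivative_eq_intros)
    have "snd ` (T \<times> S) \<subseteq> S" by auto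
    then show "(f has_derivative f' (snd p)) (at (snd p) within snd ` (T \<times> S))"
      using f'(1) that has_derivative_subset by (metis SigmaE snd_conv)
  qed
  then show ?case using f'(2) Suc.IH by (auto intro!: exI[of _ "\<lambda>p v. f' (snd p) (snd v)"])
qed

section \<open>Invariance of the jet form under holomorphic coordinate changes\<close>

context chart_domain
begin

lemma wd_restrict:
  assumes S: "open S" "S \<subseteq> V" and p: "p \<in> T \<times> S"
  shows "chart_domain.wd T S s i f p = wd s i f p"
proof -
  interpret S: chart_domain T S by unfold_locales (rule S)
  have "p \<in> T \<times> V" using S p by auto
  then show ?thesis using p by (simp add: wd_def ddx_def S.wd_def S.ddx_def)
qed

text \<open>A product rule that only needs derivatives at the point; it serves for compositions with
  the coordinate change, whose joint smoothness is never established.\<close>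

lemma wd_sum_mult_at:
  assumes t: "t \<in> T" and x: "x \<in> V"
    and f: "\<And>c. c \<in> I \<Longrightarrow> ((\<lambda>y. f c (t, y)) has_derivative f' c) (at x)"
    and g: "\<And>c. c \<in> I \<Longrightarrow> ((\<lambda>y. g c (t, y)) has_derivative g' c) (at x)"
  shows "wd s i (\<lambda>p. \<Sum>c\<in>I. f c p * g c p) (t, x)
    = (\<Sum>c\<in>I. wd s i (f c) (t, x) * g c (t, x) + f c (t, x) * wd s i (g c) (t, x))"
proof -
  have "ddx v (\<lambda>p. \<Sum>c\<in>I. f c p * g c p) (t, x)
      = (\<Sum>c\<in>I. ddx v (f c) (t, x) * g c (t, x) + f c (t, x) * ddx v (g c) (t, x))" for v
  proof -
    have "((\<lambda>y. \<Sum>c\<in>I. f c (t, y) * g c (t, y)) has_derivative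
       (\<lambda>v. \<Sum>c\<in>I. f c (t, x) * g' c v + f' c v * g c (t, x))) (at x)"
      by (intro has_derivative_sum has_derivative_mult f g)
    from ddx_eqI[OF this t x] show ?thesis
      by (auto intro!: sum.cong simp: ddx_eqI[OF f t x] ddx_eqI[OF g t x])
  qed
  then show ?thesis
    by (simp only: wd_def sum_distrib_left sum.distrib[symmetric] sum_divide_distrib)
       (intro sum.cong refl, simp add: field_simps)
qed

text \<open>Complex linearity of \<open>D\<close> keeps the two types of derivatives from mixing in
  the chain rule.\<close>

lemma wd_holomorphic_comp:
  fixes \<phi> :: "complex^'n \<Rightarrow> complex^'n"
  assumes f: "smooth_on (T \<times> V) f" and S: "open S" and t: "t \<in> T" and x: "x \<in> S"
    and im: "\<phi> x \<in> V"
    and D: "(\<phi> has_derivative D) (at x)" "\<And>a v. D (a *s v) = a *s D v"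
  shows "((\<lambda>y. f (t, \<phi> y)) has_derivative (\<lambda>v. ddx (D v) f (t, \<phi> x))) (at x)"
    and "chart_domain.wd T S (-\<i>) i (\<lambda>q. f (fst q, \<phi> (snd q))) (t, x) = (\<Sum>a\<in>UNIV. D (axis i 1) $ a * dz a f (t, \<phi> x))"
    and "chart_domain.wd T S \<i> i (\<lambda>q. f (fst q, \<phi> (snd q))) (t, x) = (\<Sum>a\<in>UNIV. cnj (D (axis i 1) $ a) * dzb a f (t, \<phi> x))"
proof -
  interpret S: chart_domain T S by unfold_locales (rule S)
  show c: "((\<lambda>y. f (t, \<phi> y)) has_derivative (\<lambda>v. ddx (D v) f (t, \<phi> x))) (at x)"
    by (rule has_derivative_compose[OF D(1) smooth_slice_derivative[OF f t im]])
  have d: "S.ddx v (\<lambda>q. f (fst q, \<phi> (snd q))) (t, x) =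
     (\<Sum>a\<in>UNIV. D v $ a * dz a f (t, \<phi> x)) + (\<Sum>a\<in>UNIV. cnj (D v $ a) * dzb a f (t, \<phi> x))" for v
    using S.ddx_eqI[of "\<lambda>q. f (fst q, \<phi> (snd q))", OF _ t x] c
    by (simp add: ddx_eq_Xop[OF f] Xop_def)
  have "axis i \<i> = \<i> *s (axis i 1 :: complex^'n)" by (simp add: vec_eq_iff axis_def)
  then have i: "D (axis i \<i>) = \<i> *s D (axis i 1)" by (simp add: D(2))
  show "S.wd (-\<i>) i (\<lambda>q. f (fst q, \<phi> (snd q))) (t, x) = (\<Sum>a\<in>UNIV. D (axis i 1) $ a * dz a f (t, \<phi> x))"
    "S.wd \<i> i (\<lambda>q. f (fst q, \<phi> (snd q))) (t, x) = (\<Sum>a\<in>UNIV. cnj (D (axis i 1) $ a) * dzb a f (t, \<phi> x))"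
    unfolding S.wd_def d i by (simp_all add: sum_distrib_left sum_negf field_simps)
qed

lemma wd_bar_holomorphic:
  assumes D: "\<And>x. x \<in> V \<Longrightarrow> (f has_derivative D x) (at x)" "\<And>x a v. x \<in> V \<Longrightarrow> D x (a *s v) = a * D x v"
  shows "dzb i (\<lambda>p. f (snd p)) = (\<lambda>p. 0)"
proof
  fix p show "dzb i (\<lambda>p. f (snd p)) p = 0"
  proof (cases "p \<in> T \<times> V")
    case True
    then obtain t x where p: "p = (t, x)" "t \<in> T" "x \<in> V" by auto
    have "ddx v (\<lambda>p. f (snd p)) (t, x) = D x v" for v
      by (rule ddx_eqI[OF _ p(2,3)]) (use D(1) p in auto)
    moreover have "axis i \<i> = \<i> *s (axis i 1 :: complex^'n)" by (simp add: vec_eq_iff axis_def)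
    ultimately show ?thesis unfolding p(1) wd_def using D(2)[OF p(3), of \<i>] by simp
  qed (simp add: wd_outside)
qed

end

lemma (in hermitian_chart) hermitian_chart_restrict:
  assumes "open S" "S \<subseteq> V"
  shows "hermitian_chart T S G H"
proof -
  have sub: "T \<times> S \<subseteq> T \<times> V" using assms by auto
  show ?thesis
    by unfold_locales
       (use assms sub cnj_G cnj_H inverse1 inverse2 H_pos smooth_on_subset[OF smooth_G sub] smooth_on_subset[OF smooth_H sub] in auto)
qed

lemma (in hermitian_chart) Mform_restrict:
  assumes S: "open S" "S \<subseteq> V" and p: "p \<in> T \<times> S"
  shows "hermitian_chart.Mform T S H \<xi> u p = Mform \<xi> u p"
proof -
  interpret S: hermitian_chart T S G H by (rule hermitian_chart_restrict[OF S])
  have 1: "S.wd s i f p = wd s i f p" for s i f by (rule wd_restrict[OF S p])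
  have sub: "T \<times> S \<subseteq> T \<times> V" using S by auto
  have 2: "S.wd s i (S.wd r j (H k l)) p = wd s i (wd r j (H k l)) p" for s i r j k l
  proof -
    have "S.wd s i (S.wd r j (H k l)) = S.wd s i (wd r j (H k l))"
      by (rule S.wd_cong[OF _ S.smooth_wd[OF S.smooth_H]]) (rule wd_restrict[OF S])
    then show ?thesis by (simp add: 1)
  qed
  show ?thesis
    unfolding Mform_def S.Mform_def DK_DL_expand[OF smooth_H] S.DK_DL_expand[OF S.smooth_H] 2
    unfolding 1 ..
qed

text \<open>
  \<open>D y\<close> is the differential of the coordinate change \<open>\<phi>\<close> and \<open>K\<close> the inverse of its matrix at \<open>x\<close>.
  On the level of first-order operators, \<open>u\<close> is \<open>u'\<close> conjugated by the Jacobian, and the derivative of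
  the Jacobian only enters \<open>\<xi>\<close>.
\<close>

lemma Mform_transfer:
  fixes \<phi> :: "complex^'n::finite \<Rightarrow> complex^'n"
  assumes c: "hermitian_chart T S G H" and d: "hermitian_chart T V G' H'"
    and t: "t \<in> T" and x: "x \<in> S" and im: "\<And>y. y \<in> S \<Longrightarrow> \<phi> y \<in> V"
    and D: "\<And>y. y \<in> S \<Longrightarrow> (\<phi> has_derivative D y) (at y)" "\<And>y a v. y \<in> S \<Longrightarrow> D y (a *s v) = a *s D y v"
    and H: "\<And>s y a b. s \<in> T \<Longrightarrow> y \<in> S \<Longrightarrow> H' a b (s, \<phi> y) =
       (\<Sum>k\<in>UNIV. \<Sum>l\<in>UNIV. D y (axis k 1) $ a * cnj (D y (axis l 1) $ b) * H k l (s, y))"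
    and G: "\<And>i j. G i j (t, x) =
       (\<Sum>a\<in>UNIV. \<Sum>b\<in>UNIV. D x (axis i 1) $ a * cnj (D x (axis j 1) $ b) * G' a b (t, \<phi> x))"
    and K: "\<And>a c. (\<Sum>i\<in>UNIV. D x (axis i 1) $ a * K i c) = (if a = c then 1 else 0)"
  shows "\<exists>\<xi> u. hermitian_chart.Mform T S H \<xi> u (t, x) = hermitian_chart.Mform T V H' \<xi>' u' (t, \<phi> x) \<and>
    hermitian_chart.Iform G H u (t, x) = hermitian_chart.Iform G' H' u' (t, \<phi> x)"
proof -
  interpret c: hermitian_chart T S G H by (rule c)
  interpret d: hermitian_chart T V G' H' by (rule d)
  define J where "J a i = (\<lambda>p :: real \<times> (complex^'n). D (snd p) (axis i 1) $ a)" for a i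
  have comp: "((\<lambda>y. \<phi> y $ a) has_derivative (\<lambda>v. D y v $ a)) (at y)" if "y \<in> S" for y a
    using bounded_linear.has_derivative[OF bounded_linear_vec_nth D(1)[OF that]] .
  have J_part: "\<exists>D'. ((\<lambda>y. D y (axis i 1) $ a) has_derivative D') (at y) \<and> (\<forall>c v. D' (c *s v) = c * D' v)"
    if "y \<in> S" for y a i
    by (rule holomorphic_partial_derivative(2)[OF c.open_V comp _ that]) (simp_all add: D(2))
  have smJ: "c.sm (J a i)" for a i
    unfolding smooth_on_def J_def
    by (intro allI Ck_on_snd Ck_on_holomorphic[OF c.open_V] J_part)
  define DJ where "DJ a i y = (SOME D'. ((\<lambda>y. D y (axis i 1) $ a) has_derivative D') (at y) \<and>
      (\<forall>c v. D' (c *s v) = c * D' v))" for a i y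
  have DJ: "((\<lambda>y. D y (axis i 1) $ a) has_derivative DJ a i y) (at y)"
    "DJ a i y (c *s v) = c * DJ a i y v" if "y \<in> S" for a i y c v
    using someI_ex[OF J_part[OF that, of i a]] unfolding DJ_def[symmetric] by blast+
  \<comment> \<open>The Jacobian of a holomorphic map is holomorphic, so conjugate derivatives
    annihilate it, and dually for its conjugate.\<close>
  have Jb: "c.dzb j (J a i) = (\<lambda>p. 0)" for a i j
    unfolding J_def by (rule c.wd_bar_holomorphic[OF DJ])
  have cJ: "c.dz j (\<lambda>p. cnj (J a i p)) = (\<lambda>p. 0)" for a i j
    using c.wd_cnj[OF smJ[of a i], of "-\<i>" j] by (simp add: Jb)
  have slice_cJ: "((\<lambda>y. cnj (J a i (s, y))) has_derivative (\<lambda>v. c.ddx v (\<lambda>p. cnj (J a i p)) (s, y))) (at y)"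
    if "s \<in> T" "y \<in> S" for a i s y
    by (rule c.smooth_slice_derivative[OF smooth_on_cnj[OF smJ] that])
  let ?p = "(t, x)" and ?q = "(t, \<phi> x)"
  \<comment> \<open>The inverse metric of the target chart as a function of the source coordinates,
    here through the transformation law and in \<open>h'\<close> by composition.\<close>
  define h where "h a b = (\<lambda>p. \<Sum>k\<in>UNIV. \<Sum>l\<in>UNIV. J a k p * cnj (J b l p) * H k l p)" for a b
  define h' where "h' a b = (\<lambda>p. H' a b (fst p, \<phi> (snd p)))" for a b
  have hh: "h a b p = h' a b p" if "p \<in> T \<times> S" for a b p
    using that H by (auto simp: h_def h'_def J_def)
  have smh: "c.sm (h a b)" for a b
    unfolding h_def by (intro smooth_intros smJ c.smooth_H)
  have wh: "c.wd s i (h a b) = c.wd s i (h' a b)" for s i a b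
    by (rule c.wd_cong[OF hh smh])
  have d1: "c.dz i (h a b) ?p = (\<Sum>e\<in>UNIV. J e i ?p * d.dz e (H' a b) ?q)" for i a b
    unfolding wh h'_def J_def
    using d.wd_holomorphic_comp(2)[OF d.smooth_H c.open_V t x im[OF x] D(1)[OF x] D(2)[OF x]] by simp
  have d2: "c.dzb j (h a b) (s, y) = (\<Sum>e\<in>UNIV. cnj (J e j (s, y)) * d.dzb e (H' a b) (s, \<phi> y))" if "s \<in> T" "y \<in> S" for s y j a b
    unfolding wh h'_def J_def
    using d.wd_holomorphic_comp(3)[OF d.smooth_H c.open_V that im[OF that(2)] D(1)[OF that(2)] D(2)[OF that(2)]] by simp
  have d3: "c.dz i (c.dzb j (h a b)) ?p = (\<Sum>e\<in>UNIV. \<Sum>f\<in>UNIV. J e i ?p * cnj (J f j ?p) * d.dz e (d.dzb f (H' a b)) ?q)" for i j a b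
  proof -
    let ?g = "\<lambda>f p. d.dzb f (H' a b) (fst p, \<phi> (snd p))"
    have "c.dz i (c.dzb j (h a b)) = c.dz i (\<lambda>p. \<Sum>f\<in>UNIV. cnj (J f j p) * ?g f p)"
      by (rule c.wd_cong[OF _ c.smooth_wd[OF smh]]) (auto simp: d2)
    then have "c.dz i (c.dzb j (h a b)) ?p = (\<Sum>f\<in>UNIV. c.dz i (\<lambda>p. cnj (J f j p)) ?p * ?g f ?p + cnj (J f j ?p) * c.dz i (?g f) ?p)"
      using c.wd_sum_mult_at[OF t x slice_cJ[OF t x], of UNIV "\<lambda>f y. ?g f y"
          "\<lambda>f v. d.ddx (D x v) (d.dzb f (H' a b)) ?q" "-\<i>" i]
        d.wd_holomorphic_comp(1)[OF d.smooth_wd[OF d.smooth_H] c.open_V t x im[OF x] D(1)[OF x] D(2)[OF x]]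
      by simp
    also have "\<dots> = (\<Sum>f\<in>UNIV. cnj (J f j ?p) * (\<Sum>e\<in>UNIV. J e i ?p * d.dz e (d.dzb f (H' a b)) ?q))"
      using d.wd_holomorphic_comp(2)[OF d.smooth_wd[OF d.smooth_H] c.open_V t x im[OF x] D(1)[OF x] D(2)[OF x]]
      by (simp add: cJ[unfolded J_def] J_def)
    finally show ?thesis
      unfolding sum_distrib_left by (subst sum.swap) (simp add: algebra_simps)
  qed
  \<comment> \<open>Only the derivative index of \<open>u'\<close> is moved to the source chart; the
    index contracted with the metric follows in \<open>u\<close>.\<close>
  define u2 where "u2 i a = (\<Sum>c\<in>UNIV. u' c a * K i c)" for i a
  have u2: "(\<Sum>i\<in>UNIV. u2 i a * J e i ?p) = u' e a" for e a
  proof -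
    have "(\<Sum>i\<in>UNIV. u2 i a * J e i ?p) = (\<Sum>c\<in>UNIV. u' c a * (\<Sum>i\<in>UNIV. J e i ?p * K i c))"
      unfolding u2_def sum_distrib_left sum_distrib_right by (subst sum.swap) (simp add: algebra_simps)
    then show ?thesis by (simp add: J_def K if_distrib[of "\<lambda>z. _ * z"] cong: if_cong)
  qed
  \<comment> \<open>Moving the Jacobian out of the operators leaves its derivative along
    \<open>u2\<close> as a zeroth-order term.\<close>
  define \<xi> where "\<xi> k = (\<Sum>a\<in>UNIV. \<xi>' a * J a k ?p + (\<Sum>i\<in>UNIV. u2 i a * c.dz i (J a k) ?p))" for k
  define u where "u i k = (\<Sum>a\<in>UNIV. u2 i a * J a k ?p)" for i k
  have M1: "d.Mform \<xi>' u' ?q = (\<Sum>a\<in>UNIV. \<Sum>b\<in>UNIV. c.DK \<xi>' u2 a (c.DL \<xi>' u2 b (h a b)) ?p)"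
    unfolding d.Mform_def
  proof (intro sum.cong refl)
    fix a b
    have 0: "H' a b ?q = h a b ?p" using hh[of ?p] t x by (simp add: h'_def)
    have 1: "(\<Sum>f\<in>UNIV. \<xi>' a * cnj (u' f b) * d.dzb f (H' a b) ?q) = (\<Sum>j\<in>UNIV. \<xi>' a * cnj (u2 j b) * c.dzb j (h a b) ?p)"
      unfolding d2[OF t x] u2[symmetric] cnj_sum sum_distrib_left sum_distrib_right
      by (subst sum.swap) (simp add: algebra_simps)
    have 2: "(\<Sum>e\<in>UNIV. u' e a * cnj (\<xi>' b) * d.dz e (H' a b) ?q) = (\<Sum>i\<in>UNIV. u2 i a * cnj (\<xi>' b) * c.dz i (h a b) ?p)"
      unfolding d1 u2[symmetric] sum_distrib_left sum_distrib_right
      by (subst sum.swap) (simp add: algebra_simps)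
    have 3: "(\<Sum>e\<in>UNIV. \<Sum>f\<in>UNIV. u' e a * cnj (u' f b) * d.dz e (d.dzb f (H' a b)) ?q)
       = (\<Sum>i\<in>UNIV. \<Sum>j\<in>UNIV. u2 i a * cnj (u2 j b) * c.dz i (c.dzb j (h a b)) ?p)"
      unfolding d3 u2[symmetric] cnj_sum sum_product sum_distrib_left sum_distrib_right
      unfolding sum.cartesian_product UNIV_Times_UNIV
      by (rule sum.reindex_bij_witness[of _ "\<lambda>(i,j,e,f). (e,f,j,i)" "\<lambda>(e,f,j,i). (i,j,e,f)"]) (auto simp: algebra_simps)
    show "d.DK \<xi>' u' a (d.DL \<xi>' u' b (H' a b)) ?q = c.DK \<xi>' u2 a (c.DL \<xi>' u2 b (h a b)) ?p"
      unfolding d.DK_DL_expand[OF d.smooth_H] c.DK_DL_expand[OF smh] 0 1 2 3 ..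
  qed
  \<comment> \<open>The factor \<open>J a k\<close> is differentiated only by \<open>DK\<close> and
    its conjugate only by \<open>DL\<close>, so no cross terms arise and each factor merges with its
    own operator.\<close>
  have M2: "c.DK \<xi>' u2 a (c.DL \<xi>' u2 b (h a b)) ?p = (\<Sum>k\<in>UNIV. \<Sum>l\<in>UNIV.
      c.DK (\<lambda>k. \<xi>' a * J a k ?p + (\<Sum>i\<in>UNIV. u2 i a * c.dz i (J a k) ?p)) (\<lambda>i k. u2 i a * J a k ?p) k
        (c.DL (\<lambda>l. \<xi>' b * J b l ?p + (\<Sum>i\<in>UNIV. u2 i b * c.dz i (J b l) ?p)) (\<lambda>i l. u2 i b * J b l ?p) l (H k l)) ?p)" for a b
  proof -
    have L: "c.DL \<xi>' u2 b (h a b) = (\<lambda>p. \<Sum>k\<in>UNIV. \<Sum>l\<in>UNIV. J a k p *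
        (cnj (J b l p) * c.DL \<xi>' u2 b (H k l) p + c.XL u2 b (\<lambda>p. cnj (J b l p)) p * H k l p))"
    proof -
      have XJ: "c.XL u2 b (J a k) = (\<lambda>p. 0)" for k by (simp add: c.XL_def' Jb)
      have "c.DL \<xi>' u2 b (h a b) = (\<lambda>p. \<Sum>k\<in>UNIV. \<Sum>l\<in>UNIV. c.DL \<xi>' u2 b (\<lambda>p. J a k p * (cnj (J b l p) * H k l p)) p)"
        unfolding h_def c.DL_def by (simp add: c.Dop_sum smooth_intros smJ c.smooth_H mult.assoc)
      also have "\<dots> = (\<lambda>p. \<Sum>k\<in>UNIV. \<Sum>l\<in>UNIV. c.XL u2 b (J a k) p * (cnj (J b l p) * H k l p) + J a k p *
        (c.XL u2 b (\<lambda>p. cnj (J b l p)) p * H k l p + cnj (J b l p) * c.DL \<xi>' u2 b (H k l) p))"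
        unfolding c.DL_def c.XL_def by (simp add: c.Dop_mult2 smooth_intros smJ c.smooth_H)
      finally show ?thesis by (simp add: XJ add.commute)
    qed
    have XcJ: "c.dz i (c.XL u2 b (\<lambda>p. cnj (J b l p))) = (\<lambda>p. 0)" for i l
      by (simp add: c.wd_XL smooth_intros smJ cJ) (simp add: c.XL_def' c.wd_const)
    have XKcJ: "c.XK u2 a (\<lambda>p. cnj (J b l p)) = (\<lambda>p. 0)" for l by (simp add: c.XK_def' cJ)
    have XKX: "c.XK u2 a (c.XL u2 b (\<lambda>p. cnj (J b l p))) = (\<lambda>p. 0)" for l by (simp add: c.XK_def' XcJ)
    have "c.DK \<xi>' u2 a (c.DL \<xi>' u2 b (h a b)) = (\<lambda>p. \<Sum>k\<in>UNIV. \<Sum>l\<in>UNIV. c.DK \<xi>' u2 a (\<lambda>p. J a k p *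
        (cnj (J b l p) * c.DL \<xi>' u2 b (H k l) p + c.XL u2 b (\<lambda>p. cnj (J b l p)) p * H k l p)) p)"
      unfolding L c.DK_def by (simp add: c.Dop_sum smooth_intros smJ c.smooth_DL c.smooth_XL c.smooth_H)
    also have "\<dots> = (\<lambda>p. \<Sum>k\<in>UNIV. \<Sum>l\<in>UNIV. c.XK u2 a (J a k) p *
          (cnj (J b l p) * c.DL \<xi>' u2 b (H k l) p + c.XL u2 b (\<lambda>p. cnj (J b l p)) p * H k l p)
        + J a k p * ((c.XK u2 a (\<lambda>p. cnj (J b l p)) p * c.DL \<xi>' u2 b (H k l) p + cnj (J b l p) * c.DK \<xi>' u2 a (c.DL \<xi>' u2 b (H k l)) p)
        + (c.XK u2 a (c.XL u2 b (\<lambda>p. cnj (J b l p))) p * H k l p + c.XL u2 b (\<lambda>p. cnj (J b l p)) p * c.DK \<xi>' u2 a (H k l) p)))"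
      unfolding c.DK_def c.XK_def
      by (simp add: c.Dop_mult2 c.Dop_add smooth_intros smJ c.smooth_DL c.smooth_XL c.smooth_H)
    finally have e: "c.DK \<xi>' u2 a (c.DL \<xi>' u2 b (h a b)) ?p = (\<Sum>k\<in>UNIV. \<Sum>l\<in>UNIV. c.XK u2 a (J a k) ?p *
          (cnj (J b l ?p) * c.DL \<xi>' u2 b (H k l) ?p + c.XL u2 b (\<lambda>p. cnj (J b l p)) ?p * H k l ?p)
        + J a k ?p * (cnj (J b l ?p) * c.DK \<xi>' u2 a (c.DL \<xi>' u2 b (H k l)) ?p
          + c.XL u2 b (\<lambda>p. cnj (J b l p)) ?p * c.DK \<xi>' u2 a (H k l) ?p))"
      by (simp add: XKcJ XKX)
    have XLc: "c.XL u2 b (\<lambda>p. cnj (J b l p)) ?p = cnj (\<Sum>i\<in>UNIV. u2 i b * c.dz i (J b l) ?p)" for l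
      by (simp add: c.XL_def' c.cnj_wd smJ)
    have XKc: "c.XK u2 a (J a k) ?p = (\<Sum>i\<in>UNIV. u2 i a * c.dz i (J a k) ?p)" for k
      by (simp add: c.XK_def')
    show ?thesis
      unfolding e XLc XKc
    proof (intro sum.cong refl)
      fix k l
      define X where "X = (\<Sum>i\<in>UNIV. u2 i a * c.dz i (J a k) ?p)"
      define Y where "Y = (\<Sum>i\<in>UNIV. u2 i b * c.dz i (J b l) ?p)"
      show "(\<Sum>i\<in>UNIV. u2 i a * c.dz i (J a k) ?p) *
          (cnj (J b l ?p) * c.DL \<xi>' u2 b (H k l) ?p + cnj (\<Sum>i\<in>UNIV. u2 i b * c.dz i (J b l) ?p) * H k l ?p)
        + J a k ?p * (cnj (J b l ?p) * c.DK \<xi>' u2 a (c.DL \<xi>' u2 b (H k l)) ?p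
          + cnj (\<Sum>i\<in>UNIV. u2 i b * c.dz i (J b l) ?p) * c.DK \<xi>' u2 a (H k l) ?p) =
       c.DK (\<lambda>k. \<xi>' a * J a k ?p + (\<Sum>i\<in>UNIV. u2 i a * c.dz i (J a k) ?p)) (\<lambda>i k. u2 i a * J a k ?p) k
        (c.DL (\<lambda>l. \<xi>' b * J b l ?p + (\<Sum>i\<in>UNIV. u2 i b * c.dz i (J b l) ?p)) (\<lambda>i l. u2 i b * J b l ?p) l (H k l)) ?p"
        unfolding c.DK_DL_expand[OF c.smooth_H] X_def[symmetric] Y_def[symmetric]
        unfolding c.DK_def' c.DL_def'
        by (simp add: algebra_simps sum_distrib_left sum.distrib)
    qed
  qed
  have M3: "c.Mform \<xi> u ?p = (\<Sum>a\<in>UNIV. \<Sum>b\<in>UNIV. c.DK \<xi>' u2 a (c.DL \<xi>' u2 b (h a b)) ?p)"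
  proof -
    define \<xi>A where "\<xi>A a k = \<xi>' a * J a k ?p + (\<Sum>i\<in>UNIV. u2 i a * c.dz i (J a k) ?p)" for a k
    have lin: "c.DK \<xi> u k (c.DL \<xi> u l (H k l)) ?p = (\<Sum>a\<in>UNIV. \<Sum>b\<in>UNIV.
       c.DK (\<xi>A a) (\<lambda>i k. u2 i a * J a k ?p) k (c.DL (\<xi>A b) (\<lambda>i l. u2 i b * J b l ?p) l (H k l)) ?p)" for k l
    proof -
      have \<xi>: "\<xi> k = (\<Sum>a\<in>UNIV. \<xi>A a k)" for k by (simp add: \<xi>_def \<xi>A_def)
      have 0: "\<xi> k * cnj (\<xi> l) * w = (\<Sum>a\<in>UNIV. \<Sum>b\<in>UNIV. \<xi>A a k * cnj (\<xi>A b l) * w)" for w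
        unfolding \<xi> cnj_sum sum_product by (simp only: sum_distrib_right)
      have 1: "(\<Sum>j\<in>UNIV. \<xi> k * cnj (u j l) * w j) = (\<Sum>a\<in>UNIV. \<Sum>b\<in>UNIV. \<Sum>j\<in>UNIV. \<xi>A a k * cnj (u2 j b * J b l ?p) * w j)" for w
        unfolding \<xi> u_def cnj_sum sum_product
        unfolding sum_distrib_right unfolding sum.cartesian_product UNIV_Times_UNIV
        by (rule sum.reindex_bij_witness[of _ "\<lambda>(a,b,j). (j,a,b)" "\<lambda>(j,a,b). (a,b,j)"]) auto
      have 2: "(\<Sum>i\<in>UNIV. u i k * cnj (\<xi> l) * w i) = (\<Sum>a\<in>UNIV. \<Sum>b\<in>UNIV. \<Sum>i\<in>UNIV. u2 i a * J a k ?p * cnj (\<xi>A b l) * w i)" for w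
        unfolding \<xi> u_def cnj_sum sum_product
        unfolding sum_distrib_right unfolding sum.cartesian_product UNIV_Times_UNIV
        by (rule sum.reindex_bij_witness[of _ "\<lambda>(a,b,j). (j,a,b)" "\<lambda>(j,a,b). (a,b,j)"]) auto
      have 3: "(\<Sum>i\<in>UNIV. \<Sum>j\<in>UNIV. u i k * cnj (u j l) * w i j) = (\<Sum>a\<in>UNIV. \<Sum>b\<in>UNIV. \<Sum>i\<in>UNIV. \<Sum>j\<in>UNIV.
          u2 i a * J a k ?p * cnj (u2 j b * J b l ?p) * w i j)" for w
        unfolding u_def cnj_sum sum_product
        unfolding sum_distrib_right unfolding sum.cartesian_product UNIV_Times_UNIV
        by (rule sum.reindex_bij_witness[of _ "\<lambda>(a,b,i,j). (i,j,a,b)" "\<lambda>(i,j,a,b). (a,b,i,j)"]) auto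
      show ?thesis
        unfolding c.DK_DL_expand[OF c.smooth_H] 0 1 2 3 by (simp only: sum.distrib)
    qed
    show ?thesis
      unfolding c.Mform_def lin M2 \<xi>A_def
      unfolding sum.cartesian_product UNIV_Times_UNIV
      by (rule sum.reindex_bij_witness[of _ "\<lambda>(a,b,k,l). (k,l,a,b)" "\<lambda>(k,l,a,b). (a,b,k,l)"]) auto
  qed
  have "c.Iform u ?p = d.Iform u' ?q"
  proof -
    have H0: "H' a b ?q = (\<Sum>k\<in>UNIV. \<Sum>l\<in>UNIV. J a k ?p * cnj (J b l ?p) * H k l ?p)" for a b
      using H[OF t x] by (simp add: J_def)
    have G0: "G i j ?p = (\<Sum>e\<in>UNIV. \<Sum>f\<in>UNIV. J e i ?p * cnj (J f j ?p) * G' e f ?q)" for i j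
      using G by (simp add: J_def)
    have "d.Iform u' ?q = (\<Sum>k\<in>UNIV. \<Sum>l\<in>UNIV. \<Sum>a\<in>UNIV. \<Sum>b\<in>UNIV. \<Sum>e\<in>UNIV. \<Sum>f\<in>UNIV. \<Sum>i\<in>UNIV. \<Sum>j\<in>UNIV.
        J a k ?p * cnj (J b l ?p) * H k l ?p * G' e f ?q * (u2 i a * J e i ?p) * cnj (u2 j b * J f j ?p))"
      unfolding d.Iform_def d.GH_def H0 u2[symmetric] cnj_sum sum_product sum_distrib_left sum_distrib_right
      unfolding sum.cartesian_product UNIV_Times_UNIV
      by (rule sum.reindex_bij_witness[of _ "\<lambda>(k,l,a,b,e,f,i,j). (a,b,e,f,j,i,k,l)" "\<lambda>(a,b,e,f,j,i,k,l). (k,l,a,b,e,f,i,j)"])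
         (auto simp: algebra_simps)
    also have "\<dots> = c.Iform u ?p"
      unfolding c.Iform_def c.GH_def G0 u_def cnj_sum sum_product sum_distrib_left sum_distrib_right
      unfolding sum.cartesian_product UNIV_Times_UNIV
      by (rule sum.reindex_bij_witness[of _ "\<lambda>(k,l,i,j,b,a,e,f). (k,l,a,b,e,f,i,j)" "\<lambda>(k,l,a,b,e,f,i,j). (k,l,i,j,b,a,e,f)"])
         (auto simp: algebra_simps)
    finally show ?thesis ..
  qed
  then show ?thesis using M1 M3 by metis
qed

section \<open>Metrics in charts of a complex manifold\<close>

locale cmanifold =
  fixes M :: "'a topology" and A :: "('a, 'n::finite) chart set"
  assumes complex_manifold: "complex_manifold M A"
begin

definition cdom :: "('a, 'n) chart \<Rightarrow> (complex^'n) set" where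
  "cdom c = snd c ` fst c"

definition TD :: "('a, 'n) chart \<Rightarrow> ('a, 'n) chart \<Rightarrow> 'a \<Rightarrow> complex^'n \<Rightarrow> complex^'n" where
  "TD c d p = frechet_derivative (transition c d) (at (snd c p))"

lemma chart:
  assumes "c \<in> A"
  shows "openin M (fst c)" "open (cdom c)" "homeomorphic_map (subtopology M (fst c)) (top_of_set (cdom c)) (snd c)"
proof -
  have "is_chart M c" using complex_manifold assms unfolding complex_manifold_def by blast
  then show "openin M (fst c)" "open (cdom c)" "homeomorphic_map (subtopology M (fst c)) (top_of_set (cdom c)) (snd c)"
    by (simp_all add: is_chart_def case_prod_beta cdom_def)
qed

lemma topspace_chart: "c \<in> A \<Longrightarrow> topspace (subtopology M (fst c)) = fst c"
  by (simp add: openin_subset[OF chart(1)] inf_absorb2)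

lemma inj_chart: "c \<in> A \<Longrightarrow> inj_on (snd c) (fst c)"
  using homeomorphic_imp_injective_map[OF chart(3)] topspace_chart by auto

lemma chart_inv [simp]: "c \<in> A \<Longrightarrow> p \<in> fst c \<Longrightarrow> chart_inv c (snd c p) = p"
  unfolding chart_inv_def by (simp add: inj_chart)

lemma chart_inv_in: "x \<in> cdom c \<Longrightarrow> chart_inv c x \<in> fst c"
  and snd_chart_inv: "x \<in> cdom c \<Longrightarrow> snd c (chart_inv c x) = x"
  unfolding chart_inv_def cdom_def by (auto intro: inv_into_into f_inv_into_f)

lemma cdom_cases: "c \<in> A \<Longrightarrow> x \<in> cdom c \<Longrightarrow> (\<And>p. p \<in> fst c \<Longrightarrow> x = snd c p \<Longrightarrow> thesis) \<Longrightarrow> thesis"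
  unfolding cdom_def by auto

lemma in_topspace: "c \<in> A \<Longrightarrow> p \<in> fst c \<Longrightarrow> p \<in> topspace M"
  by (rule subsetD[OF openin_subset[OF chart(1)]])

lemma open_chart_image:
  assumes "c \<in> A" "openin M U" "U \<subseteq> fst c"
  shows "open (snd c ` U)"
proof -
  have "openin (subtopology M (fst c)) U"
    using assms by (simp add: openin_open_subtopology chart(1))
  then have "openin (top_of_set (cdom c)) (snd c ` U)"
    using homeomorphic_imp_open_map[OF chart(3)[OF assms(1)]] by (simp add: open_map_def)
  then show ?thesis using chart(2)[OF assms(1)] by (simp add: openin_open_eq)
qed

lemma open_overlap: "c \<in> A \<Longrightarrow> d \<in> A \<Longrightarrow> open (snd c ` (fst c \<inter> fst d))"
  by (intro open_chart_image openin_Int chart(1)) auto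

lemma transition: "c \<in> A \<Longrightarrow> p \<in> fst c \<Longrightarrow> transition c d (snd c p) = snd d p"
  by (simp add: transition_def)

lemma transition_derivative:
  assumes c: "c \<in> A" "d \<in> A" and p: "p \<in> fst c" "p \<in> fst d"
  shows "(transition c d has_derivative TD c d p) (at (snd c p))"
    and "TD c d p (a *s v) = a *s TD c d p v"
proof -
  have "holomorphic_map_on (snd c ` (fst c \<inter> fst d)) (transition c d)"
    using complex_manifold c unfolding complex_manifold_def by blast
  then obtain D where D: "(transition c d has_derivative D) (at (snd c p))" "\<And>a v. D (a *s v) = a *s D v"
    unfolding holomorphic_map_on_def using p by blast
  have "TD c d p = D" unfolding TD_def using frechet_derivative_at[OF D(1)] by simp
  then show "(transition c d has_derivative TD c d p) (at (snd c p))" "TD c d p (a *s v) = a *s TD c d p v"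
    using D by auto
qed

lemma TD_linear: "c \<in> A \<Longrightarrow> d \<in> A \<Longrightarrow> p \<in> fst c \<Longrightarrow> p \<in> fst d \<Longrightarrow> linear (TD c d p)"
  using transition_derivative(1) has_derivative_bounded_linear bounded_linear.linear by blast

lemma TD_cocycle:
  assumes "c \<in> A" "d \<in> A" "e \<in> A" and p: "p \<in> fst c" "p \<in> fst d" "p \<in> fst e"
  shows "TD d e p (TD c d p v) = TD c e p v"
proof -
  let ?U = "snd c ` (fst c \<inter> fst d)"
  have "((\<lambda>x. transition d e (transition c d x)) has_derivative (\<lambda>v. TD d e p (TD c d p v))) (at (snd c p))"
    by (rule has_derivative_compose[OF transition_derivative(1)])
       (use assms transition transition_derivative(1) in auto)
  then have "(transition c e has_derivative (\<lambda>v. TD d e p (TD c d p v))) (at (snd c p))"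
  proof (rule has_derivative_transform_within_open[OF _ open_overlap[OF assms(1,2)]])
    fix x assume "x \<in> ?U"
    then obtain q where "q \<in> fst c" "q \<in> fst d" "x = snd c q" by auto
    then show "transition d e (transition c d x) = transition c e x"
      using assms(1,2) by (simp add: transition)
  qed (use p in auto)
  then show ?thesis
    using has_derivative_unique[OF transition_derivative(1)[OF assms(1,3) p(1,3)]] by metis
qed

lemma TD_self:
  assumes "c \<in> A" "p \<in> fst c"
  shows "TD c c p v = v"
proof -
  have "(transition c c has_derivative (\<lambda>v. v)) (at (snd c p))"
  proof (rule has_derivative_transform_within_open[OF has_derivative_ident open_overlap[OF assms(1) assms(1)]])
    fix x assume "x \<in> snd c ` (fst c \<inter> fst c)"
    then obtain q where "q \<in> fst c" "x = snd c q" by blast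
    then show "x = transition c c x" using assms(1) by (simp add: transition)
  qed (use assms in blast)
  then show ?thesis
    using has_derivative_unique[OF transition_derivative(1)[OF assms(1) assms(1) assms(2) assms(2)]] by metis
qed

lemma tangent_of_eq: "tangent_of A c p v = (\<lambda>d. if d \<in> charts_at A p then TD c d p v else 0)"
  unfolding tangent_of_def TD_def ..

lemma tangent_of_in:
  assumes "c \<in> A" "p \<in> fst c"
  shows "tangent_of A c p v \<in> tangent_space A p"
  using assms unfolding tangent_space_def tangent_of_eq
  by (auto simp: TD_cocycle TD_def[symmetric] charts_at_def)

lemma tangent_of_linear:
  assumes "c \<in> A" "p \<in> fst c"
  shows "tangent_of A c p (r *\<^sub>R v + s *\<^sub>R w) = (\<lambda>d. r *\<^sub>R tangent_of A c p v d + s *\<^sub>R tangent_of A c p w d)"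
    and "tangent_of A c p (\<i> *s v) = complex_structure (tangent_of A c p v)"
proof -
  have "TD c d p (r *\<^sub>R v + s *\<^sub>R w) = r *\<^sub>R TD c d p v + s *\<^sub>R TD c d p w" if "d \<in> charts_at A p" for d
    using TD_linear[OF assms(1) _ assms(2)] that by (simp add: charts_at_def linear_add linear_scale)
  then show "tangent_of A c p (r *\<^sub>R v + s *\<^sub>R w) = (\<lambda>d. r *\<^sub>R tangent_of A c p v d + s *\<^sub>R tangent_of A c p w d)"
    by (auto simp: tangent_of_eq fun_eq_iff)
  have "TD c d p (\<i> *s v) = \<i> *s TD c d p v" if "d \<in> charts_at A p" for d
    using transition_derivative(2)[OF assms(1) _ assms(2)] that by (simp add: charts_at_def)
  then show "tangent_of A c p (\<i> *s v) = complex_structure (tangent_of A c p v)"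
    by (auto simp: tangent_of_eq fun_eq_iff complex_structure_def)
qed

lemma tangent_of_transition:
  assumes "c \<in> A" "d \<in> A" "p \<in> fst c" "p \<in> fst d"
  shows "tangent_of A d p (TD c d p v) = tangent_of A c p v"
  using assms by (auto simp: tangent_of_eq fun_eq_iff charts_at_def TD_cocycle)

lemma tangent_of_nonzero:
  assumes "c \<in> A" "p \<in> fst c" "v \<noteq> 0"
  shows "tangent_of A c p v \<noteq> (\<lambda>d. 0)"
proof
  assume "tangent_of A c p v = (\<lambda>d. 0)"
  then have "tangent_of A c p v c = 0" by simp
  then show False using assms by (simp add: tangent_of_eq charts_at_def TD_self)
qed

section \<open>The Hermitian form of a metric in a chart\<close>

text \<open>The sesquilinear form of which \<open>metric_comp\<close> is the matrix; invariance
  under the complex structure makes the terms of \<open>metric_comp\<close> equal in pairs, hence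
  the denominator 2 instead of 4.\<close>

definition sesq :: "('a, 'n) metric_field \<Rightarrow> ('a, 'n) chart \<Rightarrow> 'a \<Rightarrow> complex^'n \<Rightarrow> complex^'n \<Rightarrow> complex" where
  "sesq h c p v w = (of_real (h p (tangent_of A c p v) (tangent_of A c p w))
      + \<i> * of_real (h p (tangent_of A c p v) (tangent_of A c p (\<i> *s w)))) / 2"

context
  fixes h :: "('a, 'n) metric_field" and c :: "('a, 'n) chart" and p :: 'a
  assumes h: "hermitian_metric M A h" and c: "c \<in> A" and p: "p \<in> fst c"
begin

definition rform :: "complex^'n \<Rightarrow> complex^'n \<Rightarrow> real" where
  "rform v w = h p (tangent_of A c p v) (tangent_of A c p w)"

lemma rform_sym: "rform v w = rform w v"
  using h in_topspace[OF c p] tangent_of_in[OF c p]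
  unfolding rform_def hermitian_metric_def inner_product_on_def by blast

lemma rform_lin: "rform (r *\<^sub>R v + s *\<^sub>R v') w = r * rform v w + s * rform v' w"
  using h in_topspace[OF c p] tangent_of_in[OF c p]
  unfolding rform_def tangent_of_linear(1)[OF c p] hermitian_metric_def inner_product_on_def by blast

lemma rform_pos: "v \<noteq> 0 \<Longrightarrow> 0 < rform v v"
  using h in_topspace[OF c p] tangent_of_in[OF c p] tangent_of_nonzero[OF c p]
  unfolding rform_def hermitian_metric_def inner_product_on_def by blast

lemma rform_J: "rform (\<i> *s v) (\<i> *s w) = rform v w"
  using h in_topspace[OF c p] tangent_of_in[OF c p]
  unfolding rform_def tangent_of_linear(2)[OF c p] hermitian_metric_def by blast

lemma rform_add: "rform (v + v') w = rform v w + rform v' w"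
  and rform_scale: "rform (r *\<^sub>R v) w = r * rform v w"
  using rform_lin[of 1 v 1 v' w] rform_lin[of r v 0 v w] by simp_all

lemma rform_J_left: "rform (\<i> *s v) w = - rform v (\<i> *s w)"
proof -
  have "\<i> *s (\<i> *s v) = (-1) *\<^sub>R v" by (simp add: vec_eq_iff)
  then show ?thesis using rform_J[of "\<i> *s v" w] rform_scale[of "-1" v "\<i> *s w"] by simp
qed

lemma sesq_rform: "sesq h c p v w = (of_real (rform v w) + \<i> * of_real (rform v (\<i> *s w))) / 2"
  by (simp add: sesq_def rform_def)

lemma sesq_add_left: "sesq h c p (v + v') w = sesq h c p v w + sesq h c p v' w"
  by (simp add: sesq_rform rform_add algebra_simps add_divide_distrib)

lemma sesq_cnj: "cnj (sesq h c p v w) = sesq h c p w v"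
  using rform_J_left[of w v] rform_sym[of v "\<i> *s w"] rform_sym[of v w] by (simp add: sesq_rform)

lemma sesq_scale_left: "sesq h c p (a *s v) w = a * sesq h c p v w"
proof -
  have "a *s v = Re a *\<^sub>R v + Im a *\<^sub>R (\<i> *s v)"
    by (simp add: vec_eq_iff complex_eq_iff)
  then show ?thesis
    using rform_J_left[of v "\<i> *s w"] rform_J[of v w]
    by (simp add: sesq_rform rform_add rform_scale rform_J_left rform_J complex_eq_iff)
qed

lemma sesq_expand:
  "sesq h c p v w = (\<Sum>i\<in>UNIV. \<Sum>j\<in>UNIV. v $ i * cnj (w $ j) * sesq h c p (axis i 1) (axis j 1))"
proof -
  have left: "sesq h c p v w = (\<Sum>i\<in>UNIV. v $ i * sesq h c p (axis i 1) w)" for v w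
  proof (rule complex_linear_expand)
    show "linear (\<lambda>v. sesq h c p v w)"
    proof (rule linearI)
      fix r :: real and v :: "complex^'n"
      have "r *\<^sub>R v = (of_real r :: complex) *s v"
        by (rule vec_eq_iff[THEN iffD2], rule allI)
           (simp only: vector_scaleR_component vector_smult_component, simp only: scaleR_conv_of_real)
      then show "sesq h c p (r *\<^sub>R v) w = r *\<^sub>R sesq h c p v w"
        by (simp add: sesq_scale_left scaleR_conv_of_real)
    qed (rule sesq_add_left)
  qed (rule sesq_scale_left)
  have "sesq h c p (axis i 1) w = cnj (\<Sum>j\<in>UNIV. w $ j * sesq h c p (axis j 1) (axis i 1))" for i
    using left[of w "axis i 1"] sesq_cnj[of w "axis i 1"] by simp
  then have "sesq h c p (axis i 1) w = (\<Sum>j\<in>UNIV. cnj (w $ j) * sesq h c p (axis i 1) (axis j 1))" for i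
    by (simp add: sesq_cnj)
  then show ?thesis by (subst left) (simp add: sum_distrib_left algebra_simps)
qed

lemma sesq_pos: "v \<noteq> 0 \<Longrightarrow> 0 < Re (sesq h c p v v)"
  using rform_pos by (simp add: sesq_rform)

lemma metric_comp_sesq: "metric_comp A h c (snd c p) $ i $ j = sesq h c p (axis i 1) (axis j 1)"
proof -
  have ax: "axis k \<i> = \<i> *s (axis k 1 :: complex^'n)" for k by (simp add: vec_eq_iff axis_def)
  show ?thesis
    by (simp add: metric_comp_def Let_def chart_inv[OF c p] rform_def[symmetric] ax rform_J[of "axis i 1" "axis j 1"]
        rform_J_left[of "axis i 1" "axis j 1"] sesq_rform)
qed

lemma metric_comp_hermitian: "cnj (metric_comp A h c (snd c p) $ i $ j) = metric_comp A h c (snd c p) $ j $ i"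
  by (simp add: metric_comp_sesq sesq_cnj)

lemma metric_comp_pos:
  "v \<noteq> 0 \<Longrightarrow> 0 < Re (\<Sum>i\<in>UNIV. \<Sum>j\<in>UNIV. v $ i * cnj (v $ j) * metric_comp A h c (snd c p) $ i $ j)"
  using sesq_pos by (simp only: metric_comp_sesq sesq_expand[symmetric])

text \<open>A kernel vector would have length zero in the metric.\<close>

lemma metric_comp_invertible:
  "det (transpose (metric_comp A h c (snd c p))) \<noteq> 0"
proof -
  let ?G = "metric_comp A h c (snd c p)"
  have "x = 0" if "transpose ?G *v x = 0" for x
  proof (rule ccontr)
    assume "x \<noteq> 0"
    have "(\<Sum>i\<in>UNIV. \<Sum>j\<in>UNIV. x $ i * cnj (x $ j) * ?G $ i $ j) = (\<Sum>j\<in>UNIV. cnj (x $ j) * (transpose ?G *v x) $ j)"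
      by (subst sum.swap) (simp add: matrix_vector_mult_def transpose_def sum_distrib_left algebra_simps)
    then show False using metric_comp_pos[OF \<open>x \<noteq> 0\<close>] that by simp
  qed
  then have "\<exists>B. B ** transpose ?G = mat 1" by (simp add: matrix_left_invertible_ker)
  then have "invertible (transpose ?G)" by (simp add: invertible_left_inverse)
  then show ?thesis by (simp add: invertible_det_nz)
qed

end

lemma metric_comp_transition:
  assumes h: "hermitian_metric M A h" and c: "c \<in> A" "d \<in> A" and p: "p \<in> fst c" "p \<in> fst d"
  shows "metric_comp A h c (snd c p) $ i $ j = (\<Sum>a\<in>UNIV. \<Sum>b\<in>UNIV.
     TD c d p (axis i 1) $ a * cnj (TD c d p (axis j 1) $ b) * metric_comp A h d (snd d p) $ a $ b)"
proof -
  have "sesq h c p v w = sesq h d p (TD c d p v) (TD c d p w)" for v w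
    unfolding sesq_def transition_derivative(2)[OF c p, symmetric] by (simp add: tangent_of_transition[OF c p])
  then show ?thesis
    unfolding metric_comp_sesq[OF h c(1) p(1)] metric_comp_sesq[OF h c(2) p(2)]
    by (subst sesq_expand[OF h c(2) p(2), symmetric]) simp
qed

end

section \<open>Inverse matrices and the chart data of a solution\<close>

lemma matrix_inv_both:
  fixes B :: "complex^'n^'n::finite"
  assumes "det B \<noteq> 0"
  shows "B ** matrix_inv B = mat 1" "matrix_inv B ** B = mat 1"
proof -
  have "\<exists>C. B ** C = mat 1 \<and> C ** B = mat 1"
    using assms invertible_det_nz[of B] by (simp add: invertible_def)
  from someI_ex[OF this] show "B ** matrix_inv B = mat 1" "matrix_inv B ** B = mat 1"
    unfolding matrix_inv_def by blast+
qed

text \<open>By Cramer's rule the entries of the inverse are quotients of determinants, which are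
  polynomials in the entries.\<close>

lemma smooth_on_matrix_inv:
  fixes B :: "'x::real_normed_vector \<Rightarrow> complex^'n^'n::finite"
  assumes B: "\<And>i j. smooth_on S (\<lambda>p. B p $ i $ j)" and nz: "\<And>p. p \<in> S \<Longrightarrow> det (B p) \<noteq> 0"
  shows "smooth_on S (\<lambda>p. matrix_inv (B p) $ k $ l)"
proof -
  have det: "smooth_on S (\<lambda>p. det (C p))" if "\<And>i j. smooth_on S (\<lambda>p. C p $ i $ j)" for C :: "'x \<Rightarrow> complex^'n^'n"
    unfolding det_def by (intro smooth_intros that)
  let ?C = "\<lambda>p. (\<chi> i j. if j = k then (axis l 1 :: complex^'n) $ i else B p $ i $ j)"
  have "smooth_on S (\<lambda>p. det (?C p) * inverse (det (B p)))"
  proof (intro smooth_on_mult smooth_on_inverse det B nz)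
    show "smooth_on S (\<lambda>p. ?C p $ i $ j)" for i j
      by (cases "j = k") (simp_all add: smooth_on_const B)
  qed
  then show ?thesis
  proof (rule smooth_on_cong)
    fix p assume p: "p \<in> S"
    have "B p *v column l (matrix_inv (B p)) = axis l 1"
      using matrix_inv_both(1)[OF nz[OF p]]
      by (simp add: vec_eq_iff matrix_vector_mult_def matrix_matrix_mult_def column_def mat_def axis_def)
    then have "column l (matrix_inv (B p)) = (\<chi> k. det (\<chi> i j. if j = k then (axis l 1 :: complex^'n) $ i else B p $ i $ j) / det (B p))"
      using cramer[OF nz[OF p]] by blast
    then have "column l (matrix_inv (B p)) $ k = det (?C p) / det (B p)" by simp
    then show "det (?C p) * inverse (det (B p)) = matrix_inv (B p) $ k $ l"
      by (simp add: column_def divide_inverse)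
  qed
qed

locale hcf_manifold = cmanifold M A for M :: "'a topology" and A :: "('a, 'n::finite) chart set" +
  fixes \<tau> :: ereal and g :: "real \<Rightarrow> ('a, 'n) metric_field"
  assumes compact: "compact_space M" and hcf: "HCF_solution M A \<tau> g"
begin

abbreviation "TT \<equiv> time_domain \<tau>"

definition Gm :: "('a, 'n) chart \<Rightarrow> real \<Rightarrow> complex^'n \<Rightarrow> complex^'n^'n" where
  "Gm c t x = metric_comp A (g t) c x"

text \<open>Zero outside the domain, so that the hermitian symmetry required by
  \<open>hermitian_chart\<close> holds at every point; likewise for \<open>Hc\<close>.\<close>

definition Gc :: "('a, 'n) chart \<Rightarrow> 'n \<Rightarrow> 'n \<Rightarrow> real \<times> (complex^'n) \<Rightarrow> complex" where
  "Gc c i j p = (if p \<in> TT \<times> cdom c then Gm c (fst p) (snd p) $ i $ j else 0)"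

definition Hc :: "('a, 'n) chart \<Rightarrow> 'n \<Rightarrow> 'n \<Rightarrow> real \<times> (complex^'n) \<Rightarrow> complex" where
  "Hc c k l p = (if p \<in> TT \<times> cdom c then inv_comp (Gm c (fst p)) (snd p) k l else 0)"

lemma herm: "t \<in> TT \<Longrightarrow> hermitian_metric M A (g t)"
  using hcf by (simp add: HCF_solution_def smooth_hermitian_family_def)

lemma Gm_at: "c \<in> A \<Longrightarrow> x \<in> cdom c \<Longrightarrow> Gm c t x = metric_comp A (g t) c (snd c (chart_inv c x))"
  by (simp add: Gm_def snd_chart_inv)

lemma Gm_det: "c \<in> A \<Longrightarrow> t \<in> TT \<Longrightarrow> x \<in> cdom c \<Longrightarrow> det (transpose (Gm c t x)) \<noteq> 0"
  unfolding Gm_at by (rule metric_comp_invertible[OF herm _ chart_inv_in])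

lemma smooth_Gm:
  assumes c: "c \<in> A"
  shows "smooth_on (TT \<times> cdom c) (\<lambda>p. Gm c (fst p) (snd p) $ i $ j)"
proof -
  have s: "smooth_on (TT \<times> cdom c) (\<lambda>p. complex_of_real (g (fst p) (chart_inv c (snd p))
     (tangent_of A c (chart_inv c (snd p)) v) (tangent_of A c (chart_inv c (snd p)) w)))" for v w
  proof (rule smooth_on_of_real)
    have "smooth_on (TT \<times> cdom c) (\<lambda>(t, x). g t (chart_inv c x)
      (tangent_of A c (chart_inv c x) v) (tangent_of A c (chart_inv c x) w))"
      using hcf c unfolding HCF_solution_def smooth_hermitian_family_def cdom_def by blast
    then show "smooth_on (TT \<times> cdom c) (\<lambda>p. g (fst p) (chart_inv c (snd p))
      (tangent_of A c (chart_inv c (snd p)) v) (tangent_of A c (chart_inv c (snd p)) w))"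
      by (simp only: case_prod_beta')
  qed
  show ?thesis
    unfolding Gm_def metric_comp_def Let_def vec_lambda_beta divide_inverse by (intro smooth_intros s)
qed

lemma metric_chart: assumes c: "c \<in> A" shows "metric_chart TT (cdom c) (Gc c) (Hc c) (Gm c)"
proof -
  have Geq: "Gc c i j p = Gm c (fst p) (snd p) $ i $ j" if "p \<in> TT \<times> cdom c" for i j p using that by (simp add: Gc_def)
  have Heq: "Hc c k l p = matrix_inv (transpose (Gm c (fst p) (snd p))) $ k $ l" if "p \<in> TT \<times> cdom c" for k l p
    using that by (simp add: Hc_def inv_comp_def)
  have det: "det (transpose (Gm c (fst p) (snd p))) \<noteq> 0" if "p \<in> TT \<times> cdom c" for p
    using Gm_det[OF c] that by auto
  have Gh: "cnj (Gc c i j p) = Gc c j i p" for i j p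
    using metric_comp_hermitian[OF herm c chart_inv_in] by (auto simp: Gc_def Gm_at[OF c])
  have i1: "(\<Sum>l\<in>UNIV. Hc c k l p * Gc c m l p) = (if k = m then 1 else 0)" if "p \<in> TT \<times> cdom c" for k m p
    using matrix_inv_both(2)[OF det[OF that]]
    by (simp add: Heq[OF that] Geq[OF that] vec_eq_iff matrix_matrix_mult_def mat_def transpose_def)
  have i2: "(\<Sum>k\<in>UNIV. Hc c k l p * Gc c k m p) = (if l = m then 1 else 0)" if "p \<in> TT \<times> cdom c" for l m p
    using matrix_inv_both(1)[OF det[OF that]]
    by (simp add: Heq[OF that] Geq[OF that] vec_eq_iff matrix_matrix_mult_def mat_def transpose_def mult.commute)
  have Hh: "cnj (Hc c k l p) = Hc c l k p" for k l p
  proof (cases "p \<in> TT \<times> cdom c")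
    case True
    \<comment> \<open>The adjoint of \<open>Hc\<close> is again an inverse of \<open>Gc\<close>,
      hence equal to \<open>Hc\<close>.\<close>
    have c1: "(\<Sum>j\<in>UNIV. cnj (Hc c j l p) * Gc c m j p) = (if l = m then 1 else 0)" for m
      using arg_cong[OF i2[OF True, of l m], of cnj] by (simp add: Gh)
    have "cnj (Hc c k l p) = (\<Sum>j\<in>UNIV. cnj (Hc c j l p) * (\<Sum>m\<in>UNIV. Hc c m k p * Gc c m j p))"
      unfolding i2[OF True] by (simp add: if_distrib[of "\<lambda>z. _ * z"] cong: if_cong)
    also have "\<dots> = (\<Sum>m\<in>UNIV. (\<Sum>j\<in>UNIV. cnj (Hc c j l p) * Gc c m j p) * Hc c m k p)"
      unfolding sum_distrib_left sum_distrib_right by (subst sum.swap) (simp add: algebra_simps)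
    also have "\<dots> = Hc c l k p" unfolding c1 by (simp add: if_distrib[of "\<lambda>z. z * _"] cong: if_cong)
    finally show ?thesis .
  qed (simp_all add: Hc_def)
  have Hp: "0 < Re (\<Sum>k\<in>UNIV. \<Sum>l\<in>UNIV. Hc c k l p * w k * cnj (w l))"
    if p: "p \<in> TT \<times> cdom c" and w: "w \<noteq> (\<lambda>_. 0)" for p w
  proof -
    \<comment> \<open>Writing \<open>w\<close> as the metric applied to \<open>y\<close> turns the
      form of the inverse at \<open>w\<close> into that of the metric at the conjugate of
      \<open>y\<close>.\<close>
    define y where "y l = (\<Sum>k\<in>UNIV. Hc c k l p * w k)" for l
    have wy: "w m = (\<Sum>l\<in>UNIV. Gc c m l p * y l)" for m
    proof -
      have "(\<Sum>l\<in>UNIV. Gc c m l p * y l) = (\<Sum>k\<in>UNIV. (\<Sum>l\<in>UNIV. Hc c k l p * Gc c m l p) * w k)"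
        unfolding y_def sum_distrib_left sum_distrib_right by (subst sum.swap) (simp add: algebra_simps)
      then show ?thesis unfolding i1[OF p] by (simp add: if_distrib[of "\<lambda>z. z * _"] cong: if_cong)
    qed
    define v :: "complex^'n" where "v = (\<chi> n. cnj (y n))"
    have "v \<noteq> 0"
    proof
      assume "v = 0"
      then have "y n = 0" for n by (simp add: v_def vec_eq_iff)
      then have "w m = 0" for m unfolding wy[of m] by simp
      with w show False by auto
    qed
    have "(\<Sum>k\<in>UNIV. \<Sum>l\<in>UNIV. Hc c k l p * w k * cnj (w l)) = (\<Sum>l\<in>UNIV. y l * cnj (w l))"
      unfolding y_def sum_distrib_right by (rule sum.swap)
    also have "\<dots> = (\<Sum>l\<in>UNIV. \<Sum>n\<in>UNIV. v $ n * cnj (v $ l) * Gc c n l p)"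
      unfolding wy by (simp add: v_def Gh sum_distrib_left algebra_simps)
    also have "\<dots> = (\<Sum>n\<in>UNIV. \<Sum>l\<in>UNIV. v $ n * cnj (v $ l) * Gc c n l p)" by (rule sum.swap)
    finally show ?thesis
      using metric_comp_pos[OF herm c chart_inv_in \<open>v \<noteq> 0\<close>] p
      by (auto simp: Geq[OF p] Gm_at[OF c])
  qed
  show ?thesis
  proof unfold_locales
    show "open (cdom c)" by (rule chart(2)[OF c])
    show "smooth_on (TT \<times> cdom c) (Gc c i j)" for i j
      by (rule smooth_on_cong[OF smooth_Gm[OF c]]) (simp add: Geq)
    show "smooth_on (TT \<times> cdom c) (Hc c k l)" for k l
      by (rule smooth_on_cong[OF smooth_on_matrix_inv[of _ "\<lambda>p. transpose (Gm c (fst p) (snd p))"]])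
         (use smooth_Gm[OF c] det Heq in \<open>auto simp: transpose_def\<close>)
  qed (use Gh Hh i1 i2 Hp in \<open>auto simp: Gc_def Hc_def\<close>)
qed

end

section \<open>The maximum principle\<close>

lemma (in hermitian_chart) H_unique:
  assumes p: "p \<in> T \<times> V" and X: "\<And>m. (\<Sum>b\<in>UNIV. X b * G m b p) = (if a = m then 1 else 0)"
  shows "H a b p = X b"
proof -
  have "X b = (\<Sum>b'\<in>UNIV. X b' * (\<Sum>m\<in>UNIV. H m b p * G m b' p))"
    unfolding inverse2[OF p] by (simp add: if_distrib[of "\<lambda>z. _ * z"] cong: if_cong)
  also have "\<dots> = (\<Sum>m\<in>UNIV. (\<Sum>b'\<in>UNIV. X b' * G m b' p) * H m b p)"
    unfolding sum_distrib_left sum_distrib_right by (subst sum.swap) (simp add: algebra_simps)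
  also have "\<dots> = H a b p" unfolding X by (simp add: if_distrib[of "\<lambda>z. z * _"] cong: if_cong)
  finally show ?thesis ..
qed

context cmanifold
begin

lemma TD_inverse:
  assumes "c \<in> A" "d \<in> A" "p \<in> fst c" "p \<in> fst d"
  shows "(\<Sum>i\<in>UNIV. TD c d p (axis i 1) $ a * TD d c p (axis e 1) $ i) = (if a = e then 1 else 0)"
proof -
  have "linear (\<lambda>v. TD c d p v $ a)"
    using TD_linear[OF assms] by (simp add: linear_iff)
  from complex_linear_expand[OF this, of "TD d c p (axis e 1)"]
  have "TD c d p (TD d c p (axis e 1)) $ a = (\<Sum>i\<in>UNIV. TD d c p (axis e 1) $ i * TD c d p (axis i 1) $ a)"
    by (simp add: transition_derivative(2)[OF assms])
  then show ?thesis
    using assms by (simp add: TD_cocycle TD_self axis_def mult.commute)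
qed

text \<open>Two layers are needed: open chart domains for differentiation and compact sets inside
  them for minima. Compactness of \<open>M\<close> is applied to the cover by the interiors of the
  compact sets.\<close>

lemma finite_chart_cover:
  assumes "compact_space M"
  obtains F where "finite F" "\<And>c K. (c, K) \<in> F \<Longrightarrow> c \<in> A \<and> compact K \<and> K \<subseteq> cdom c"
    "\<And>p. p \<in> topspace M \<Longrightarrow> \<exists>(c, K)\<in>F. p \<in> fst c \<and> snd c p \<in> K"
proof -
  define F0 :: "(('a, 'n) chart \<times> (complex^'n) set) set" where "F0 = {(c, K). c \<in> A \<and> compact K \<and> K \<subseteq> cdom c}"
  define W where "W = (\<lambda>(c :: ('a, 'n) chart, K). {p \<in> fst c. snd c p \<in> interior K})"
  have "openin M (W f)" if f: "f \<in> F0" for f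
  proof -
    obtain c K where [simp]: "f = (c, K)" and c: "c \<in> A" "K \<subseteq> cdom c" using f by (auto simp: F0_def)
    have "openin (top_of_set (cdom c)) (interior K)"
      using c interior_subset by (simp add: openin_open_eq chart(2)) blast
    then have "openin (subtopology M (fst c)) {p \<in> topspace (subtopology M (fst c)). snd c p \<in> interior K}"
      by (rule openin_continuous_map_preimage[OF homeomorphic_imp_continuous_map[OF chart(3)[OF c(1)]]])
    then have "openin (subtopology M (fst c)) (W f)"
      unfolding topspace_chart[OF c(1)] by (simp add: W_def)
    then show ?thesis using chart(1)[OF c(1)] openin_trans_full by blast
  qed
  moreover have "topspace M \<subseteq> \<Union> (W ` F0)"
  proof
    fix p assume "p \<in> topspace M"
    then obtain c where c: "c \<in> A" "p \<in> fst c"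
      using complex_manifold unfolding complex_manifold_def by blast
    then have "snd c p \<in> cdom c" by (simp add: cdom_def)
    then obtain r where r: "r > 0" "cball (snd c p) r \<subseteq> cdom c"
      using chart(2)[OF c(1)] open_contains_cball by blast
    then have "(c, cball (snd c p) r) \<in> F0" "p \<in> W (c, cball (snd c p) r)"
      using c by (auto simp: F0_def W_def)
    then show "p \<in> \<Union> (W ` F0)" by blast
  qed
  ultimately obtain \<F> where \<F>: "finite \<F>" "\<F> \<subseteq> W ` F0" "topspace M \<subseteq> \<Union>\<F>"
    using assms unfolding compact_space_alt by (metis (no_types, lifting) imageE)
  then obtain F where F: "finite F" "F \<subseteq> F0" "\<F> = W ` F" by (meson finite_subset_image)
  show thesis
  proof (rule that[OF F(1)])
    show "c \<in> A \<and> compact K \<and> K \<subseteq> cdom c" if "(c, K) \<in> F" for c K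
      using that F(2) by (auto simp: F0_def)
    fix p assume "p \<in> topspace M"
    then obtain f where f: "f \<in> F" "p \<in> W f" using \<F>(3) F(3) by blast
    obtain c K where cK: "f = (c, K)" by (cases f)
    have "p \<in> fst c \<and> snd c p \<in> K"
      using f(2) interior_subset[of K] by (auto simp: W_def cK)
    then show "\<exists>(c, K)\<in>F. p \<in> fst c \<and> snd c p \<in> K"
      using f(1) cK by blast
  qed
qed

end

section \<open>Transfer of the forms between charts\<close>

context hcf_manifold
begin

definition Mform_at :: "('a, 'n) chart \<Rightarrow> ('n \<Rightarrow> complex) \<Rightarrow> ('n \<Rightarrow> 'n \<Rightarrow> complex) \<Rightarrow> real \<times> (complex^'n) \<Rightarrow> complex" where
  "Mform_at c = hermitian_chart.Mform TT (cdom c) (Hc c)"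

definition Iform_at :: "('a, 'n) chart \<Rightarrow> ('n \<Rightarrow> 'n \<Rightarrow> complex) \<Rightarrow> real \<times> (complex^'n) \<Rightarrow> complex" where
  "Iform_at c = hermitian_chart.Iform (Gc c) (Hc c)"

lemma hermitian_chart: "c \<in> A \<Longrightarrow> hermitian_chart TT (cdom c) (Gc c) (Hc c)"
  using metric_chart by (simp add: metric_chart_def)

lemma Icc_time_domain:
  assumes "ereal t < \<tau>"
  shows "{0..t} \<subseteq> TT"
proof
  fix s assume s: "s \<in> {0..t}"
  then have "ereal s \<le> ereal t" by simp
  then have "ereal s < \<tau>" using assms by (rule le_less_trans)
  then show "s \<in> TT" using s by (simp add: time_domain_def)
qed

lemma open_times:
  "open ({s. 0 < s} \<inter> ereal -` {..<\<tau>})" "{s. 0 < s} \<inter> ereal -` {..<\<tau>} \<subseteq> TT"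
  by (auto simp: time_domain_def open_Collect_less intro!: open_Int open_vimage continuous_on_ereal continuous_on_id)

lemma dual_Nakano_nonneg_iff:
  assumes t: "t \<in> TT"
  shows "dual_Nakano_nonneg A (g t) \<longleftrightarrow> (\<forall>c\<in>A. \<forall>x\<in>cdom c. \<forall>\<xi> u. 0 \<le> Re (Mform_at c \<xi> u (t, x)))"
  unfolding dual_Nakano_nonneg_def cdom_def[symmetric]
proof (intro ball_cong refl)
  fix c x assume c: "c \<in> A" and x: "x \<in> cdom c"
  interpret metric_chart TT "cdom c" "Gc c" "Hc c" "Gm c" by (rule metric_chart[OF c])
  have p: "(t, x) \<in> TT \<times> cdom c" using t x by simp
  have "(\<forall>u :: complex^'n^'n. (\<Sum>i\<in>UNIV. \<Sum>j\<in>UNIV. \<Sum>k\<in>UNIV. \<Sum>l\<in>UNIV.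
           curvature_up (metric_comp A (g t) c) x i j l k * u $ i $ k * cnj (u $ j $ l)) \<in> \<real>\<^sub>\<ge>\<^sub>0)
    \<longleftrightarrow> (\<forall>u :: complex^'n^'n. (\<Sum>i\<in>UNIV. \<Sum>j\<in>UNIV. \<Sum>k\<in>UNIV. \<Sum>l\<in>UNIV. curv (t, x) i j k l * u $ i $ k * cnj (u $ j $ l)) \<in> \<real>\<^sub>\<ge>\<^sub>0)"
    using curvature_up_eq[OF p] by (simp add: Gm_def[of c t, abs_def, symmetric])
  also have "\<dots> \<longleftrightarrow> (\<forall>u. (\<Sum>i\<in>UNIV. \<Sum>j\<in>UNIV. \<Sum>k\<in>UNIV. \<Sum>l\<in>UNIV. curv (t, x) i j k l * u i k * cnj (u j l)) \<in> \<real>\<^sub>\<ge>\<^sub>0)"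
  proof (intro iffI allI)
    fix u assume "\<forall>u :: complex^'n^'n. (\<Sum>i\<in>UNIV. \<Sum>j\<in>UNIV. \<Sum>k\<in>UNIV. \<Sum>l\<in>UNIV. curv (t, x) i j k l * u $ i $ k * cnj (u $ j $ l)) \<in> \<real>\<^sub>\<ge>\<^sub>0"
    from spec[OF this, of "\<chi> i k. u i k"]
    show "(\<Sum>i\<in>UNIV. \<Sum>j\<in>UNIV. \<Sum>k\<in>UNIV. \<Sum>l\<in>UNIV. curv (t, x) i j k l * u i k * cnj (u j l)) \<in> \<real>\<^sub>\<ge>\<^sub>0" by simp
  next
    fix u :: "complex^'n^'n"
    assume "\<forall>u. (\<Sum>i\<in>UNIV. \<Sum>j\<in>UNIV. \<Sum>k\<in>UNIV. \<Sum>l\<in>UNIV. curv (t, x) i j k l * u i k * cnj (u j l)) \<in> \<real>\<^sub>\<ge>\<^sub>0"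
    from spec[OF this, of "\<lambda>i k. u $ i $ k"]
    show "(\<Sum>i\<in>UNIV. \<Sum>j\<in>UNIV. \<Sum>k\<in>UNIV. \<Sum>l\<in>UNIV. curv (t, x) i j k l * u $ i $ k * cnj (u $ j $ l)) \<in> \<real>\<^sub>\<ge>\<^sub>0" .
  qed
  also have "\<dots> \<longleftrightarrow> (\<forall>\<xi> u. 0 \<le> Re (Mform_at c \<xi> u (t, x)))"
    unfolding Mform_at_def by (rule curv_nonneg_iff[OF p])
  finally show "(\<forall>u :: complex^'n^'n. (\<Sum>i\<in>UNIV. \<Sum>j\<in>UNIV. \<Sum>k\<in>UNIV. \<Sum>l\<in>UNIV.
           curvature_up (metric_comp A (g t) c) x i j l k * u $ i $ k * cnj (u $ j $ l)) \<in> \<real>\<^sub>\<ge>\<^sub>0)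
    \<longleftrightarrow> (\<forall>\<xi> u. 0 \<le> Re (Mform_at c \<xi> u (t, x)))" .
qed

lemma Gc_transition:
  assumes "c \<in> A" "d \<in> A" "p \<in> fst c" "p \<in> fst d" "t \<in> TT"
  shows "Gc c i j (t, snd c p) = (\<Sum>a\<in>UNIV. \<Sum>b\<in>UNIV.
     TD c d p (axis i 1) $ a * cnj (TD c d p (axis j 1) $ b) * Gc d a b (t, snd d p))"
  using metric_comp_transition[OF herm[OF assms(5)] assms(1-4)] assms
  by (simp add: Gc_def Gm_def cdom_def)

text \<open>By uniqueness of the inverse it suffices to multiply the transformed matrix with the
  metric of the other chart, where the Jacobians cancel.\<close>

lemma Hc_transition:
  assumes c: "c \<in> A" "d \<in> A" and p: "p \<in> fst c" "p \<in> fst d" and t: "t \<in> TT"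
  shows "Hc d a b (t, snd d p) = (\<Sum>k\<in>UNIV. \<Sum>l\<in>UNIV.
     TD c d p (axis k 1) $ a * cnj (TD c d p (axis l 1) $ b) * Hc c k l (t, snd c p))"
proof (rule hermitian_chart.H_unique[OF hermitian_chart[OF c(2)]])
  let ?J = "\<lambda>a k. TD c d p (axis k 1) $ a" and ?K = "\<lambda>k a. TD d c p (axis a 1) $ k"
  interpret c: hermitian_chart TT "cdom c" "Gc c" "Hc c" by (rule hermitian_chart[OF c(1)])
  show "(t, snd d p) \<in> TT \<times> cdom d" using t p by (simp add: cdom_def)
  have q: "(t, snd c p) \<in> TT \<times> cdom c" using t p by (simp add: cdom_def)
  fix m
  have "(\<Sum>b\<in>UNIV. (\<Sum>k\<in>UNIV. \<Sum>l\<in>UNIV. ?J a k * cnj (?J b l) * Hc c k l (t, snd c p)) * Gc d m b (t, snd d p))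
    = (\<Sum>k\<in>UNIV. \<Sum>l\<in>UNIV. \<Sum>i\<in>UNIV. \<Sum>j\<in>UNIV. ?J a k * Hc c k l (t, snd c p) * ?K i m * Gc c i j (t, snd c p)
        * cnj (\<Sum>b\<in>UNIV. ?K j b * ?J b l))"
    unfolding Gc_transition[OF c(2) c(1) p(2) p(1) t] cnj_sum sum_distrib_left sum_distrib_right
    unfolding sum.cartesian_product UNIV_Times_UNIV
    by (rule sum.reindex_bij_witness[of _ "\<lambda>(k,l,i,j,b). (b,i,j,k,l)" "\<lambda>(b,i,j,k,l). (k,l,i,j,b)"])
       (auto simp: algebra_simps)
  also have "\<dots> = (\<Sum>k\<in>UNIV. \<Sum>l\<in>UNIV. \<Sum>i\<in>UNIV. ?J a k * Hc c k l (t, snd c p) * ?K i m * Gc c i l (t, snd c p))"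
    unfolding TD_inverse[OF c(2) c(1) p(2) p(1)]
    by (simp add: if_distrib[of cnj] if_distrib[of "\<lambda>z. _ * z"] cong: if_cong)
  also have "\<dots> = (\<Sum>k\<in>UNIV. \<Sum>i\<in>UNIV. ?J a k * ?K i m * (\<Sum>l\<in>UNIV. Hc c k l (t, snd c p) * Gc c i l (t, snd c p)))"
    unfolding sum_distrib_left by (rule sum.cong[OF refl], subst sum.swap) (simp add: algebra_simps)
  also have "\<dots> = (if a = m then 1 else 0)"
    unfolding c.inverse1[OF q]
    by (simp add: TD_inverse[OF c p] if_distrib[of "\<lambda>z. _ * z"] cong: if_cong)
  finally show "(\<Sum>b\<in>UNIV. (\<Sum>k\<in>UNIV. \<Sum>l\<in>UNIV. ?J a k * cnj (?J b l) * Hc c k l (t, snd c p)) * Gc d m b (t, snd d p))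
    = (if a = m then 1 else 0)" .
qed

text \<open>Every pair in one chart has a counterpart in the other with the same values of both
  forms, so positivity can be checked on the finitely many compact sets alone.\<close>

lemma form_transfer:
  assumes c: "c \<in> A" "d \<in> A" and p: "p \<in> fst c" "p \<in> fst d" and t: "t \<in> TT"
  shows "\<exists>\<xi> u. Mform_at c \<xi> u (t, snd c p) = Mform_at d \<xi>' u' (t, snd d p) \<and> Iform_at c u (t, snd c p) = Iform_at d u' (t, snd d p)"
proof -
  let ?S = "snd c ` (fst c \<inter> fst d)"
  interpret c: hermitian_chart TT "cdom c" "Gc c" "Hc c" by (rule hermitian_chart[OF c(1)])
  have S: "open ?S" "?S \<subseteq> cdom c" using open_overlap[OF c] by (auto simp: cdom_def)
  have ps: "snd c p \<in> ?S" using p by blast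
  have el: "\<exists>q\<in>fst c \<inter> fst d. y = snd c q \<and> chart_inv c y = q" if "y \<in> ?S" for y
    using that c by auto
  have "\<exists>\<xi> u. hermitian_chart.Mform TT ?S (Hc c) \<xi> u (t, snd c p)
      = hermitian_chart.Mform TT (cdom d) (Hc d) \<xi>' u' (t, transition c d (snd c p)) \<and>
    hermitian_chart.Iform (Gc c) (Hc c) u (t, snd c p) = hermitian_chart.Iform (Gc d) (Hc d) u' (t, transition c d (snd c p))"
  proof (rule Mform_transfer[where D = "\<lambda>y. TD c d (chart_inv c y)" and K = "\<lambda>i b. TD d c p (axis b 1) $ i"])
    show "hermitian_chart TT ?S (Gc c) (Hc c)" by (rule c.hermitian_chart_restrict[OF S])
    show "hermitian_chart TT (cdom d) (Gc d) (Hc d)" by (rule hermitian_chart[OF c(2)])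
    show "t \<in> TT" "snd c p \<in> ?S" by (fact t, fact ps)
    show "transition c d y \<in> cdom d" if "y \<in> ?S" for y
      using that c by (auto simp: transition cdom_def)
    show "(transition c d has_derivative TD c d (chart_inv c y)) (at y)" if yS: "y \<in> ?S" for y
    proof -
      obtain q where "q \<in> fst c" "q \<in> fst d" "y = snd c q" "chart_inv c y = q" using el[OF yS] by blast
      then show ?thesis using transition_derivative(1)[OF c, of q] by simp
    qed
    show "TD c d (chart_inv c y) (a *s v) = a *s TD c d (chart_inv c y) v" if yS: "y \<in> ?S" for y a v
    proof -
      obtain q where "q \<in> fst c" "q \<in> fst d" "chart_inv c y = q" using el[OF yS] by blast
      then show ?thesis using transition_derivative(2)[OF c, of q] by simp
    qed
    show "Hc d a b (s, transition c d y) = (\<Sum>k\<in>UNIV. \<Sum>l\<in>UNIV. TD c d (chart_inv c y) (axis k 1) $ a *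
        cnj (TD c d (chart_inv c y) (axis l 1) $ b) * Hc c k l (s, y))" if sT: "s \<in> TT" and yS: "y \<in> ?S" for s y a b
    proof -
      obtain q where "q \<in> fst c" "q \<in> fst d" "y = snd c q" "chart_inv c y = q" using el[OF yS] by blast
      then show ?thesis using Hc_transition[OF c _ _ sT] c by (simp add: transition)
    qed
    show "Gc c i j (t, snd c p) = (\<Sum>a\<in>UNIV. \<Sum>b\<in>UNIV. TD c d (chart_inv c (snd c p)) (axis i 1) $ a *
        cnj (TD c d (chart_inv c (snd c p)) (axis j 1) $ b) * Gc d a b (t, transition c d (snd c p)))" for i j
      using Gc_transition[OF c p t] c p by (simp add: transition)
    show "(\<Sum>i\<in>UNIV. TD c d (chart_inv c (snd c p)) (axis i 1) $ a * TD d c p (axis e 1) $ i) = (if a = e then 1 else 0)" for a e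
      using TD_inverse[OF c p] c p by simp
  qed
  then show ?thesis
    unfolding Mform_at_def Iform_at_def using c.Mform_restrict[OF S] t ps c p by (simp add: transition)
qed

text \<open>For nonzero u the perturbation is positive, and for u = 0 the form is the inverse
  metric. So the perturbed form starts out definite at time 0.\<close>

lemma form_pos:
  assumes c: "c \<in> A" and p: "p \<in> TT \<times> cdom c" and \<eta>: "\<eta> > 0"
    and nonneg: "\<And>\<xi> u. 0 \<le> Re (Mform_at c \<xi> u p)" and nz: "\<xi> \<noteq> (\<lambda>_. 0) \<or> u \<noteq> (\<lambda>_ _. 0)"
  shows "0 < Re (Mform_at c \<xi> u p + of_real \<eta> * Iform_at c u p)"
proof -
  interpret c: hermitian_chart TT "cdom c" "Gc c" "Hc c" by (rule hermitian_chart[OF c])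
  show ?thesis
  proof (cases "u = (\<lambda>_ _. 0)")
    case True
    then show ?thesis
      using nz c.H_pos[OF p, of \<xi>] by (simp add: Mform_at_def Iform_at_def c.Mform_no_u c.Iform_def)
  next
    case False
    then have "0 < \<eta> * Re (Iform_at c u p)" using c.Iform_pos[OF p] \<eta> by (simp add: Iform_at_def)
    then show ?thesis using nonneg[of \<xi> u] by simp
  qed
qed

text \<open>Positive times have a neighbourhood inside the time domain, so there the derivative
  within the domain becomes two-sided.\<close>

lemma flow_in_chart:
  assumes c: "c \<in> A" and x: "x \<in> cdom c" and t: "0 < t" "t \<in> TT"
  shows "((\<lambda>s. Gc c i j (s, x)) has_vector_derivative
      hermitian_chart.flow_rhs_low TT (cdom c) (Gc c) (Hc c) i j (t, x)) (at t)"
    and "((\<lambda>s. Hc c k l (s, x)) has_vector_derivative hermitian_chart.flow_rhs TT (cdom c) (Hc c) k l (t, x)) (at t)"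
proof -
  interpret metric_chart TT "cdom c" "Gc c" "Hc c" "Gm c" by (rule metric_chart[OF c])
  let ?J = "{s. 0 < s} \<inter> ereal -` {..<\<tau>}"
  have J: "open ?J" "?J \<subseteq> TT" "t \<in> ?J"
    using open_times t by (auto simp: time_domain_def)
  have "((\<lambda>s. Gm c s x $ i $ j) has_vector_derivative
       - second_chern_ricci (Gm c t) x i j - torsion_Q (Gm c t) x i j) (at t)" for i j
  proof -
    have "((\<lambda>s. Gm c s x $ i $ j) has_vector_derivative
       - second_chern_ricci (Gm c t) x i j - torsion_Q (Gm c t) x i j) (at t within TT)"
      using hcf c t(2) x unfolding HCF_solution_def cdom_def Gm_def[abs_def] by blast
    then have "((\<lambda>s. Gm c s x $ i $ j) has_vector_derivative
       - second_chern_ricci (Gm c t) x i j - torsion_Q (Gm c t) x i j) (at t within ?J)"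
      by (rule has_vector_derivative_within_subset[OF _ J(2)])
    then show ?thesis using at_within_open[OF J(3,1)] by simp
  qed
  from flow_equations[OF J x this]
  show "((\<lambda>s. Gc c i j (s, x)) has_vector_derivative flow_rhs_low i j (t, x)) (at t)"
    "((\<lambda>s. Hc c k l (s, x)) has_vector_derivative flow_rhs k l (t, x)) (at t)" by blast+
qed

section \<open>Continuity argument in time\<close>

text \<open>A null vector has a nonzero \<open>u\<close>-part, since on \<xi> alone the form is the
  inverse metric. So it can be rescaled to make \<open>u\<close> of norm 1, where the domination
  contradicts \<open>touching_inequality\<close>.\<close>

lemma no_null_vector:
  assumes c: "c \<in> A" and x: "x \<in> cdom c" and t: "0 < t" "t \<in> TT" and \<epsilon>: "\<epsilon> > 0"
    and nonneg: "\<And>s y \<xi> u. 0 \<le> s \<Longrightarrow> s \<le> t \<Longrightarrow> y \<in> cdom c \<Longrightarrow>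
        0 \<le> Re (Mform_at c \<xi> u (s, y) + of_real (\<epsilon> * exp (\<kappa> * s)) * Iform_at c u (s, y))"
    and dominated: "\<And>U :: complex^'n^'n. norm U = 1 \<Longrightarrow> 0 < \<kappa> * Re (Iform_at c (\<lambda>i k. U $ i $ k) (t, x)) +
        Re (hermitian_chart.Err TT (cdom c) (Gc c) (Hc c) (\<epsilon> * exp (\<kappa> * t)) (\<lambda>i k. U $ i $ k) (t, x))"
    and nz: "\<xi> \<noteq> (\<lambda>_. 0) \<or> u \<noteq> (\<lambda>_ _. 0)"
  shows "0 < Re (Mform_at c \<xi> u (t, x) + of_real (\<epsilon> * exp (\<kappa> * t)) * Iform_at c u (t, x))"
proof (rule ccontr)
  interpret c: hermitian_chart TT "cdom c" "Gc c" "Hc c" by (rule hermitian_chart[OF c])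
  let ?\<eta> = "\<epsilon> * exp (\<kappa> * t)"
  assume "\<not> ?thesis"
  moreover have "0 \<le> Re (Mform_at c \<xi> u (t, x) + of_real ?\<eta> * Iform_at c u (t, x))"
    by (rule nonneg) (use t x in auto)
  ultimately have zero: "Re (Mform_at c \<xi> u (t, x) + of_real ?\<eta> * Iform_at c u (t, x)) = 0" by simp
  have p: "(t, x) \<in> TT \<times> cdom c" using t x by simp
  have u: "u \<noteq> (\<lambda>_ _. 0)"
  proof
    assume u: "u = (\<lambda>_ _. 0)"
    then have "\<xi> \<noteq> (\<lambda>_. 0)" using nz by simp
    from c.H_pos[OF p this] show False
      using zero by (simp add: u Mform_at_def Iform_at_def c.Mform_no_u c.Iform_def)
  qed
  define U :: "complex^'n^'n" where "U = (\<chi> i k. u i k)"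
  have U: "U \<noteq> 0" using u by (auto simp: U_def vec_eq_iff fun_eq_iff)
  define r where "r = 1 / norm U"
  have r: "r > 0" using U by (simp add: r_def)
  let ?\<xi> = "\<lambda>k. of_real r * \<xi> k" and ?u = "\<lambda>i k. of_real r * u i k"
  have rU: "norm (r *\<^sub>R U) = 1" using U by (simp add: r_def)
  have ru: "(\<lambda>i k. (r *\<^sub>R U) $ i $ k) = ?u"
  proof (intro ext)
    show "(r *\<^sub>R U) $ i $ k = of_real r * u i k" for i k
      by (simp only: vector_scaleR_component U_def vec_lambda_beta, simp only: scaleR_conv_of_real)
  qed
  have tJ: "t \<in> {s. 0 < s} \<inter> ereal -` {..<\<tau>}" using t by (simp add: time_domain_def)
  have "\<kappa> * Re (c.Iform ?u (t, x)) + Re (c.Err ?\<eta> ?u (t, x)) \<le> 0"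
  proof (rule c.touching_inequality[OF open_times tJ x _ flow_in_chart(1)[OF c x t] \<epsilon>])
    fix s y k l assume s: "s \<in> {s. 0 < s} \<inter> ereal -` {..<\<tau>}" and y: "y \<in> cdom c"
    then show "((\<lambda>s. Hc c k l (s, y)) has_vector_derivative c.flow_rhs k l (s, y)) (at s)"
      by (intro flow_in_chart(2)[OF c y]) (auto simp: time_domain_def)
    show "0 \<le> Re (c.Mform \<xi> u (s, y) + of_real (\<epsilon> * exp (\<kappa> * s)) * c.Iform u (s, y))" if "s \<le> t" for \<xi> u
      using nonneg[of s y \<xi> u] s y that unfolding Mform_at_def Iform_at_def by simp
  next
    show "Re (c.Mform ?\<xi> ?u (t, x) + of_real ?\<eta> * c.Iform ?u (t, x)) = 0"
      unfolding c.form_scale using zero by (simp add: Mform_at_def Iform_at_def)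
  qed
  then show False using dominated[OF rU] unfolding ru Iform_at_def by simp
qed

text \<open>
  \<open>M + \<epsilon> exp(\<kappa> t) I\<close> stays positive definite: the times at which it is not form a set whose
  infimum would be a time of first degeneracy.
\<close>

lemma perturbed_form_nonneg:
  assumes N0: "dual_Nakano_nonneg A (g 0)" and t1: "0 < t1" "ereal t1 < \<tau>"
    and F: "finite F" "\<And>c K. (c, K) \<in> F \<Longrightarrow> c \<in> A \<and> compact K \<and> K \<subseteq> cdom c"
      "\<And>p. p \<in> topspace M \<Longrightarrow> \<exists>(c, K)\<in>F. p \<in> fst c \<and> snd c p \<in> K"
    and \<kappa>: "\<kappa> \<ge> 0" "\<And>c K t x \<eta> U. (c, K) \<in> F \<Longrightarrow> t \<in> {0..t1} \<Longrightarrow> x \<in> K \<Longrightarrow> \<eta> \<in> {0..1} \<Longrightarrow> norm (U :: complex^'n^'n) = 1 \<Longrightarrow>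
        0 < \<kappa> * Re (Iform_at c (\<lambda>i k. U $ i $ k) (t, x)) +
        Re (hermitian_chart.Err TT (cdom c) (Gc c) (Hc c) \<eta> (\<lambda>i k. U $ i $ k) (t, x))"
    and \<epsilon>: "\<epsilon> > 0" "\<epsilon> * exp (\<kappa> * t1) \<le> 1"
    and c: "c \<in> A" and x: "x \<in> cdom c"
  shows "0 \<le> Re (Mform_at c \<xi> u (t1, x) + of_real (\<epsilon> * exp (\<kappa> * t1)) * Iform_at c u (t1, x))"
proof -
  \<comment> \<open>The pair (\<xi>, u) is packed into one vector so that it can be normalised to a
    compact unit sphere.\<close>
  define form where "form c W p = Re (Mform_at c (\<lambda>k. W $ None $ k) (\<lambda>i k. W $ Some i $ k) p
      + of_real (\<epsilon> * exp (\<kappa> * fst p)) * Iform_at c (\<lambda>i k. W $ Some i $ k) p)"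
    for c :: "('a, 'n) chart" and W :: "complex^'n^('n option)" and p
  have form_pack: "form c (\<chi> a k. case a of None \<Rightarrow> \<xi> k | Some i \<Rightarrow> u i k) (t, x) =
      Re (Mform_at c \<xi> u (t, x) + of_real (\<epsilon> * exp (\<kappa> * t)) * Iform_at c u (t, x))" for c \<xi> u t x
    by (simp add: form_def)
  have IT: "{0..t1} \<subseteq> TT" by (rule Icc_time_domain[OF t1(2)])
  define PSDF where "PSDF t \<longleftrightarrow> (\<forall>(c, K)\<in>F. \<forall>x\<in>K. \<forall>W. 0 \<le> form c W (t, x))" for t
  \<comment> \<open>Nonnegativity on the compact sets spreads to all chart domains; the second-order
    condition needs it on an open set.\<close>
  have PSD: "0 \<le> Re (Mform_at c \<xi> u (t, x) + of_real (\<epsilon> * exp (\<kappa> * t)) * Iform_at c u (t, x))"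
    if P: "PSDF t" and t: "t \<in> TT" and c: "c \<in> A" and x: "x \<in> cdom c" for t c x \<xi> u
  proof -
    obtain p where p: "p \<in> fst c" "x = snd c p" using cdom_cases[OF c x] by blast
    obtain d K where d: "(d, K) \<in> F" "p \<in> fst d" "snd d p \<in> K" using F(3)[OF in_topspace[OF c p(1)]] by blast
    have dA: "d \<in> A" using F(2)[OF d(1)] by blast
    obtain \<xi>' u' where eq: "Mform_at d \<xi>' u' (t, snd d p) = Mform_at c \<xi> u (t, x)" "Iform_at d u' (t, snd d p) = Iform_at c u (t, x)"
      using form_transfer[OF dA c d(2) p(1) t, of \<xi> u] p(2) by blast
    have "0 \<le> form d W (t, snd d p)" for W using P d unfolding PSDF_def by blast
    from this[of "\<chi> a k. case a of None \<Rightarrow> \<xi>' k | Some i \<Rightarrow> u' i k"] show ?thesis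
      unfolding form_pack eq .
  qed
  \<comment> \<open>The non-strict inequality keeps this set closed, whereas \<open>Bad\<close>
    records only negative values.\<close>
  define Z where "Z = (\<lambda>(c, K). {z \<in> ({0..t1} \<times> K) \<times> sphere (0 :: complex^'n^('n option)) 1. form c (snd z) (fst z) \<le> 0})"
  have cont: "continuous_on (({0..t1} \<times> K) \<times> Y) (\<lambda>z. form c (snd z) (fst z))"
    if c: "c \<in> A" and K: "K \<subseteq> cdom c" for c K Y
  proof -
    interpret c: hermitian_chart TT "cdom c" "Gc c" "Hc c" by (rule hermitian_chart[OF c])
    have f: "fst z \<in> TT \<times> cdom c" if "z \<in> ({0..t1} \<times> K) \<times> Y" for z
    proof -
      have "{0..t1} \<times> K \<subseteq> TT \<times> cdom c" using K IT by blast
      moreover have "fst z \<in> {0..t1} \<times> K" using that by (simp add: mem_Times_iff)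
      ultimately show ?thesis by (rule subsetD)
    qed
    let ?X = "({0..t1} \<times> K) \<times> Y"
    have W: "continuous_on ?X (\<lambda>z. snd z $ a $ k)" for a k by (intro continuous_intros)
    have M: "continuous_on ?X (\<lambda>z. c.Mform (\<lambda>k. snd z $ None $ k) (\<lambda>i k. snd z $ Some i $ k) (fst z))"
      by (rule c.continuous_on_Mform[OF f W W])
    have I: "continuous_on ?X (\<lambda>z. c.Iform (\<lambda>i k. snd z $ Some i $ k) (fst z))"
      by (rule c.continuous_on_Iform[OF f W])
    have e: "continuous_on ?X (\<lambda>z. complex_of_real (\<epsilon> * exp (\<kappa> * fst (fst z))))"
      by (intro continuous_intros)
    show ?thesis
      unfolding form_def Mform_at_def Iform_at_def
      by (intro continuous_on_Re continuous_on_add continuous_on_mult M I e)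
  qed
  have "closed (fst ` fst ` Z f)" if f: "f \<in> F" for f
  proof -
    obtain c K where [simp]: "f = (c, K)" by (cases f)
    have c: "c \<in> A" "compact K" "K \<subseteq> cdom c" using F(2) f by auto
    let ?X = "({0..t1} \<times> K) \<times> sphere (0 :: complex^'n^('n option)) 1"
    have X: "compact ?X" by (intro compact_Times compact_Icc c compact_sphere)
    have "closedin (top_of_set ?X) (?X \<inter> (\<lambda>z. form c (snd z) (fst z)) -` {..0})"
      by (rule continuous_closedin_preimage[OF cont[OF c(1,3)] closed_atMost])
    then have "compact (?X \<inter> (\<lambda>z. form c (snd z) (fst z)) -` {..0})"
      using X closedin_compact by blast
    moreover have "?X \<inter> (\<lambda>z. form c (snd z) (fst z)) -` {..0} = Z f" by (auto simp: Z_def)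
    ultimately have "compact (Z f)" by simp
    then have "compact (fst ` fst ` Z f)" by (intro compact_continuous_image continuous_intros)
    then show ?thesis by (rule compact_imp_closed)
  qed
  then have closedP: "closed (\<Union>f\<in>F. fst ` fst ` Z f)" using F(1) by (intro closed_UN ballI)
  define Bad where "Bad = {s \<in> {0..t1}. \<not> PSDF s}"
  have Bad_sub: "Bad \<subseteq> (\<Union>f\<in>F. fst ` fst ` Z f)"
  proof
    fix s assume "s \<in> Bad"
    then have s: "s \<in> {0..t1}" and "\<exists>f\<in>F. \<exists>y\<in>snd f. \<exists>W. form (fst f) W (s, y) < 0"
      unfolding Bad_def PSDF_def by (simp_all only: mem_Collect_eq case_prod_beta bex_simps ball_simps not_all not_le)
    then obtain d K y W where d: "(d, K) \<in> F" "y \<in> K" "form d W (s, y) < 0"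
      by (metis prod.collapse)
    have dA: "d \<in> A" using F(2)[OF d(1)] by blast
    interpret d: hermitian_chart TT "cdom d" "Gc d" "Hc d" by (rule hermitian_chart[OF dA])
    have scale: "form d (r *\<^sub>R W) p = r * r * form d W p" for r W p
    proof -
      have e: "(r *\<^sub>R W) $ a $ k = of_real r * (W $ a $ k)" for a k
        by (simp only: vector_scaleR_component, simp only: scaleR_conv_of_real)
      show ?thesis unfolding form_def e Mform_at_def Iform_at_def d.form_scale by simp
    qed
    have W: "W \<noteq> 0" using d(3) scale[of 0 W "(s, y)"] by auto
    have "form d ((1 / norm W) *\<^sub>R W) (s, y) < 0"
      unfolding scale using d(3) W by (simp add: divide_neg_pos)
    then have "((s, y), (1 / norm W) *\<^sub>R W) \<in> Z (d, K)"
      using s d(2) W by (simp add: Z_def)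
    then show "s \<in> (\<Union>f\<in>F. fst ` fst ` Z f)" using d(1) by force
  qed
  have "Bad = {}"
  proof (rule ccontr)
    assume ne: "Bad \<noteq> {}"
    define t where "t = Inf Bad"
    have bdd: "bdd_below Bad" by (rule bdd_belowI[of _ 0]) (auto simp: Bad_def)
    \<comment> \<open>The infimum need not be bad itself, but it belongs to the closed set of times
      at which some unit vector has a nonpositive value.\<close>
    have "t \<in> closure Bad" unfolding t_def by (rule closure_contains_Inf[OF ne bdd])
    then have "t \<in> (\<Union>f\<in>F. fst ` fst ` Z f)" using closure_minimal[OF Bad_sub closedP] by blast
    then obtain d K y W where d: "(d, K) \<in> F" "y \<in> K" "norm W = 1" "form d W (t, y) \<le> 0" and t: "t \<in> {0..t1}"
      by (fastforce simp: Z_def)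
    have dA: "d \<in> A" and K: "K \<subseteq> cdom d" using F(2)[OF d(1)] by blast+
    have y: "y \<in> cdom d" using d K by blast
    have before: "PSDF s" if "0 \<le> s" "s < t" for s
    proof (rule ccontr)
      assume "\<not> PSDF s"
      then have "s \<in> Bad" using that t by (auto simp: Bad_def)
      then show False using cInf_lower[OF _ bdd, of s] that by (simp add: t_def)
    qed
    have nz: "(\<lambda>k. W $ None $ k) \<noteq> (\<lambda>_. 0) \<or> (\<lambda>i k. W $ Some i $ k) \<noteq> (\<lambda>_ _. 0)"
    proof (rule ccontr)
      assume "\<not> ?thesis"
      then have "W $ a $ k = 0" for a k by (cases a) (auto simp: fun_eq_iff)
      then have "W = 0" by (simp add: vec_eq_iff)
      then show False using d(3) by simp
    qed
    show False
    proof (cases "t = 0")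
      \<comment> \<open>At the initial time the hypothesis on \<open>g 0\<close> gives strict
        positivity without use of the flow.\<close>
      case True
      have 0: "0 \<in> TT" using IT t1 by auto
      have "0 < form d W (t, y)"
        unfolding form_def fst_conv
      proof (rule form_pos[OF dA _ _ _ nz])
        show "(t, y) \<in> TT \<times> cdom d" using True 0 y by simp
        show "0 < \<epsilon> * exp (\<kappa> * t)" using \<epsilon> by simp
        show "0 \<le> Re (Mform_at d \<xi> u (t, y))" for \<xi> u
          using N0 dual_Nakano_nonneg_iff[OF 0] dA y True by simp
      qed
      then show False using d(4) by simp
    next
      case False
      then have tpos: "0 < t" using t by simp
      \<comment> \<open>Before \<open>t\<close> the form is nonnegative everywhere; continuity in
        time extends this to \<open>t\<close> itself.\<close>
      have now: "0 \<le> Re (Mform_at d \<xi> u (s, z) + of_real (\<epsilon> * exp (\<kappa> * s)) * Iform_at d u (s, z))"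
        if s: "0 \<le> s" "s \<le> t" and z: "z \<in> cdom d" for s z \<xi> u
      proof -
        let ?W = "(\<chi> a k. case a of None \<Rightarrow> \<xi> k | Some i \<Rightarrow> u i k) :: complex^'n^('n option)"
        have c: "continuous_on {0..t} (\<lambda>s. form d ?W (s, z))"
          by (rule continuous_on_compose2[OF cont[OF dA, of "{z}" UNIV], of _ "\<lambda>s. ((s, z), ?W)", simplified])
             (use z t in \<open>auto intro!: continuous_intros\<close>)
        have "0 \<le> form d ?W (s, z)"
        proof (rule continuous_ge_on_closure[of "{0..<t}" "\<lambda>s. form d ?W (s, z)"])
          show "continuous_on (closure {0..<t}) (\<lambda>s. form d ?W (s, z))" using c tpos by simp
          show "s \<in> closure {0..<t}" using s tpos by simp
          fix r assume r: "r \<in> {0..<t}"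
          then have "r \<in> TT" using t IT by auto
          then show "0 \<le> form d ?W (r, z)"
            using PSD[OF before _ dA z, of r \<xi> u] r unfolding form_pack by simp
        qed
        then show ?thesis unfolding form_pack .
      qed
      have tT: "t \<in> TT" using t IT by blast
      have "exp (\<kappa> * t) \<le> exp (\<kappa> * t1)" using t \<kappa>(1) by (simp add: mult_left_mono)
      then have "\<epsilon> * exp (\<kappa> * t) \<le> 1" using \<epsilon> by (smt (verit) mult_left_mono)
      then have \<eta>: "\<epsilon> * exp (\<kappa> * t) \<in> {0..1}" using \<epsilon> by simp
      have "0 < form d W (t, y)"
        unfolding form_def fst_conv
        by (rule no_null_vector[OF dA y tpos tT \<epsilon>(1) now \<kappa>(2)[OF d(1) t d(2) \<eta>] nz])
      then show False using d(4) by simp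
    qed
  qed
  then have "PSDF t1" using t1 by (auto simp: Bad_def)
  moreover have "t1 \<in> TT" using IT t1(1) by (auto dest: subsetD[of _ _ t1])
  ultimately show ?thesis by (rule PSD[OF _ _ c x])
qed

lemma dual_Nakano_nonneg_preserved:
  assumes N0: "dual_Nakano_nonneg A (g 0)" and t: "0 < t" "ereal t < \<tau>"
  shows "dual_Nakano_nonneg A (g t)"
proof -
  obtain F where F: "finite F" "\<And>c K. (c, K) \<in> F \<Longrightarrow> c \<in> A \<and> compact K \<and> K \<subseteq> cdom c"
    "\<And>p. p \<in> topspace M \<Longrightarrow> \<exists>(c, K)\<in>F. p \<in> fst c \<and> snd c p \<in> K"
    by (rule finite_chart_cover[OF compact]) (rule that)
  have IT: "{0..t} \<subseteq> TT" by (rule Icc_time_domain[OF t(2)])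
  define dom_by where "dom_by f \<kappa> \<longleftrightarrow> (\<forall>s\<in>{0..t}. \<forall>x\<in>snd f. \<forall>\<eta>\<in>{0..1}. \<forall>U :: complex^'n^'n. norm U = 1 \<longrightarrow>
      0 < \<kappa> * Re (Iform_at (fst f) (\<lambda>i k. U $ i $ k) (s, x)) +
        Re (hermitian_chart.Err TT (cdom (fst f)) (Gc (fst f)) (Hc (fst f)) \<eta> (\<lambda>i k. U $ i $ k) (s, x)))"
    for f and \<kappa> :: real
  have "\<exists>\<kappa>0\<ge>0. \<forall>\<kappa>\<ge>\<kappa>0. dom_by f \<kappa>" if f: "f \<in> F" for f
  proof -
    have c: "fst f \<in> A" "compact (snd f)" "snd f \<subseteq> cdom (fst f)" using f F(2)[of "fst f" "snd f"] by auto
    interpret c: hermitian_chart TT "cdom (fst f)" "Gc (fst f)" "Hc (fst f)" by (rule hermitian_chart[OF c(1)])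
    show ?thesis
      unfolding Iform_at_def dom_by_def by (rule c.Err_dominated[OF compact_Icc IT c(2,3)])
  qed
  then obtain \<kappa>0 where \<kappa>0: "\<And>f. f \<in> F \<Longrightarrow> \<kappa>0 f \<ge> (0::real)" "\<And>f \<kappa>. f \<in> F \<Longrightarrow> \<kappa> \<ge> \<kappa>0 f \<Longrightarrow> dom_by f \<kappa>"
    by metis
  \<comment> \<open>A common bound for the finitely many charts: the sum dominates each of its
    nonnegative terms.\<close>
  define \<kappa> where "\<kappa> = (\<Sum>f\<in>F. \<kappa>0 f)"
  have \<kappa>: "\<kappa> \<ge> 0" "\<And>f. f \<in> F \<Longrightarrow> \<kappa>0 f \<le> \<kappa>"
    unfolding \<kappa>_def using \<kappa>0(1) F(1) by (auto intro: sum_nonneg member_le_sum)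
  have cdom: "0 < \<kappa> * Re (Iform_at c (\<lambda>i k. U $ i $ k) (s, x)) +
        Re (hermitian_chart.Err TT (cdom c) (Gc c) (Hc c) \<eta> (\<lambda>i k. U $ i $ k) (s, x))"
    if "(c, K) \<in> F" "s \<in> {0..t}" "x \<in> K" "\<eta> \<in> {0..1}" "norm (U :: complex^'n^'n) = 1" for c K s x \<eta> U
    using \<kappa>0(2)[OF that(1) \<kappa>(2)[OF that(1)]] that(2-) unfolding dom_by_def by simp
  have tT: "t \<in> TT" using IT t by auto
  show ?thesis
    unfolding dual_Nakano_nonneg_iff[OF tT]
  proof (intro ballI allI)
    fix c x \<xi> u assume c: "c \<in> A" and x: "x \<in> cdom c"
    let ?m = "Re (Mform_at c \<xi> u (t, x))" and ?b = "Re (Iform_at c u (t, x))"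
    show "0 \<le> ?m"
    proof (rule field_le_epsilon)
      fix e :: real assume e: "e > 0"
      \<comment> \<open>The size of the perturbation at time \<open>t\<close>: at most 1, as the
        domination requires, and small enough to contribute at most \<open>e\<close>.\<close>
      define \<eta> where "\<eta> = min 1 (e / (\<bar>?b\<bar> + 1))"
      have \<eta>: "0 < \<eta>" "\<eta> \<le> 1" "\<eta> \<le> e / (\<bar>?b\<bar> + 1)" using e by (auto simp: \<eta>_def)
      have "\<eta> * ?b \<le> \<eta> * (\<bar>?b\<bar> + 1)" using \<eta>(1) by (intro mult_left_mono) auto
      also have "\<dots> \<le> e" using \<eta>(3) by (simp add: pos_le_divide_eq)
      finally have b: "\<eta> * ?b \<le> e" .
      \<comment> \<open>Starting with \<epsilon> equal to
        \<open>\<eta> * exp (- (\<kappa> * t))\<close> makes the perturbation reach size \<eta>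
        exactly at time \<open>t\<close>.\<close>
      have ee: "\<eta> * exp (- (\<kappa> * t)) * exp (\<kappa> * t) = \<eta>" by (simp add: exp_minus)
      have "0 \<le> Re (Mform_at c \<xi> u (t, x) + of_real (\<eta> * exp (- (\<kappa> * t)) * exp (\<kappa> * t)) * Iform_at c u (t, x))"
      proof (rule perturbed_form_nonneg[OF N0 t F \<kappa>(1) cdom _ _ c x])
        show "0 < \<eta> * exp (- (\<kappa> * t))" using \<eta> by simp
        show "\<eta> * exp (- (\<kappa> * t)) * exp (\<kappa> * t) \<le> 1" unfolding ee by (rule \<eta>(2))
      qed
      then show "0 \<le> ?m + e" unfolding ee using b by simp
    qed
  qed
qed

end

theorem mainTheorem6:
  fixes M :: "'a topology" and A :: "('a, 'n::finite) chart set"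
    and g :: "real \<Rightarrow> ('a, 'n) metric_field" and \<tau> :: ereal
  assumes "complex_manifold M A" and "compact_space M"
    and "0 < \<tau>" and "HCF_solution M A \<tau> g"
    and "dual_Nakano_nonneg A (g 0)"
  shows "\<forall>t. 0 < t \<and> ereal t < \<tau> \<longrightarrow> dual_Nakano_nonneg A (g t)"
proof (intro allI impI)
  fix t assume t: "0 < t \<and> ereal t < \<tau>"
  interpret hcf_manifold M A \<tau> g by unfold_locales (fact assms)+
  show "dual_Nakano_nonneg A (g t)"
    using dual_Nakano_nonneg_preserved assms(5) t by blast
qed

end
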